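(* Consider a linear network of $L\ge 2$ links of capacity $1$. If $\rho_k<1$ for all $2\le k\le L$ and $$\rho_0<\inf\{\bar\phi_0(x):\ x\in[0,1],\ 1-\rho_1\le x\le 1\},$$ then the network is stable, i.e. the Markov process $(N(t))$ is ergodic.
   Context: Linear network: there are $L$ links labelled $1,\dots,L$, each of capacity $1$, and $K=L+1$ classes of flows $0,1,\dots,L$. Class $0$ goes through links $1,2,\dots,L$ in this order; class $l$ ($1\le l\le L$) goes through link $l$ only. Class-$k$ flows arrive according to a Poisson process of intensity $\lambda_k>0$, have independent exponentially distributed sizes with mean $1/\mu_k$ ($\mu_k>0$), and access rate $a_k>0$; $\rho_k=\lambda_k/\mu_k$. For $x=(x_0,\dots,x_L)\in\mathbb{R}_+^{L+1}$ define $\theta_0^0(x)=x_0$ and, for $1\le k\le L$, $$\theta_0^k(x)=\min\Big(\theta_0^{k-1}(x),\tfrac{\theta_0^{k-1}(x)}{\theta_0^{k-1}(x)+x_k}\Big),\qquad \psi_k(x)=\min\Big(x_k,\tfrac{x_k}{\theta_0^{k-1}(x)+x_k}\Big),$$ and $\psi_0(x)=\theta_0^L(x)$ (with the convention that each minimum is $0$ when its denominator is $0$). Put $\phi_k(n)=\psi_k(a_0n_0,\dots,a_Ln_L)$ for $n\in\mathbb{N}^{L+1}$. $(N(t))$ is the Markov jump process on $\mathbb{N}^{L+1}$ with transitions $n\to n+e_k$ at rate $\lambda_k$ and $n\to n-e_k$ at rate $\mu_k\phi_k(n)$, $0\le k\le L$ ($e_k$ is the unit vector of coordinate $k$). Ergodic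 means positive recurrent. Quasi-stationary process: for $\alpha\in[0,1]$ and $x_{2:L}=(x_2,\dots,x_L)\in\mathbb{R}_+^{L-1}$ let $\tilde\theta_0^1(\alpha,x_{2:L})=\alpha$ and, for $2\le k\le L$, $$\tilde\theta_0^k=\min\Big(\tilde\theta_0^{k-1},\tfrac{\tilde\theta_0^{k-1}}{\tilde\theta_0^{k-1}+x_k}\Big),\quad \tilde\psi_k(\alpha,x_{2:L})=\min\Big(x_k,\tfrac{x_k}{\tilde\theta_0^{k-1}+x_k}\Big),\quad \tilde\psi_0(\alpha,x_{2:L})=\tilde\theta_0^L(\alpha,x_{2:L})$$ (same convention), and $\tilde\phi_k(\alpha,n_{2:L})=\tilde\psi_k(\alpha,(a_2n_2,\dots,a_Ln_L))$ for $n_{2:L}\in\mathbb{N}^{L-1}$. Let $(\tilde N^\alpha_{2:L}(t))$ be the Markov jump process on $\mathbb{N}^{L-1}$ in which, for $2\le k\le L$, $n_k\to n_k+1$ at rate $\lambda_k$ and $n_k\to n_k-1$ at rate $\mu_k\tilde\phi_k(\alpha,n_{2:L})$. When $\rho_k<1$ for $2\le k\le L$ it is ergodic; $\tilde\pi^\alpha$ denotes its stationary distribution and $$\bar\phi_0(\alpha)=\sum_{n_{2:L}\in\mathbb{N}^{L-1}}\tilde\pi^\alpha(n_{2:L})\,\tilde\phi_0(\alpha,n_{2:L}),\qquad \alpha\in[0,1].$$ *)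

theory Defs
  imports "HOL-Probability.Probability"
begin

section \<open>Markov jump processes with given transition rates\<close>

text \<open>
  A jump process on a countable state space \<open>S\<close> is given by its rates \<open>q i j\<close> for
  \<open>i \<noteq> j\<close>; diagonal values of \<open>q\<close> are ignored.
\<close>

definition exit_rate :: "'s set \<Rightarrow> ('s \<Rightarrow> 's \<Rightarrow> real) \<Rightarrow> 's \<Rightarrow> real" where
  "exit_rate S q i = (\<Sum>\<^sub>\<infinity>j\<in>S - {i}. q i j)"

text \<open>
  Jump chain and holding times: \<open>Y\<close> is the sequence of visited states, a Markov chain with
  transition probabilities \<open>q i j / exit_rate S q i\<close>, and, given \<open>Y\<close>, the holding times \<open>H n\<close>
  are independent and exponential with parameters \<open>exit_rate S q (Y n)\<close>. The product formula
  determines the joint law of \<open>Y\<close> and \<open>H\<close> from that of \<open>Y 0\<close>. It is meant for rates without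
  absorbing states (every exit rate is positive). If the jump times accumulate, the path
  after their limit is left unspecified; this has probability 0 when the exit rates are bounded.
\<close>

definition markov_jump_process ::
  "'w measure \<Rightarrow> 's set \<Rightarrow> ('s \<Rightarrow> 's \<Rightarrow> real) \<Rightarrow> (real \<Rightarrow> 'w \<Rightarrow> 's) \<Rightarrow> bool" where
  "markov_jump_process M S q N \<longleftrightarrow>
     prob_space M \<and>
     (\<forall>t\<ge>0. N t \<in> measurable M (count_space S)) \<and>
     (\<exists>(Y :: nat \<Rightarrow> 'w \<Rightarrow> 's) (H :: nat \<Rightarrow> 'w \<Rightarrow> real).
        (\<forall>n. Y n \<in> measurable M (count_space S)) \<and>
        (\<forall>n. H n \<in> borel_measurable M) \<and>
        (\<forall>n i t. (\<forall>k\<le>n. i k \<in> S \<and> 0 \<le> t k) \<longrightarrow>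
           measure M {\<omega> \<in> space M. \<forall>k\<le>n. Y k \<omega> = i k \<and> t k < H k \<omega>} =
             measure M {\<omega> \<in> space M. Y 0 \<omega> = i 0}
             * (\<Prod>k<n. (if i (Suc k) = i k then 0 else q (i k) (i (Suc k)) / exit_rate S q (i k)))
             * (\<Prod>k\<le>n. exp (- exit_rate S q (i k) * t k))) \<and>
        (AE \<omega> in M. \<forall>n t. (\<Sum>k<n. H k \<omega>) \<le> t \<and> t < (\<Sum>k<Suc n. H k \<omega>) \<longrightarrow> N t \<omega> = Y n \<omega>))"

text \<open>\<open>P i\<close> is the law under which the process starts in \<open>i\<close>.\<close>

definition markov_jump_family ::
  "'s set \<Rightarrow> ('s \<Rightarrow> 's \<Rightarrow> real) \<Rightarrow> ('s \<Rightarrow> 'w measure) \<Rightarrow> (real \<Rightarrow> 'w \<Rightarrow> 's) \<Rightarrow> bool" where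
  "markov_jump_family S q P N \<longleftrightarrow>
     (\<forall>i\<in>S. markov_jump_process (P i) S q N \<and> (AE \<omega> in P i. N 0 \<omega> = i))"

text \<open>Infima of times are taken in \<open>ennreal\<close>, so that the infimum of the empty set is \<open>\<infinity>\<close>.\<close>

definition first_jump_time :: "(real \<Rightarrow> 'w \<Rightarrow> 's) \<Rightarrow> 'w \<Rightarrow> ennreal" where
  "first_jump_time N \<omega> = (INF t\<in>{t. 0 \<le> t \<and> N t \<omega> \<noteq> N 0 \<omega>}. ennreal t)"

definition return_time :: "(real \<Rightarrow> 'w \<Rightarrow> 's) \<Rightarrow> 's \<Rightarrow> 'w \<Rightarrow> ennreal" where
  "return_time N i \<omega> =
     (INF t\<in>{t. 0 \<le> t \<and> first_jump_time N \<omega> \<le> ennreal t \<and> N t \<omega> = i}. ennreal t)"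

definition positive_recurrent ::
  "'s set \<Rightarrow> ('s \<Rightarrow> 'w measure) \<Rightarrow> (real \<Rightarrow> 'w \<Rightarrow> 's) \<Rightarrow> bool" where
  "positive_recurrent S P N \<longleftrightarrow> (\<forall>i\<in>S. (\<integral>\<^sup>+\<omega>. return_time N i \<omega> \<partial>P i) < \<infinity>)"

text \<open>Stationarity as \<open>\<pi> Q = 0\<close>, \<open>Q\<close> being the rate matrix.\<close>

definition stationary_distribution ::
  "'s set \<Rightarrow> ('s \<Rightarrow> 's \<Rightarrow> real) \<Rightarrow> 's pmf \<Rightarrow> bool" where
  "stationary_distribution S q \<pi> \<longleftrightarrow>
     set_pmf \<pi> \<subseteq> S \<and>
     (\<forall>j\<in>S. ((\<lambda>i. pmf \<pi> i * q i j) has_sum (pmf \<pi> j * exit_rate S q j)) (S - {j}))"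


section \<open>Flow counts\<close>

text \<open>
  \<open>\<nat>\<close>-valued vectors indexed by a finite set \<open>K\<close> of classes, as functions vanishing off \<open>K\<close>.
\<close>

definition states :: "nat set \<Rightarrow> (nat \<Rightarrow> nat) set" where
  "states K = {n. \<forall>k. k \<notin> K \<longrightarrow> n k = 0}"

text \<open>Arrivals \<open>n \<rightarrow> n + e\<^sub>k\<close> at rate \<open>lam k\<close>, departures \<open>n \<rightarrow> n - e\<^sub>k\<close> at rate \<open>mu k * phi k n\<close>.\<close>

definition flow_rates ::
  "nat set \<Rightarrow> (nat \<Rightarrow> real) \<Rightarrow> (nat \<Rightarrow> real) \<Rightarrow> (nat \<Rightarrow> (nat \<Rightarrow> nat) \<Rightarrow> real)
    \<Rightarrow> (nat \<Rightarrow> nat) \<Rightarrow> (nat \<Rightarrow> nat) \<Rightarrow> real" where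
  "flow_rates K lam mu phi n m =
     (\<Sum>k\<in>K. (if m = n(k := n k + 1) then lam k else 0)
            + (if n = m(k := m k + 1) then mu k * phi k n else 0))"


section \<open>The linear network\<close>

text \<open>
  In all the quotients below, a vanishing denominator makes the minimum 0, because \<open>x / 0 = 0\<close>
  and all arguments are nonnegative.
\<close>

fun theta0 :: "(nat \<Rightarrow> real) \<Rightarrow> nat \<Rightarrow> real" where
  "theta0 x 0 = x 0"
| "theta0 x (Suc k) = min (theta0 x k) (theta0 x k / (theta0 x k + x (Suc k)))"

definition psi :: "nat \<Rightarrow> nat \<Rightarrow> (nat \<Rightarrow> real) \<Rightarrow> real" where
  "psi L k x = (if k = 0 then theta0 x L else min (x k) (x k / (theta0 x (k - 1) + x k)))"

definition phi :: "nat \<Rightarrow> (nat \<Rightarrow> real) \<Rightarrow> nat \<Rightarrow> (nat \<Rightarrow> nat) \<Rightarrow> real" where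
  "phi L a k n = psi L k (\<lambda>j. a j * real (n j))"

definition network_rates ::
  "nat \<Rightarrow> (nat \<Rightarrow> real) \<Rightarrow> (nat \<Rightarrow> real) \<Rightarrow> (nat \<Rightarrow> real) \<Rightarrow> (nat \<Rightarrow> nat) \<Rightarrow> (nat \<Rightarrow> nat) \<Rightarrow> real" where
  "network_rates L lam mu a = flow_rates {0..L} lam mu (phi L a)"


section \<open>The quasi-stationary process\<close>

text \<open>The value at index 0 is a dummy; the recursion starts at index 1.\<close>

fun qs_theta0 :: "real \<Rightarrow> (nat \<Rightarrow> real) \<Rightarrow> nat \<Rightarrow> real" where
  "qs_theta0 \<alpha> x 0 = \<alpha>"
| "qs_theta0 \<alpha> x (Suc 0) = \<alpha>"
| "qs_theta0 \<alpha> x (Suc (Suc k)) =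
     min (qs_theta0 \<alpha> x (Suc k))
         (qs_theta0 \<alpha> x (Suc k) / (qs_theta0 \<alpha> x (Suc k) + x (Suc (Suc k))))"

definition qs_psi :: "nat \<Rightarrow> real \<Rightarrow> nat \<Rightarrow> (nat \<Rightarrow> real) \<Rightarrow> real" where
  "qs_psi L \<alpha> k x =
     (if k = 0 then qs_theta0 \<alpha> x L else min (x k) (x k / (qs_theta0 \<alpha> x (k - 1) + x k)))"

definition qs_phi :: "nat \<Rightarrow> (nat \<Rightarrow> real) \<Rightarrow> real \<Rightarrow> nat \<Rightarrow> (nat \<Rightarrow> nat) \<Rightarrow> real" where
  "qs_phi L a \<alpha> k n = qs_psi L \<alpha> k (\<lambda>j. a j * real (n j))"

definition qs_rates ::
  "nat \<Rightarrow> (nat \<Rightarrow> real) \<Rightarrow> (nat \<Rightarrow> real) \<Rightarrow> (nat \<Rightarrow> real) \<Rightarrow> real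
    \<Rightarrow> (nat \<Rightarrow> nat) \<Rightarrow> (nat \<Rightarrow> nat) \<Rightarrow> real" where
  "qs_rates L lam mu a \<alpha> = flow_rates {2..L} lam mu (qs_phi L a \<alpha>)"

definition qs_distribution ::
  "nat \<Rightarrow> (nat \<Rightarrow> real) \<Rightarrow> (nat \<Rightarrow> real) \<Rightarrow> (nat \<Rightarrow> real) \<Rightarrow> real \<Rightarrow> (nat \<Rightarrow> nat) pmf" where
  "qs_distribution L lam mu a \<alpha> =
     (THE \<pi>. stationary_distribution (states {2..L}) (qs_rates L lam mu a \<alpha>) \<pi>)"

definition mean_phi0 ::
  "nat \<Rightarrow> (nat \<Rightarrow> real) \<Rightarrow> (nat \<Rightarrow> real) \<Rightarrow> (nat \<Rightarrow> real) \<Rightarrow> real \<Rightarrow> real" where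
  "mean_phi0 L lam mu a \<alpha> =
     (\<Sum>\<^sub>\<infinity>n\<in>states {2..L}. pmf (qs_distribution L lam mu a \<alpha>) n * qs_phi L a \<alpha> 0 n)"

end

theory Submission imports Defs begin

text \<open>
  Given the ratio \<open>\<alpha> = \<theta>\<^sub>0\<^sup>1\<close>, the classes \<open>2, \<dots>, L\<close> evolve exactly as the quasi-stationary process of
  parameter \<open>\<alpha>\<close>, and when the classes 0 and 1 hold many flows a jump hardly changes \<open>\<alpha>\<close>. Put
  \<open>\<alpha>\<^sub>* = 1 - \<rho>\<^sub>1\<close>. Class 1 drains while \<open>\<alpha> < \<alpha>\<^sub>*\<close>. Class 0 drains on average while \<open>\<alpha> \<ge> \<alpha>\<^sub>* - \<delta>\<close>, because
  the lower bound \<open>\<rho>\<^sub>0 < mean_phi0 \<alpha>\<close> on \<open>[\<alpha>\<^sub>*, 1]\<close> persists slightly to the left of \<open>\<alpha>\<^sub>*\<close>. Hence a smoothed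
  maximum of \<open>n\<^sub>0\<close> and \<open>\<kappa> n\<^sub>1\<close>, with its kink on the ray \<open>\<alpha> = \<alpha>\<^sub>* - \<delta>\<close>, is a Lyapunov function up to two
  corrections. The service rate of class 0 is replaced by its mean by adding an approximate solution
  of the Poisson equation of the fast classes, \<open>- 1/(\<Lambda> T) \<Sum>\<^sub>s\<^sub><\<^sub>T \<Sum>\<^sub>t\<^sub>\<le>\<^sub>s P\<^sup>t \<phi>\<^sub>0\<close> for the uniformised chain \<open>P\<close>,
  whose generator image is \<open>\<phi>\<^sub>0\<close> minus a Cesaro average over \<open>T\<close> steps; it is bounded and Lipschitz
  in \<open>\<alpha>\<close>. A small multiple of \<open>\<Sum>\<^sub>k n\<^sub>k\<^sup>2\<close> over \<open>k \<ge> 2\<close> absorbs the states in which the Cesaro average has not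
  yet settled. The Cesaro averages are tight and their cluster points are stationary, so that
  uniqueness of the stationary distribution makes them eventually exceed \<open>mean_phi0 \<alpha> - \<epsilon>\<close>.
\<close>

section \<open>The jump chain and its return times\<close>

text \<open>Of \<open>mean_phi0\<close> only a one-sided local bound is used: near \<alpha>0, long
  Cesaro averages exceed \<open>mean_phi0\<close> at \<alpha>0 minus an arbitrarily small constant.
  Continuity of the stationary law in \<alpha> is never established. One horizon \<open>T0\<close>
  at \<alpha>0 suffices: finite powers of the uniformised chain are Lipschitz in \<alpha>, uniformly
  in the state, and the corrector of horizon \<open>T0\<close> plus a small multiple of the squares
  carries the bound to all later horizons. The obstacle is that the averages settle uniformly only
  over bounded fast populations. It dictates the order of the constants: cone, slope, gain
  \<open>eps\<close>, weight \<open>c\<close> of the squares, cutoff \<open>y\<close>, horizon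
  \<open>T\<close>, then the smoothing width \<open>R\<close> (a jump moves the ramp weight of a
  corrector of size \<open>T\<close>, an error of order \<open>T / R\<close>), and last the size of
  the slow classes (the ratio moves the corrector by order \<open>T^2\<close> over that size).
  Recurrence asks for the mean return to one prescribed state rather than to a finite set, so the
  drift function is completed by survival probabilities of the chain killed at that state.\<close>

definition jump_prob :: "'s set \<Rightarrow> ('s \<Rightarrow> 's \<Rightarrow> real) \<Rightarrow> 's \<Rightarrow> 's \<Rightarrow> real" where
  "jump_prob S q x y = (if y = x then 0 else q x y / exit_rate S q x)"

lemma nn_integral_count_space_Times:
  fixes f :: "'a \<times> 'b \<Rightarrow> ennreal"
  shows "(\<integral>\<^sup>+z. f z \<partial>count_space (A \<times> B)) =
    (\<integral>\<^sup>+x. \<integral>\<^sup>+y. f (x, y) \<partial>count_space B \<partial>count_space A)"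
proof -
  have "(\<integral>\<^sup>+z. f z \<partial>count_space (A \<times> B)) = (\<integral>\<^sup>+z. f z * indicator (A \<times> B) z \<partial>count_space UNIV)"
    by (rule nn_integral_count_space_indicator) simp
  also have "\<dots> = (\<integral>\<^sup>+x. \<integral>\<^sup>+y. f (x, y) * indicator (A \<times> B) (x, y) \<partial>count_space UNIV \<partial>count_space UNIV)"
    by (rule nn_integral_fst_count_space[symmetric])
  also have "\<dots> = (\<integral>\<^sup>+x. (\<integral>\<^sup>+y. f (x, y) * indicator B y \<partial>count_space UNIV) * indicator A x \<partial>count_space UNIV)"
    by (intro nn_integral_cong) (auto simp: indicator_def)
  also have "\<dots> = (\<integral>\<^sup>+x. \<integral>\<^sup>+y. f (x, y) \<partial>count_space B \<partial>count_space A)"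
    by (simp add: nn_integral_count_space_indicator)
  finally show ?thesis .
qed

text \<open>The bound \<open>c\<close> keeps all mean holding times below one constant. Explosion
  does no harm: a path is followed only up to its return to \<open>i\<close>, hence through finitely
  many jumps.\<close>

locale jump_chain = prob_space M for M :: "'w measure" +
  fixes S :: "'s set" and q :: "'s \<Rightarrow> 's \<Rightarrow> real"
    and Y :: "nat \<Rightarrow> 'w \<Rightarrow> 's" and H :: "nat \<Rightarrow> 'w \<Rightarrow> real" and i :: 's and c :: real
  assumes countable_S: "countable S"
    and Y_measurable[measurable]: "\<And>n. Y n \<in> measurable M (count_space S)"
    and H_measurable[measurable]: "\<And>n. H n \<in> borel_measurable M"
    and law: "\<And>n s t. (\<And>k. k \<le> n \<Longrightarrow> s k \<in> S \<and> 0 \<le> t k) \<Longrightarrow>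
           prob {\<omega> \<in> space M. \<forall>k\<le>n. Y k \<omega> = s k \<and> t k < H k \<omega>} =
             prob {\<omega> \<in> space M. Y 0 \<omega> = s 0}
             * (\<Prod>k<n. jump_prob S q (s k) (s (Suc k)))
             * (\<Prod>k\<le>n. exp (- exit_rate S q (s k) * t k))"
    and i_in_S: "i \<in> S"
    and start: "AE \<omega> in M. Y 0 \<omega> = i"
    and jump_prob_nonneg: "\<And>x y. x \<in> S \<Longrightarrow> y \<in> S \<Longrightarrow> 0 \<le> jump_prob S q x y"
    and jump_prob_total: "\<And>x. x \<in> S \<Longrightarrow> (\<integral>\<^sup>+y. ennreal (jump_prob S q x y) \<partial>count_space S) = 1"
    and c_pos: "0 < c"
    and exit_rate_ge: "\<And>x. x \<in> S \<Longrightarrow> c \<le> exit_rate S q x"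
begin

text \<open>Only the paths that stay in \<open>B\<close> after time 0 are counted: \<open>B = S\<close> gives the whole chain,
  \<open>B = S - {i}\<close> the chain killed at its return to \<open>i\<close>.\<close>

definition paths :: "'s set \<Rightarrow> nat \<Rightarrow> (nat \<Rightarrow> 's) set" where
  "paths B n = {s \<in> PiE {..n} (\<lambda>_. S). \<forall>k. 1 \<le> k \<and> k \<le> n \<longrightarrow> s k \<in> B}"

definition weight :: "nat \<Rightarrow> (nat \<Rightarrow> 's) \<Rightarrow> real" where
  "weight n s = prob {\<omega> \<in> space M. Y 0 \<omega> = s 0} * (\<Prod>k<n. jump_prob S q (s k) (s (Suc k)))"

text \<open>The n-th power of the jump kernel restricted to \<open>B\<close>, applied to
  \<open>f\<close> and evaluated at the start; in other words the mean of \<open>f (Y n)\<close> on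
  the event that \<open>Y 1, ..., Y n\<close> lie in \<open>B\<close>.\<close>

definition path_sum :: "'s set \<Rightarrow> nat \<Rightarrow> ('s \<Rightarrow> ennreal) \<Rightarrow> ennreal" where
  "path_sum B n f = (\<integral>\<^sup>+s. ennreal (weight n s) * f (s n) \<partial>count_space (paths B n))"

text \<open>\<open>law\<close> speaks only of events \<open>t k < H k\<close> with nonnegative
  \<open>t k\<close>, so positivity of the holding times has to be part of the event.
  \<open>AE_holding_pos\<close> shows that this costs nothing.\<close>

definition stays :: "'s set \<Rightarrow> nat \<Rightarrow> 'w set" where
  "stays B n = {\<omega> \<in> space M. \<forall>k\<le>n. 0 < H k \<omega> \<and> (1 \<le> k \<longrightarrow> Y k \<omega> \<in> B)}"

lemma countable_paths: "countable (paths B n)"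
proof -
  have "countable (PiE {..n} (\<lambda>_. S))"
    using countable_S by (intro countable_PiE) auto
  then show ?thesis
    by (rule countable_subset[rotated]) (auto simp: paths_def)
qed

lemma paths_in_S: "s \<in> paths B n \<Longrightarrow> k \<le> n \<Longrightarrow> s k \<in> S"
  by (auto simp: paths_def PiE_iff)

lemma weight_nonneg: "s \<in> paths B n \<Longrightarrow> 0 \<le> weight n s"
  unfolding weight_def
  by (intro mult_nonneg_nonneg prod_nonneg ballI jump_prob_nonneg paths_in_S[of s B n]) auto

lemma stays_measurable[measurable]: "B \<subseteq> S \<Longrightarrow> stays B n \<in> events"
proof -
  assume "B \<subseteq> S"
  then have [measurable]: "Measurable.pred M (\<lambda>\<omega>. Y k \<omega> \<in> B)" for k
    by (intro pred_sets2[OF _ Y_measurable]) auto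
  show ?thesis
    unfolding stays_def by measurable
qed

lemma emeasure_stays_less:
  assumes "B \<subseteq> S" "0 \<le> t"
  shows "emeasure M {\<omega> \<in> stays B n. t < H n \<omega>} =
    path_sum B n (\<lambda>x. ennreal (exp (- exit_rate S q x * t)))"
proof -
  \<comment> \<open>Only the last holding time gets a threshold; the others get 0, which contributes
    the factor 1 and the condition \<open>0 < H k\<close>.\<close>
  define tt where "tt k = (if k = n then t else 0)" for k
  define X where "X s = {\<omega> \<in> space M. \<forall>k\<le>n. Y k \<omega> = s k \<and> tt k < H k \<omega>}" for s
  have eq: "{\<omega> \<in> stays B n. t < H n \<omega>} = (\<Union>s\<in>paths B n. X s)"
  proof (intro set_eqI iffI)
    fix \<omega> assume \<omega>: "\<omega> \<in> {\<omega> \<in> stays B n. t < H n \<omega>}"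
    then have sp: "\<omega> \<in> space M" by (auto simp: stays_def)
    have "restrict (\<lambda>k. Y k \<omega>) {..n} \<in> paths B n"
      using \<omega> measurable_space[OF Y_measurable sp] by (auto simp: paths_def stays_def)
    moreover have "\<omega> \<in> X (restrict (\<lambda>k. Y k \<omega>) {..n})"
      using \<omega> by (auto simp: X_def stays_def tt_def)
    ultimately show "\<omega> \<in> (\<Union>s\<in>paths B n. X s)" by blast
  next
    fix \<omega> assume "\<omega> \<in> (\<Union>s\<in>paths B n. X s)"
    then obtain s where s: "s \<in> paths B n" "\<omega> \<in> X s" by blast
    have "0 < H k \<omega>" if "k \<le> n" for k
    proof -
      have "tt k < H k \<omega>" using s that by (auto simp: X_def)
      then show ?thesis using assms(2) by (auto simp: tt_def split: if_splits)
    qed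
    moreover have "t < H n \<omega>" using s by (auto simp: X_def tt_def)
    ultimately show "\<omega> \<in> {\<omega> \<in> stays B n. t < H n \<omega>}"
      using s by (auto simp: X_def stays_def paths_def)
  qed
  have meas: "X s \<in> events" for s
    unfolding X_def by measurable
  have disj: "disjoint_family_on X (paths B n)"
  proof (unfold disjoint_family_on_def, intro ballI impI)
    fix s s' assume ss: "s \<in> paths B n" "s' \<in> paths B n" "s \<noteq> s'"
    then have "\<exists>k\<le>n. s k \<noteq> s' k"
      by (auto simp: paths_def intro: PiE_ext[of s "{..n}" "\<lambda>_. S" s'])
    then show "X s \<inter> X s' = {}" by (auto simp: X_def)
  qed
  have "emeasure M {\<omega> \<in> stays B n. t < H n \<omega>} = (\<integral>\<^sup>+s. emeasure M (X s) \<partial>count_space (paths B n))"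
    unfolding eq by (rule emeasure_UN_countable[OF meas countable_paths disj])
  also have "\<dots> = (\<integral>\<^sup>+s. ennreal (weight n s) * ennreal (exp (- exit_rate S q (s n) * t)) \<partial>count_space (paths B n))"
  proof (rule nn_integral_cong)
    fix s assume "s \<in> space (count_space (paths B n))"
    then have s: "s \<in> paths B n" by simp
    have "(\<Prod>k\<le>n. exp (- exit_rate S q (s k) * tt k)) = (\<Prod>k\<in>{n}. exp (- exit_rate S q (s k) * tt k))"
      by (rule prod.mono_neutral_right) (auto simp: tt_def)
    then have "prob (X s) = weight n s * exp (- exit_rate S q (s n) * t)"
      unfolding X_def weight_def
      using assms(2) paths_in_S[OF s] by (subst law) (auto simp: tt_def)
    then show "emeasure M (X s) = ennreal (weight n s) * ennreal (exp (- exit_rate S q (s n) * t))"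
      by (simp add: emeasure_eq_measure ennreal_mult'')
  qed
  finally show ?thesis by (simp add: path_sum_def)
qed

lemma emeasure_stays: "B \<subseteq> S \<Longrightarrow> emeasure M (stays B n) = path_sum B n (\<lambda>_. 1)"
proof -
  assume B: "B \<subseteq> S"
  have "{\<omega> \<in> stays B n. 0 < H n \<omega>} = stays B n"
    by (auto simp: stays_def)
  then show ?thesis
    using emeasure_stays_less[OF B, of 0 n] by simp
qed

lemma path_sum_mono:
  "(\<And>x. x \<in> S \<Longrightarrow> f x \<le> g x) \<Longrightarrow> path_sum B n f \<le> path_sum B n g"
  unfolding path_sum_def
  by (intro nn_integral_mono mult_left_mono) (auto intro: paths_in_S)

lemma path_sum_cong:
  "(\<And>x. x \<in> S \<Longrightarrow> f x = g x) \<Longrightarrow> path_sum B n f = path_sum B n g"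
  unfolding path_sum_def
  by (intro nn_integral_cong) (auto dest: paths_in_S)

lemma path_sum_add: "path_sum B n (\<lambda>x. f x + g x) = path_sum B n f + path_sum B n g"
  by (simp add: path_sum_def distrib_left nn_integral_add)

lemma path_sum_cmult: "path_sum B n (\<lambda>x. f x * a) = path_sum B n f * a"
  by (simp add: path_sum_def nn_integral_multc mult.assoc[symmetric])

text \<open>The Markov property, read off from the product formula: splitting off the last state is
  a bijection under which the weight factorises.\<close>

lemma path_sum_Suc:
  assumes "B \<subseteq> S"
  shows "path_sum B (Suc n) f =
    path_sum B n (\<lambda>x. \<integral>\<^sup>+y. ennreal (jump_prob S q x y) * f y \<partial>count_space B)"
proof -
  let ?g = "\<lambda>(s, y). s(Suc n := y)"
  have bij: "bij_betw ?g (paths B n \<times> B) (paths B (Suc n))"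
  proof (rule bij_betwI[where g = "\<lambda>s. (restrict s {..n}, s (Suc n))"])
    show "?g \<in> paths B n \<times> B \<rightarrow> paths B (Suc n)"
      using assms by (auto simp: paths_def PiE_iff extensional_def le_Suc_eq)
    show "(\<lambda>s. (restrict s {..n}, s (Suc n))) \<in> paths B (Suc n) \<rightarrow> paths B n \<times> B"
      by (auto simp: paths_def PiE_iff)
    show "(restrict (?g z) {..n}, ?g z (Suc n)) = z" if "z \<in> paths B n \<times> B" for z
      using that by (auto simp: paths_def PiE_iff extensional_def fun_eq_iff split: prod.splits)
    show "?g (restrict s {..n}, s (Suc n)) = s" if "s \<in> paths B (Suc n)" for s
      using that by (auto simp: paths_def PiE_iff extensional_def fun_eq_iff)
  qed
  have "path_sum B (Suc n) f =
      (\<integral>\<^sup>+z. ennreal (weight (Suc n) (?g z)) * f (?g z (Suc n)) \<partial>count_space (paths B n \<times> B))"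
    unfolding path_sum_def by (rule nn_integral_bij_count_space[OF bij, symmetric])
  also have "\<dots> = (\<integral>\<^sup>+s. \<integral>\<^sup>+y. ennreal (weight (Suc n) (s(Suc n := y))) * f y \<partial>count_space B \<partial>count_space (paths B n))"
    by (subst nn_integral_count_space_Times) simp
  also have "\<dots> = (\<integral>\<^sup>+s. ennreal (weight n s) * (\<integral>\<^sup>+y. ennreal (jump_prob S q (s n) y) * f y \<partial>count_space B) \<partial>count_space (paths B n))"
  proof (rule nn_integral_cong)
    fix s assume "s \<in> space (count_space (paths B n))"
    then have s: "s \<in> paths B n" by simp
    have "(\<integral>\<^sup>+y. ennreal (weight (Suc n) (s(Suc n := y))) * f y \<partial>count_space B) =
        (\<integral>\<^sup>+y. ennreal (weight n s) * (ennreal (jump_prob S q (s n) y) * f y) \<partial>count_space B)"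
    proof (rule nn_integral_cong)
      fix y assume "y \<in> space (count_space B)"
      have "weight (Suc n) (s(Suc n := y)) = weight n s * jump_prob S q (s n) y"
        by (auto simp: weight_def intro!: prod.cong)
      then show "ennreal (weight (Suc n) (s(Suc n := y))) * f y =
          ennreal (weight n s) * (ennreal (jump_prob S q (s n) y) * f y)"
        using weight_nonneg[OF s] by (simp add: ennreal_mult' mult.assoc)
    qed
    then show "(\<integral>\<^sup>+y. ennreal (weight (Suc n) (s(Suc n := y))) * f y \<partial>count_space B) =
        ennreal (weight n s) * (\<integral>\<^sup>+y. ennreal (jump_prob S q (s n) y) * f y \<partial>count_space B)"
      by (simp add: nn_integral_cmult)
  qed
  finally show ?thesis by (simp add: path_sum_def)
qed

lemma path_sum_0: "path_sum B 0 f = f i"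
proof -
  have p: "prob {\<omega> \<in> space M. Y 0 \<omega> = x} = (if x = i then 1 else 0)" for x
  proof (cases "x = i")
    case True
    then show ?thesis using start prob_Collect_eq_1 by simp
  next
    case False
    then have "AE \<omega> in M. Y 0 \<omega> \<noteq> x" using start by auto
    then show ?thesis using False prob_Collect_eq_0 by simp
  qed
  let ?s = "restrict (\<lambda>_. i) {..0::nat}"
  have s_eq: "s = ?s" if "s \<in> paths B 0" "s 0 = i" for s
    using that by (auto simp: paths_def fun_eq_iff PiE_iff extensional_def)
  have s_in: "?s \<in> paths B 0"
    using i_in_S by (auto simp: paths_def)
  have "path_sum B 0 f = (\<Sum>s\<in>{?s}. ennreal (weight 0 s) * f (s 0))"
    unfolding path_sum_def
  proof (rule nn_integral_count_space')
    show "ennreal (weight 0 s) * f (s 0) = 0" if "s \<in> paths B 0" "s \<notin> {?s}" for s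
      using s_eq[OF that(1)] that(2) by (cases "s 0 = i") (simp_all add: weight_def p)
  qed (use s_in in simp_all)
  then show ?thesis by (simp add: weight_def p)
qed

text \<open>The cylinder events over all paths of a given length have total mass 1, since every row
  of the jump kernel sums to 1, and each of them includes the positivity of its holding
  times.\<close>

lemma AE_holding_pos: "AE \<omega> in M. \<forall>k. 0 < H k \<omega>"
proof -
  have tot: "path_sum S n (\<lambda>_. 1) = 1" for n
  proof (induction n)
    case (Suc n)
    have "path_sum S (Suc n) (\<lambda>_. 1) = path_sum S n (\<lambda>_. 1)"
      by (subst path_sum_Suc) (auto simp: jump_prob_total intro!: path_sum_cong)
    then show ?case using Suc by simp
  qed (simp add: path_sum_0)
  have "AE \<omega> in M. \<omega> \<in> stays S k" for k
    using tot[of k] emeasure_stays[of S k]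
    by (intro AE_prob_1) (simp add: measure_def)
  then have "AE \<omega> in M. 0 < H k \<omega>" for k
    by (rule AE_mp) (auto simp: stays_def)
  then show ?thesis by (simp add: AE_all_countable)
qed

text \<open>A holding time is at most the number of integers \<open>j \<ge> 0\<close> below it, and
  given the path it exceeds \<open>j\<close> with probability at most \<open>exp (- c) ^ j\<close>.
  The constant is the sum of this geometric series.\<close>

lemma expected_holding_le:
  assumes B: "B \<subseteq> S"
  shows "(\<integral>\<^sup>+\<omega>. ennreal (H n \<omega>) * indicator (stays B n) \<omega> \<partial>M)
    \<le> emeasure M (stays B n) * ennreal (1 / (1 - exp (- c)))"
proof -
  note [measurable] = stays_measurable[OF B]
  have meas[measurable]: "{\<omega> \<in> stays B n. r < H n \<omega>} \<in> events" for r
    by measurable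
  have "ennreal (H n \<omega>) * indicator (stays B n) \<omega>
      \<le> (\<Sum>j. indicator {\<omega> \<in> stays B n. real j < H n \<omega>} \<omega>)" for \<omega>
  proof (cases "\<omega> \<in> stays B n")
    case True
    define m where "m = nat \<lceil>H n \<omega>\<rceil>"
    have "ennreal (H n \<omega>) \<le> ennreal (real m)"
      unfolding m_def by (intro ennreal_leI) linarith
    also have "\<dots> = (\<Sum>j<m. indicator {\<omega> \<in> stays B n. real j < H n \<omega>} \<omega>)"
    proof -
      have "real j < H n \<omega>" if "j < m" for j
        using that unfolding m_def by linarith
      then have "(\<Sum>j<m. indicator {\<omega> \<in> stays B n. real j < H n \<omega>} \<omega> :: ennreal) = (\<Sum>j<m. 1)"
        using True by (intro sum.cong) (auto simp: indicator_def)
      then show ?thesis by (simp add: ennreal_of_nat_eq_real_of_nat)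
    qed
    also have "\<dots> \<le> (\<Sum>j. indicator {\<omega> \<in> stays B n. real j < H n \<omega>} \<omega>)"
      by (rule sum_le_suminf) auto
    finally show ?thesis using True by simp
  qed simp
  then have "(\<integral>\<^sup>+\<omega>. ennreal (H n \<omega>) * indicator (stays B n) \<omega> \<partial>M)
      \<le> (\<integral>\<^sup>+\<omega>. (\<Sum>j. indicator {\<omega> \<in> stays B n. real j < H n \<omega>} \<omega>) \<partial>M)"
    by (intro nn_integral_mono) auto
  also have "\<dots> = (\<Sum>j. emeasure M {\<omega> \<in> stays B n. real j < H n \<omega>})"
    by (subst nn_integral_suminf) auto
  also have "\<dots> \<le> (\<Sum>j. emeasure M (stays B n) * ennreal (exp (- c) ^ j))"
  proof (intro suminf_le)
    fix j
    have "emeasure M {\<omega> \<in> stays B n. real j < H n \<omega>} =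
        path_sum B n (\<lambda>x. ennreal (exp (- exit_rate S q x * real j)))"
      using B by (rule emeasure_stays_less) simp
    also have "\<dots> \<le> path_sum B n (\<lambda>x. 1 * ennreal (exp (- c) ^ j))"
    proof (rule path_sum_mono)
      fix x assume "x \<in> S"
      then have "- exit_rate S q x * real j \<le> real j * (- c)"
        using mult_left_mono[OF exit_rate_ge, of x "real j"] by (simp add: algebra_simps)
      then show "ennreal (exp (- exit_rate S q x * real j)) \<le> 1 * ennreal (exp (- c) ^ j)"
        unfolding exp_of_nat_mult[symmetric] by (auto intro!: ennreal_leI)
    qed
    also have "\<dots> = emeasure M (stays B n) * ennreal (exp (- c) ^ j)"
      by (simp only: path_sum_cmult emeasure_stays[OF B])
    finally show "emeasure M {\<omega> \<in> stays B n. real j < H n \<omega>} \<le> emeasure M (stays B n) * ennreal (exp (- c) ^ j)" .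
  qed auto
  also have "\<dots> = emeasure M (stays B n) * (\<Sum>j. ennreal (exp (- c) ^ j))"
    by (rule ennreal_suminf_cmult)
  also have "(\<Sum>j. ennreal (exp (- c) ^ j)) = ennreal (1 / (1 - exp (- c)))"
    using c_pos by (intro suminf_ennreal_eq geometric_sums) auto
  finally show ?thesis .
qed

text \<open>\<open>V\<close> dominates the expected number of steps before the return to \<open>i\<close>.\<close>

context
  fixes V :: "'s \<Rightarrow> real"
  assumes V_super: "\<And>x. x \<in> S \<Longrightarrow>
      1 + (\<integral>\<^sup>+y. ennreal (jump_prob S q x y) * ennreal (V y) \<partial>count_space (S - {i})) \<le> ennreal (V x)"
begin

text \<open>The terms are the probabilities that the first n jumps avoid \<open>i\<close>, so the
  sum is the mean number of jumps until the return. By \<open>V_super\<close>, the mean of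
  \<open>V\<close> over surviving paths plus the partial sum does not increase with n, and it starts
  at \<open>V i\<close>.\<close>

lemma suminf_stays_le: "(\<Sum>n. emeasure M (stays (S - {i}) n)) \<le> ennreal (V i)"
proof (rule suminf_le_const)
  have step: "path_sum (S - {i}) (Suc n) V + path_sum (S - {i}) n (\<lambda>_. 1) \<le> path_sum (S - {i}) n V" for n
    by (subst path_sum_Suc) (auto simp: path_sum_add[symmetric] add.commute V_super intro!: path_sum_mono)
  have "path_sum (S - {i}) n V + (\<Sum>k<n. path_sum (S - {i}) k (\<lambda>_. 1)) \<le> V i" for n
  proof (induction n)
    case (Suc n)
    have "path_sum (S - {i}) (Suc n) V + (\<Sum>k<Suc n. path_sum (S - {i}) k (\<lambda>_. 1)) =
      (path_sum (S - {i}) (Suc n) V + path_sum (S - {i}) n (\<lambda>_. 1)) + (\<Sum>k<n. path_sum (S - {i}) k (\<lambda>_. 1))"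
      by (simp add: ac_simps)
    also have "\<dots> \<le> path_sum (S - {i}) n V + (\<Sum>k<n. path_sum (S - {i}) k (\<lambda>_. 1))"
      by (intro add_right_mono step)
    finally show ?case using Suc by (rule order_trans)
  qed (simp add: path_sum_0)
  then have "(\<Sum>k<n. path_sum (S - {i}) k (\<lambda>_. 1)) \<le> ennreal (V i)" for n
    by (rule order_trans[OF add_increasing[OF zero_le order_refl]])
  then show "(\<Sum>n<k. emeasure M (stays (S - {i}) n)) \<le> ennreal (V i)" for k
    using emeasure_stays[of "S - {i}"] by auto
qed simp

lemma expected_return_time_finite:
  assumes N: "AE \<omega> in M. \<forall>n t. (\<Sum>k<n. H k \<omega>) \<le> t \<and> t < (\<Sum>k<Suc n. H k \<omega>) \<longrightarrow> N t \<omega> = Y n \<omega>"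
  shows "(\<integral>\<^sup>+\<omega>. return_time N i \<omega> \<partial>M) < \<infinity>"
proof -
  let ?B = "S - {i}"
  have B: "?B \<subseteq> S" by auto
  note [measurable] = stays_measurable[OF B]
  have fin: "(\<Sum>n. emeasure M (stays ?B n)) < \<infinity>"
    using suminf_stays_le by (rule order.strict_trans1) simp
  \<comment> \<open>\<open>jump_prob\<close> vanishes on the diagonal, so the first jump really
    leaves \<open>i\<close>; this is what makes \<open>H 0\<close> an upper bound for
    \<open>first_jump_time\<close>.\<close>
  have "AE \<omega> in M. Y 1 \<omega> \<noteq> i"
  proof -
    have "prob {\<omega> \<in> space M. \<forall>k\<le>1. Y k \<omega> = i \<and> 0 < H k \<omega>} = 0"
      using i_in_S by (subst law[of 1 "\<lambda>_. i" "\<lambda>_. 0"]) (auto simp: jump_prob_def)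
    then have "AE \<omega> in M. \<not> (\<forall>k\<le>1. Y k \<omega> = i \<and> 0 < H k \<omega>)"
      by (subst (asm) prob_Collect_eq_0) (auto)
    with AE_holding_pos start show ?thesis
      by eventually_elim (auto simp: le_Suc_eq)
  qed
  \<comment> \<open>The survival probabilities are summable, so they tend to 0: almost surely the
    return takes finitely many jumps.\<close>
  moreover have "AE \<omega> in M. \<exists>n. \<omega> \<notin> stays ?B n"
  proof -
    have "AE \<omega> in M. \<omega> \<notin> (\<Inter>n. stays ?B n)"
    proof (rule AE_not_in)
      have "emeasure M (\<Inter>n. stays ?B n) \<le> emeasure M (stays ?B n)" for n
        by (intro emeasure_mono) auto
      moreover have "(\<lambda>n. emeasure M (stays ?B n)) \<longlonglongrightarrow> 0"
      proof -
        have "summable (\<lambda>n. prob (stays ?B n))"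
          using fin by (intro summable_suminf_not_top) (auto simp: emeasure_eq_measure)
        then show ?thesis
          by (simp add: emeasure_eq_measure ennreal_tendsto_0_iff summable_LIMSEQ_zero)
      qed
      ultimately have "emeasure M (\<Inter>n. stays ?B n) \<le> 0"
        by (intro LIMSEQ_le_const) auto
      then show "(\<Inter>n. stays ?B n) \<in> null_sets M"
        by (intro null_setsI) auto
    qed
    then show ?thesis by auto
  qed
  ultimately have "AE \<omega> in M. return_time N i \<omega> \<le> (\<Sum>k. ennreal (H k \<omega>) * indicator (stays ?B k) \<omega>)"
    using N AE_holding_pos start AE_space
  proof eventually_elim
    case (elim \<omega>)
    note N' = elim(3)[rule_format, OF conjI]
    have pos: "0 < H k \<omega>" for k using elim by auto
    have "\<exists>n. 1 \<le> n \<and> Y n \<omega> = i"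
      using elim measurable_space[OF Y_measurable] by (auto simp: stays_def)
    define n where "n = (LEAST n. 1 \<le> n \<and> Y n \<omega> = i)"
    have n: "1 \<le> n" "Y n \<omega> = i"
      unfolding n_def using LeastI_ex[OF \<open>\<exists>n. 1 \<le> n \<and> Y n \<omega> = i\<close>] by auto
    have less: "Y k \<omega> \<noteq> i" if "1 \<le> k" "k < n" for k
      using not_less_Least[of k "\<lambda>n. 1 \<le> n \<and> Y n \<omega> = i"] that unfolding n_def by auto
    \<comment> \<open>The time of the jump into \<open>Y n = i\<close>. It is at least
      \<open>H 0\<close>, hence not before the first jump, and so competes in the infimum that
      defines \<open>return_time\<close>. For each summand \<open>H k\<close> the path belongs to
      \<open>stays\<close> at k.\<close>
    define T where "T = (\<Sum>k<n. H k \<omega>)"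
    have T: "N T \<omega> = i"
      using N'[of n T] pos[of n] n unfolding T_def by auto
    have T_ge: "H 0 \<omega> \<le> T"
    proof -
      have "(\<Sum>k\<in>{0}. H k \<omega>) \<le> T"
        unfolding T_def using n pos by (intro sum_mono2) (auto intro: less_imp_le)
      then show ?thesis by simp
    qed
    have "N (H 0 \<omega>) \<omega> = Y 1 \<omega>" "N 0 \<omega> = Y 0 \<omega>"
      using N'[of 1 "H 0 \<omega>"] N'[of 0 0] pos[of 0] pos[of 1] by auto
    then have "first_jump_time N \<omega> \<le> ennreal (H 0 \<omega>)"
      unfolding first_jump_time_def using elim(1,5) pos[of 0] by (intro INF_lower) (auto simp: less_imp_le)
    also have "\<dots> \<le> ennreal T" using T_ge by (intro ennreal_leI)
    finally have "return_time N i \<omega> \<le> ennreal T"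
      unfolding return_time_def using T T_ge pos[of 0] by (intro INF_lower) auto
    also have "\<dots> = (\<Sum>k<n. ennreal (H k \<omega>))"
      unfolding T_def using pos by (intro sum_ennreal[symmetric]) (auto intro: less_imp_le)
    also have "\<dots> = (\<Sum>k<n. ennreal (H k \<omega>) * indicator (stays ?B k) \<omega>)"
    proof (rule sum.cong)
      fix k assume "k \<in> {..<n}"
      then have "\<omega> \<in> stays ?B k"
        using elim less measurable_space[OF Y_measurable] by (auto simp: stays_def)
      then show "ennreal (H k \<omega>) = ennreal (H k \<omega>) * indicator (stays ?B k) \<omega>" by simp
    qed simp
    also have "\<dots> \<le> (\<Sum>k. ennreal (H k \<omega>) * indicator (stays ?B k) \<omega>)"
      by (rule sum_le_suminf) auto
    finally show ?case .
  qed
  then have "(\<integral>\<^sup>+\<omega>. return_time N i \<omega> \<partial>M)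
      \<le> (\<integral>\<^sup>+\<omega>. (\<Sum>k. ennreal (H k \<omega>) * indicator (stays ?B k) \<omega>) \<partial>M)"
    by (rule nn_integral_mono_AE)
  also have "\<dots> = (\<Sum>k. \<integral>\<^sup>+\<omega>. ennreal (H k \<omega>) * indicator (stays ?B k) \<omega> \<partial>M)"
    by (rule nn_integral_suminf) auto
  also have "\<dots> \<le> (\<Sum>k. emeasure M (stays ?B k) * ennreal (1 / (1 - exp (- c))))"
    by (intro suminf_le expected_holding_le[OF B]) auto
  also have "\<dots> = (\<Sum>k. emeasure M (stays ?B k)) * ennreal (1 / (1 - exp (- c)))"
    by (rule ennreal_suminf_multc)
  also have "\<dots> < \<infinity>"
    using fin by (auto simp: ennreal_mult_less_top)
  finally show ?thesis .
qed

end

end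

section \<open>Drift criterion for flow counts\<close>

text \<open>Instantiated by the network on \<open>{0..L}\<close> and, for each \<alpha>, by the
  quasi-stationary process on \<open>{2..L}\<close>. The bound 1 on \<open>phi\<close> keeps the
  exit rates bounded, which permits uniformisation.\<close>

locale flow_system =
  fixes K :: "nat set" and lam mu :: "nat \<Rightarrow> real" and phi :: "nat \<Rightarrow> (nat \<Rightarrow> nat) \<Rightarrow> real"
  assumes finite_K: "finite K" and K_nonempty: "K \<noteq> {}"
    and lam_pos: "\<And>k. k \<in> K \<Longrightarrow> 0 < lam k"
    and mu_pos: "\<And>k. k \<in> K \<Longrightarrow> 0 < mu k"
    and phi_le_1: "\<And>k n. k \<in> K \<Longrightarrow> phi k n \<le> 1"
    and phi_pos: "\<And>k n. k \<in> K \<Longrightarrow> 0 < n k \<Longrightarrow> 0 < phi k n"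
    and phi_zero: "\<And>k n. k \<in> K \<Longrightarrow> n k = 0 \<Longrightarrow> phi k n = 0"
begin

abbreviation q where "q \<equiv> flow_rates K lam mu phi"

abbreviation inc :: "(nat \<Rightarrow> nat) \<Rightarrow> nat \<Rightarrow> nat \<Rightarrow> nat" where "inc n k \<equiv> n(k := n k + 1)"
abbreviation dec :: "(nat \<Rightarrow> nat) \<Rightarrow> nat \<Rightarrow> nat \<Rightarrow> nat" where "dec n k \<equiv> n(k := n k - 1)"

definition outflow :: "((nat \<Rightarrow> nat) \<Rightarrow> real) \<Rightarrow> (nat \<Rightarrow> nat) \<Rightarrow> real" where
  "outflow f n = (\<Sum>k\<in>K. lam k * f (inc n k) + mu k * phi k n * f (dec n k))"

text \<open>The adjoint of \<open>outflow\<close>. On naturals \<open>dec n k = n\<close> if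
  \<open>n k = 0\<close>, so the arrival term needs a guard here, whereas in \<open>outflow\<close>
  the factor \<open>phi\<close> vanishes at such states.\<close>

definition inflow :: "((nat \<Rightarrow> nat) \<Rightarrow> real) \<Rightarrow> (nat \<Rightarrow> nat) \<Rightarrow> real" where
  "inflow p n = (\<Sum>k\<in>K. (if 0 < n k then p (dec n k) * lam k else 0)
     + p (inc n k) * (mu k * phi k (inc n k)))"

definition rate :: "(nat \<Rightarrow> nat) \<Rightarrow> real" where
  "rate n = (\<Sum>k\<in>K. lam k + mu k * phi k n)"

definition gen :: "((nat \<Rightarrow> nat) \<Rightarrow> real) \<Rightarrow> (nat \<Rightarrow> nat) \<Rightarrow> real" where
  "gen f n = (\<Sum>k\<in>K. lam k * (f (inc n k) - f n) + mu k * phi k n * (f (dec n k) - f n))"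

definition total_rate :: real where
  "total_rate = (\<Sum>k\<in>K. lam k + mu k)"

lemma phi_nonneg: "k \<in> K \<Longrightarrow> 0 \<le> phi k n"
  using phi_pos[of k n] phi_zero[of k n] by (cases "n k = 0") auto

lemma lam_nonneg: "k \<in> K \<Longrightarrow> 0 \<le> lam k" and mu_nonneg: "k \<in> K \<Longrightarrow> 0 \<le> mu k"
  using lam_pos mu_pos by (auto intro: less_imp_le)

lemma departure_nonneg: "k \<in> K \<Longrightarrow> 0 \<le> mu k * phi k n"
  by (simp add: mu_nonneg phi_nonneg)

lemma flow_rates_nonneg: "0 \<le> q n m"
  unfolding flow_rates_def using lam_nonneg departure_nonneg
  by (intro sum_nonneg add_nonneg_nonneg) auto

lemma gen_eq: "gen f n = outflow f n - rate n * f n"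
  unfolding gen_def outflow_def rate_def sum_distrib_right sum_subtractf[symmetric]
  by (intro sum.cong) (simp_all add: algebra_simps)

lemma rate_le: "rate n \<le> total_rate"
  unfolding rate_def total_rate_def
  using mu_pos phi_le_1 by (intro sum_mono add_left_mono) (auto simp: mult_le_cancel_left1)

lemma rate_ge: "(\<Sum>k\<in>K. lam k) \<le> rate n"
  unfolding rate_def using departure_nonneg by (intro sum_mono) auto

lemma sum_lam_pos: "0 < (\<Sum>k\<in>K. lam k)"
  using finite_K K_nonempty lam_pos by (rule sum_pos)

lemma rate_pos: "0 < rate n"
  using sum_lam_pos rate_ge by (rule less_le_trans)

lemma total_rate_pos: "0 < total_rate"
  using rate_pos rate_le by (rule less_le_trans)

lemma outflow_mono:
  "(\<And>k. k \<in> K \<Longrightarrow> f (inc n k) \<le> g (inc n k)) \<Longrightarrow> (\<And>k. k \<in> K \<Longrightarrow> 0 < n k \<Longrightarrow> f (dec n k) \<le> g (dec n k))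
    \<Longrightarrow> outflow f n \<le> outflow g n"
  unfolding outflow_def
proof (intro sum_mono add_mono)
  fix k assume f: "\<And>k. k \<in> K \<Longrightarrow> 0 < n k \<Longrightarrow> f (dec n k) \<le> g (dec n k)" and k: "k \<in> K"
  show "mu k * phi k n * f (dec n k) \<le> mu k * phi k n * g (dec n k)"
  proof (cases "n k = 0")
    case False
    then show ?thesis using f[OF k] departure_nonneg[OF k] by (intro mult_left_mono) auto
  qed (simp add: phi_zero k)
qed (use lam_nonneg in \<open>auto intro!: mult_left_mono\<close>)

lemma outflow_const: "outflow (\<lambda>_. a) n = rate n * a"
  unfolding outflow_def rate_def sum_distrib_right
  by (intro sum.cong) (simp_all add: algebra_simps)

lemma upd_in_states: "n \<in> states K \<Longrightarrow> k \<in> K \<Longrightarrow> n(k := x) \<in> states K"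
  by (auto simp: states_def)

lemma dec_eq_iff: "n = m(k := Suc (m k)) \<longleftrightarrow> 0 < n k \<and> m = n(k := n k - Suc 0)"
  by (auto simp: fun_eq_iff)

text \<open>Jumps are possible in both directions or in neither, so one finite set supports both the
  row and the column of the rate matrix at \<open>n\<close>.\<close>

definition nbrs :: "(nat \<Rightarrow> nat) \<Rightarrow> (nat \<Rightarrow> nat) set" where
  "nbrs n = inc n ` K \<union> dec n ` {k \<in> K. 0 < n k}"

lemma finite_nbrs: "finite (nbrs n)"
  using finite_K by (simp add: nbrs_def)

lemma nbrs_subset: "n \<in> states K \<Longrightarrow> nbrs n \<subseteq> states K - {n}"
  by (auto simp: nbrs_def upd_in_states fun_eq_iff split: if_splits dest: spec[where x="_::nat"])

lemma rates_outside_nbrs: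
  assumes "m \<notin> nbrs n"
  shows "q n m = 0" "q m n = 0"
proof -
  have *: "m \<noteq> inc n k" "n = inc m k \<longleftrightarrow> False" if "k \<in> K" for k
    using assms that dec_eq_iff[of n m k] by (auto simp: nbrs_def)
  then show "q n m = 0" "q m n = 0"
    unfolding flow_rates_def by (auto intro!: sum.neutral)
qed

lemma sum_nbrs_outflow: "(\<Sum>m\<in>nbrs n. q n m * g m) = outflow g n"
proof -
  have "(\<Sum>m\<in>nbrs n. q n m * g m) = (\<Sum>k\<in>K. \<Sum>m\<in>nbrs n.
      (if m = inc n k then lam k * g m else 0) + (if n = inc m k then mu k * phi k n * g m else 0))"
    unfolding flow_rates_def sum_distrib_right
    by (subst sum.swap) (auto intro!: sum.cong simp: algebra_simps)
  also have "\<dots> = outflow g n"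
    unfolding outflow_def
  proof (rule sum.cong)
    fix k assume k: "k \<in> K"
    have "(\<Sum>m\<in>nbrs n. if n = inc m k then mu k * phi k n * g m else 0) = mu k * phi k n * g (dec n k)"
    proof (cases "n k = 0")
      case True
      then have "n \<noteq> inc m k" for m by (simp add: dec_eq_iff)
      then show ?thesis using True k by (simp add: phi_zero del: fun_upd_apply)
    next
      case False
      then have "dec n k \<in> nbrs n" using k by (auto simp: nbrs_def)
      then show ?thesis using False finite_nbrs[of n] by (simp add: dec_eq_iff)
    qed
    moreover have "inc n k \<in> nbrs n" using k by (auto simp: nbrs_def)
    ultimately show "(\<Sum>m\<in>nbrs n. (if m = inc n k then lam k * g m else 0) + (if n = inc m k then mu k * phi k n * g m else 0))
       = lam k * g (inc n k) + mu k * phi k n * g (dec n k)"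
      using finite_nbrs[of n] by (simp add: sum.distrib)
  qed simp
  finally show ?thesis .
qed

lemma sum_nbrs_inflow: "(\<Sum>m\<in>nbrs n. p m * q m n) = inflow p n"
proof -
  have "(\<Sum>m\<in>nbrs n. p m * q m n) = (\<Sum>k\<in>K. \<Sum>m\<in>nbrs n.
      (if n = inc m k then p m * lam k else 0) + (if m = inc n k then p m * (mu k * phi k m) else 0))"
    unfolding flow_rates_def sum_distrib_left
    by (subst sum.swap) (auto intro!: sum.cong simp: algebra_simps)
  also have "\<dots> = inflow p n"
    unfolding inflow_def
  proof (rule sum.cong)
    fix k assume k: "k \<in> K"
    have "(\<Sum>m\<in>nbrs n. if n = inc m k then p m * lam k else 0) = (if 0 < n k then p (dec n k) * lam k else 0)"
    proof (cases "n k = 0")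
      case True
      then have "n \<noteq> inc m k" for m by (simp add: dec_eq_iff)
      then show ?thesis using True by simp
    next
      case False
      then have "dec n k \<in> nbrs n" using k by (auto simp: nbrs_def)
      then show ?thesis using False finite_nbrs[of n] by (simp add: dec_eq_iff)
    qed
    moreover have "inc n k \<in> nbrs n" using k by (auto simp: nbrs_def)
    ultimately show "(\<Sum>m\<in>nbrs n. (if n = inc m k then p m * lam k else 0) + (if m = inc n k then p m * (mu k * phi k m) else 0))
       = (if 0 < n k then p (dec n k) * lam k else 0) + p (inc n k) * (mu k * phi k (inc n k))"
      using finite_nbrs[of n] by (simp add: sum.distrib)
  qed simp
  finally show ?thesis .
qed

lemma exit_rate_eq: "n \<in> states K \<Longrightarrow> exit_rate (states K) q n = rate n"
proof -
  assume n: "n \<in> states K"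
  have "((\<lambda>m. q n m) has_sum (\<Sum>m\<in>nbrs n. q n m)) (states K - {n})"
    using nbrs_subset[OF n] finite_nbrs rates_outside_nbrs(1)
    by (intro has_sum_finite_neutralI) auto
  then show ?thesis
    using sum_nbrs_outflow[of n "\<lambda>_. 1"] outflow_const[of 1 n]
    by (simp add: exit_rate_def infsumI)
qed

lemma stationary_distribution_iff:
  "stationary_distribution (states K) q \<pi> \<longleftrightarrow>
    set_pmf \<pi> \<subseteq> states K \<and> (\<forall>n\<in>states K. inflow (pmf \<pi>) n = pmf \<pi> n * rate n)"
proof -
  have "((\<lambda>i. pmf \<pi> i * q i n) has_sum inflow (pmf \<pi>) n) (states K - {n})" if "n \<in> states K" for n
    unfolding sum_nbrs_inflow[symmetric]
    using nbrs_subset[OF that] finite_nbrs rates_outside_nbrs(2)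
    by (intro has_sum_finite_neutralI) auto
  then show ?thesis
    unfolding stationary_distribution_def
    by (auto simp: exit_rate_eq dest: has_sum_unique)
qed

lemma countable_states: "countable (states K)"
proof -
  have "inj_on (\<lambda>n. restrict n K) (states K)"
  proof (rule inj_onI, rule ext)
    fix n m x assume "n \<in> states K" "m \<in> states K" "restrict n K = restrict m K"
    then show "n x = m x"
      by (cases "x \<in> K") (auto simp: states_def restrict_def fun_eq_iff split: if_splits)
  qed
  moreover have "countable (PiE K (\<lambda>_. UNIV :: nat set))"
    using finite_K by (intro countable_PiE) auto
  then have "countable ((\<lambda>n. restrict n K) ` states K)"
    by (rule countable_subset[rotated]) auto
  ultimately show ?thesis
    by (rule countable_image_inj_on[rotated])
qed

lemma finite_states_le: "finite {n \<in> states K. (\<Sum>k\<in>K. n k) \<le> b}"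
proof -
  have "finite {n. \<forall>k. (k \<in> K \<longrightarrow> n k \<in> {..b}) \<and> (k \<notin> K \<longrightarrow> n k = (0::nat))}"
    using finite_K by (intro finite_set_of_finite_funs) auto
  moreover have "n k \<le> b" if "(\<Sum>k\<in>K. n k) \<le> b" "k \<in> K" for n k
    using member_le_sum[of k K n] finite_K that by auto
  ultimately show ?thesis
    by (auto intro: finite_subset[rotated] simp: states_def)
qed

text \<open>Irreducibility, in the form of a propagation principle: every state is linked to the
  empty one by removing flows one at a time, so a set respecting single arrivals in both directions
  contains all states or none.\<close>

lemma states_connected:
  assumes Z: "\<And>n k. n \<in> states K \<Longrightarrow> k \<in> K \<Longrightarrow> n \<in> Z \<longleftrightarrow> inc n k \<in> Z"
    and z: "z \<in> Z" "z \<in> states K" and n: "n \<in> states K"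
  shows "n \<in> Z"
proof -
  have "n \<in> Z \<longleftrightarrow> (\<lambda>_. 0) \<in> Z" if "n \<in> states K" for n
    using that
  proof (induction "\<Sum>k\<in>K. n k" arbitrary: n)
    case 0
    then have "n = (\<lambda>_. 0)" using finite_K by (auto simp: states_def fun_eq_iff)
    then show ?case by simp
  next
    case (Suc x)
    then obtain k where k: "k \<in> K" "0 < n k"
      using finite_K by (metis not_gr_zero sum.neutral Zero_not_Suc)
    have "(\<Sum>k\<in>K. n k) = n k + (\<Sum>j\<in>K - {k}. n j)" "(\<Sum>j\<in>K. dec n k j) = dec n k k + (\<Sum>j\<in>K - {k}. dec n k j)"
      using k finite_K by (simp_all add: sum.remove[of K k])
    moreover have "(\<Sum>j\<in>K - {k}. dec n k j) = (\<Sum>j\<in>K - {k}. n j)" by (intro sum.cong) auto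
    ultimately have "x = (\<Sum>j\<in>K. dec n k j)" using Suc(2) k by simp
    then have "dec n k \<in> Z \<longleftrightarrow> (\<lambda>_. 0) \<in> Z"
      using Suc(1,3) k by (simp add: upd_in_states)
    moreover have "dec n k \<in> Z \<longleftrightarrow> inc (dec n k) k \<in> Z"
      using Suc(3) k by (intro Z upd_in_states) auto
    moreover have "inc (dec n k) k = n" using k by (auto simp: fun_eq_iff)
    ultimately show ?case by simp
  qed
  then show ?thesis using z n by blast
qed

lemma jump_prob_integral:
  assumes n: "n \<in> states K" and g: "\<And>m. m \<in> states K \<Longrightarrow> 0 \<le> g m"
  shows "(\<integral>\<^sup>+m. ennreal (jump_prob (states K) q n m) * ennreal (g m) \<partial>count_space (states K))
    = ennreal (outflow g n / rate n)"
proof -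
  have "(\<integral>\<^sup>+m. ennreal (jump_prob (states K) q n m) * ennreal (g m) \<partial>count_space (states K))
     = (\<Sum>m\<in>nbrs n. ennreal (jump_prob (states K) q n m) * ennreal (g m))"
    using nbrs_subset[OF n] finite_nbrs
    by (intro nn_integral_count_space') (auto simp: jump_prob_def rates_outside_nbrs)
  also have "\<dots> = (\<Sum>m\<in>nbrs n. ennreal (q n m * g m / rate n))"
  proof (rule sum.cong)
    fix m assume m: "m \<in> nbrs n"
    then have "m \<noteq> n" "m \<in> states K" using nbrs_subset[OF n] by auto
    then show "ennreal (jump_prob (states K) q n m) * ennreal (g m) = ennreal (q n m * g m / rate n)"
      using flow_rates_nonneg rate_pos[of n] g
      by (simp add: jump_prob_def exit_rate_eq[OF n] ennreal_mult'[symmetric] less_imp_le)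
  qed simp
  also have "\<dots> = ennreal (\<Sum>m\<in>nbrs n. q n m * g m / rate n)"
    using flow_rates_nonneg rate_pos[of n] g nbrs_subset[OF n]
    by (intro sum_ennreal) (auto simp: less_imp_le)
  finally show ?thesis
    by (simp add: sum_nbrs_outflow flip: sum_divide_distrib)
qed

lemma jump_prob_nonneg: "n \<in> states K \<Longrightarrow> 0 \<le> jump_prob (states K) q n m"
  using flow_rates_nonneg rate_pos[of n] by (simp add: jump_prob_def exit_rate_eq less_imp_le)

text \<open>The jump chain killed at \<open>i\<close>; \<open>((taboo i) ^^ k) (\<lambda>_. 1) n\<close> is the probability that the
  chain started in \<open>n\<close> does not visit \<open>i\<close> during its first \<open>k\<close> jumps.\<close>

definition taboo :: "(nat \<Rightarrow> nat) \<Rightarrow> ((nat \<Rightarrow> nat) \<Rightarrow> real) \<Rightarrow> (nat \<Rightarrow> nat) \<Rightarrow> real" where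
  "taboo i g n = outflow (\<lambda>m. if m = i then 0 else g m) n / rate n"

lemma taboo_mono:
  "(\<And>m. f m \<le> g m) \<Longrightarrow> taboo i f n \<le> taboo i g n"
  unfolding taboo_def using rate_pos[of n] by (intro divide_right_mono outflow_mono) (auto intro: less_imp_le)

lemma taboo_linear:
  "taboo i (\<lambda>m. a * f m + b * g m) n = a * taboo i f n + b * taboo i g n"
proof -
  have "outflow (\<lambda>m. if m = i then 0 else a * f m + b * g m) n =
     a * outflow (\<lambda>m. if m = i then 0 else f m) n + b * outflow (\<lambda>m. if m = i then 0 else g m) n"
    unfolding outflow_def sum_distrib_left sum.distrib[symmetric]
    by (intro sum.cong refl) (auto simp: algebra_simps)
  then show ?thesis by (simp add: taboo_def add_divide_distrib)
qed

text \<open>From a neighbour of \<open>i\<close> the killed chain dies at once with positive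
  probability, and a chance of dying passes from any state to its neighbours at the price of one
  more jump. Connectedness spreads it everywhere.\<close>

lemma taboo_survival_lt_1:
  assumes i: "i \<in> states K" and n: "n \<in> states K"
  shows "\<exists>k. ((taboo i) ^^ k) (\<lambda>_. 1) n < 1"
proof -
  let ?D = "\<lambda>k. ((taboo i) ^^ k) (\<lambda>_. 1)"
  define Z where "Z = {n. n = i \<or> (\<exists>k. ?D k n < 1)}"
  have D: "0 \<le> ?D k m \<and> ?D k m \<le> 1" for k m
  proof (induction k arbitrary: m)
    case (Suc k)
    have "taboo i (\<lambda>_. 0) m \<le> taboo i (?D k) m" "taboo i (?D k) m \<le> taboo i (\<lambda>_. 1) m"
      using Suc by (auto intro!: taboo_mono)
    moreover have "taboo i (\<lambda>_. 0) m = 0"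
      unfolding taboo_def outflow_def by (simp cong: if_cong)
    moreover have "taboo i (\<lambda>_. 1) m \<le> 1"
    proof -
      have "outflow (\<lambda>m. if m = i then 0 else 1) m \<le> outflow (\<lambda>_. 1) m"
        by (rule outflow_mono) auto
      then show ?thesis
        using rate_pos[of m] by (simp add: taboo_def outflow_const)
    qed
    ultimately show ?case by auto
  qed simp
  have step: "\<exists>k. ?D k n < 1"
    if m: "m \<in> nbrs n" "m \<in> Z" for n m
  proof -
    have "\<exists>k. (if m = i then 0 else ?D k m) < 1"
      using m(2) by (auto simp: Z_def)
    then obtain k where k: "(if m = i then 0 else ?D k m) < 1" ..
    let ?g = "\<lambda>m. if m = i then 0 else ?D k m"
    have q_pos: "0 < q n m"
    proof -
      obtain j where j: "j \<in> K" "m = inc n j \<or> 0 < n j \<and> m = dec n j"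
        using m(1) by (auto simp: nbrs_def)
      have "0 < (if m = inc n j then lam j else 0) + (if n = inc m j then mu j * phi j n else 0)"
        using j(2)
      proof
        assume "m = inc n j"
        then show ?thesis
          using lam_pos[OF j(1)] departure_nonneg[OF j(1), of n] by (intro add_pos_nonneg) simp_all
      next
        assume "0 < n j \<and> m = dec n j"
        then have "n = inc m j" "0 < mu j * phi j n"
          using mu_pos phi_pos j(1) by (simp_all add: dec_eq_iff)
        then show ?thesis
          using lam_nonneg[OF j(1)] by (intro add_nonneg_pos) simp_all
      qed
      then show ?thesis
        unfolding flow_rates_def using j(1) finite_K lam_nonneg departure_nonneg
        by (intro sum_pos2[of K j] add_nonneg_nonneg) auto
    qed
    have "(\<Sum>m\<in>nbrs n. q n m * ?g m) < (\<Sum>m\<in>nbrs n. q n m * 1)"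
    proof (rule sum_strict_mono_ex1[OF finite_nbrs])
      show "\<exists>m\<in>nbrs n. q n m * ?g m < q n m * 1"
        using m(1) k q_pos by (intro bexI[of _ m]) auto
      show "\<forall>m\<in>nbrs n. q n m * ?g m \<le> q n m * 1"
      proof
        fix m
        show "q n m * ?g m \<le> q n m * 1"
          using D flow_rates_nonneg by (intro mult_left_mono) auto
      qed
    qed
    then have "outflow ?g n < rate n"
      using sum_nbrs_outflow[of n "\<lambda>_. 1"] outflow_const[of 1 n] by (simp add: sum_nbrs_outflow)
    then have "?D (Suc k) n < 1"
      using rate_pos[of n] by (simp add: taboo_def)
    then show ?thesis by blast
  qed
  have Z_all: "n \<in> Z" if "n \<in> states K" for n
  proof (rule states_connected[OF _ _ i that])
    show "i \<in> Z" by (simp add: Z_def)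
    fix n k assume "n \<in> states K" and k: "k \<in> K"
    have "inc n k \<in> nbrs n" "n \<in> nbrs (inc n k)"
      using k by (auto simp: nbrs_def image_iff intro!: bexI[of _ k])
    then show "n \<in> Z \<longleftrightarrow> inc n k \<in> Z"
      using step by (auto simp: Z_def)
  qed
  \<comment> \<open>Membership in \<open>Z\<close> says nothing when \<open>n = i\<close>, so the
    conclusion is drawn from a neighbour in \<open>Z\<close>.\<close>
  obtain k where "k \<in> K" using K_nonempty by auto
  then show ?thesis
    using step[of "inc n k" n] Z_all[of "inc n k"] n by (auto simp: nbrs_def upd_in_states)
qed

text \<open>\<open>W\<close> decreases only outside \<open>F\<close>. The sum \<open>E\<close> of
  the survival probabilities up to a horizon \<open>l\<close> repairs this: killing lowers it by
  \<open>1 - D l\<close>, which is nonnegative everywhere and bounded away from 0 on the finite set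
  \<open>F\<close>.\<close>

lemma return_function_exists:
  assumes W: "\<And>n. 0 \<le> W n" and F: "finite F" "F \<subseteq> states K"
    and eps: "0 < eps" and drift: "\<And>n. n \<in> states K - F \<Longrightarrow> gen W n \<le> - eps"
    and i: "i \<in> states K"
  shows "\<exists>V. (\<forall>n. 0 \<le> V n) \<and> (\<forall>n\<in>states K. 1 + taboo i V n \<le> V n)"
proof -
  define D where "D k = ((taboo i) ^^ k) (\<lambda>_. 1)" for k
  have D_0: "D 0 = (\<lambda>_. 1)" and D_Suc: "D (Suc k) n = taboo i (D k) n" for k n
    by (simp_all add: D_def)
  have D_nonneg: "0 \<le> D k n" for k n
  proof (induction k arbitrary: n)
    case (Suc k)
    have "taboo i (\<lambda>_. 0) n \<le> taboo i (D k) n" using Suc by (intro taboo_mono)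
    then show ?case by (simp add: D_Suc taboo_def outflow_def cong: if_cong)
  qed (simp add: D_0)
  have D_antimono: "D (Suc k) n \<le> D k n" for k n
  proof (induction k arbitrary: n)
    case 0
    have "outflow (\<lambda>m. if m = i then 0 else 1) n \<le> outflow (\<lambda>_. 1) n"
      by (rule outflow_mono) auto
    then show ?case
      using rate_pos[of n] by (simp add: D_Suc D_0 taboo_def outflow_const)
  next
    case (Suc k)
    then show ?case by (simp add: D_Suc[of "Suc k"] D_Suc[of k] taboo_mono)
  qed
  have D_mono: "D l n \<le> D k n" if "k \<le> l" for k l n
    using that D_antimono by (rule lift_Suc_antimono_le[of "\<lambda>k. D k n", rotated])
  obtain k where k: "\<And>n. n \<in> F \<Longrightarrow> D (k n) n < 1"
    using taboo_survival_lt_1[OF i] F(2) unfolding D_def by (metis subsetD)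
  \<comment> \<open>Survival probabilities decrease in the horizon, so this sum serves all states of
    \<open>F\<close> at once.\<close>
  define l where "l = (\<Sum>n\<in>F. k n)"
  have l: "D l n < 1" if "n \<in> F" for n
    using D_mono[of "k n" l n] k[OF that] member_le_sum[OF that, of k] F(1) by (auto simp: l_def)
  define eta where "eta = Min (insert 1 ((\<lambda>n. 1 - D l n) ` F))"
  have eta: "0 < eta" "\<And>n. n \<in> F \<Longrightarrow> eta \<le> 1 - D l n"
    unfolding eta_def using F(1) l by (auto simp: Min_gr_iff intro: Min_le)
  define C where "C = (\<Sum>n\<in>F. \<bar>gen W n / rate n\<bar>)"
  have C: "\<bar>gen W n / rate n\<bar> \<le> C" if "n \<in> F" for n
    unfolding C_def using that F(1) by (intro member_le_sum) auto
  have C_nonneg: "0 \<le> C" unfolding C_def by (intro sum_nonneg) auto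
  \<comment> \<open>\<open>A\<close> turns a drift of \<open>eps\<close> per unit of time into a
    decrease of at least 1 per jump, \<open>total_rate\<close> bounding the jump rate. Below,
    \<open>B\<close> pays on \<open>F\<close> for the possible increase \<open>A * C\<close> of the
    first part and for the required 1.\<close>
  define A where "A = total_rate / eps"
  have A: "0 < A" unfolding A_def using total_rate_pos eps by simp
  define B where "B = (1 + A * C) / eta"
  have B: "0 \<le> B" unfolding B_def using A C_nonneg eta by simp
  define E where "E n = (\<Sum>k<l. D k n)" for n
  define V where "V n = A * W n + B * E n" for n
  have E_eq: "E n - taboo i E n = 1 - D l n" for n
  proof -
    have "taboo i (\<lambda>m. \<Sum>k<l. D k m) n = (\<Sum>k<l. D (Suc k) n)" for l
    proof (induction l)
      case 0
      show ?case by (simp add: taboo_def outflow_def cong: if_cong)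
    next
      case (Suc l)
      then show ?case
        using taboo_linear[of i 1 "\<lambda>m. \<Sum>k<l. D k m" 1 "D l" n] by (simp add: D_Suc)
    qed
    then show ?thesis
      using sum_lessThan_telescope'[of "\<lambda>k. D k n" l]
      by (simp add: E_def[abs_def] D_0 flip: sum_subtractf)
  qed
  have W_ge: "- (gen W n / rate n) \<le> W n - taboo i W n" for n
  proof -
    have "taboo i W n \<le> outflow W n / rate n"
      unfolding taboo_def using rate_pos[of n] W by (intro divide_right_mono outflow_mono) (auto intro: less_imp_le)
    then show ?thesis
      using rate_pos[of n] by (simp add: gen_eq diff_divide_distrib)
  qed
  have "1 + taboo i V n \<le> V n" if n: "n \<in> states K" for n
  proof -
    have V_eq: "V n - taboo i V n = A * (W n - taboo i W n) + B * (1 - D l n)"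
      unfolding V_def[abs_def] taboo_linear E_eq[symmetric] by (simp add: algebra_simps)
    have Dl: "D l n \<le> 1" using D_mono[of 0 l n] by (simp add: D_0)
    have "1 \<le> V n - taboo i V n"
    proof (cases "n \<in> F")
      case True
      have "A * (- C) \<le> A * (W n - taboo i W n)"
        using A abs_le_D1[OF C[OF True]] W_ge[of n] by (intro mult_left_mono) linarith+
      moreover have "1 + A * C \<le> B * (1 - D l n)"
        using mult_left_mono[OF eta(2)[OF True] B] eta(1) by (simp add: B_def)
      ultimately show ?thesis by (simp add: V_eq)
    next
      case False
      then have "eps \<le> - gen W n" using drift[of n] n by simp
      then have "eps / rate n \<le> - gen W n / rate n"
        using rate_pos[of n] by (intro divide_right_mono) auto
      moreover have "eps / total_rate \<le> eps / rate n"
        using rate_pos[of n] rate_le[of n] eps by (intro divide_left_mono) (auto intro: mult_pos_pos total_rate_pos)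
      ultimately have "eps / total_rate \<le> W n - taboo i W n"
        using W_ge[of n] by simp
      then have "1 \<le> A * (W n - taboo i W n)"
        using mult_left_mono[of "eps / total_rate" "W n - taboo i W n" A] A eps total_rate_pos
        by (simp add: A_def)
      then show ?thesis using B Dl by (simp add: V_eq add_increasing2)
    qed
    then show ?thesis by simp
  qed
  moreover have "0 \<le> V n" for n
    unfolding V_def E_def using A B W D_nonneg by (auto intro!: add_nonneg_nonneg mult_nonneg_nonneg sum_nonneg)
  ultimately show ?thesis by blast
qed

lemma positive_recurrent_if_drift:
  fixes P :: "(nat \<Rightarrow> nat) \<Rightarrow> 'w measure"
  assumes fam: "markov_jump_family (states K) q P N"
    and W: "\<And>n. 0 \<le> W n" and F: "finite F" "F \<subseteq> states K"
    and eps: "0 < eps" and drift: "\<And>n. n \<in> states K - F \<Longrightarrow> gen W n \<le> - eps"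
  shows "positive_recurrent (states K) P N"
  unfolding positive_recurrent_def
proof
  fix i assume i: "i \<in> states K"
  obtain V where V: "\<And>n. 0 \<le> V n" "\<And>n. n \<in> states K \<Longrightarrow> 1 + taboo i V n \<le> V n"
    using return_function_exists[OF W F eps drift i] by auto
  have mjp: "markov_jump_process (P i) (states K) q N" and N0: "AE \<omega> in P i. N 0 \<omega> = i"
    using fam i by (auto simp: markov_jump_family_def)
  then obtain Y :: "nat \<Rightarrow> 'w \<Rightarrow> _" and H :: "nat \<Rightarrow> 'w \<Rightarrow> real" where
    prob: "prob_space (P i)" and
    Y[measurable]: "\<And>n. Y n \<in> measurable (P i) (count_space (states K))" and
    H[measurable]: "\<And>n. H n \<in> borel_measurable (P i)" and
    law: "\<And>n s t. (\<And>k. k \<le> n \<Longrightarrow> s k \<in> states K \<and> 0 \<le> t k) \<Longrightarrow>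
           measure (P i) {\<omega> \<in> space (P i). \<forall>k\<le>n. Y k \<omega> = s k \<and> t k < H k \<omega>} =
             measure (P i) {\<omega> \<in> space (P i). Y 0 \<omega> = s 0}
             * (\<Prod>k<n. jump_prob (states K) q (s k) (s (Suc k)))
             * (\<Prod>k\<le>n. exp (- exit_rate (states K) q (s k) * t k))" and
    N: "AE \<omega> in P i. \<forall>n t. (\<Sum>k<n. H k \<omega>) \<le> t \<and> t < (\<Sum>k<Suc n. H k \<omega>) \<longrightarrow> N t \<omega> = Y n \<omega>"
    unfolding markov_jump_process_def jump_prob_def by blast
  interpret prob_space "P i" by (rule prob)
  \<comment> \<open>The family prescribes \<open>N 0\<close>, not \<open>Y 0\<close>. They are tied
    together only if the first holding interval is nonempty, which \<open>law\<close> yields state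
    by state.\<close>
  have "AE \<omega> in P i. 0 < H 0 \<omega>"
  proof -
    have "AE \<omega> in P i. \<forall>x\<in>states K. \<not> (Y 0 \<omega> = x \<and> \<not> 0 < H 0 \<omega>)"
    proof (subst AE_ball_countable[OF countable_states], rule ballI)
      fix x assume x: "x \<in> states K"
      let ?A = "{\<omega> \<in> space (P i). Y 0 \<omega> = x}" and ?B = "{\<omega> \<in> space (P i). Y 0 \<omega> = x \<and> 0 < H 0 \<omega>}"
      have "prob ?B = prob ?A"
        using law[of 0 "\<lambda>_. x" "\<lambda>_. 0"] x by simp
      then have "prob (?A - ?B) = 0"
        by (subst finite_measure_Diff) auto
      moreover have "?A - ?B = {\<omega> \<in> space (P i). Y 0 \<omega> = x \<and> \<not> 0 < H 0 \<omega>}" by auto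
      ultimately show "AE \<omega> in P i. \<not> (Y 0 \<omega> = x \<and> \<not> 0 < H 0 \<omega>)"
        by (subst prob_Collect_eq_0[symmetric]) auto
    qed
    with AE_space[of "P i"] show ?thesis
    proof eventually_elim
      case (elim \<omega>)
      then have "Y 0 \<omega> \<in> states K" using measurable_space[OF Y[of 0]] by simp
      then show ?case using elim by simp
    qed
  qed
  with N N0 have Y0: "AE \<omega> in P i. Y 0 \<omega> = i"
  proof eventually_elim
    case (elim \<omega>)
    then show ?case using elim(1)[rule_format, of 0 0] by simp
  qed
  interpret jump_chain "P i" "states K" q Y H i "\<Sum>k\<in>K. lam k"
  proof
    show "(\<integral>\<^sup>+m. ennreal (jump_prob (states K) q n m) \<partial>count_space (states K)) = 1" if "n \<in> states K" for n
      using jump_prob_integral[OF that, of "\<lambda>_. 1"] rate_pos[of n] by (simp add: outflow_const)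
  qed (use countable_states law i Y0 jump_prob_nonneg sum_lam_pos rate_ge in \<open>auto simp: exit_rate_eq\<close>)
  show "(\<integral>\<^sup>+\<omega>. return_time N i \<omega> \<partial>P i) < \<infinity>"
  proof (rule expected_return_time_finite[OF _ N])
    fix n assume n: "n \<in> states K"
    have "(\<integral>\<^sup>+m. ennreal (jump_prob (states K) q n m) * ennreal (V m) \<partial>count_space (states K - {i}))
       = (\<integral>\<^sup>+m. ennreal (jump_prob (states K) q n m) * ennreal (if m = i then 0 else V m) \<partial>count_space (states K))"
      by (subst nn_integral_count_space_eq[where A = "states K" and B = "states K - {i}"])
        (auto intro!: nn_integral_cong)
    also have "\<dots> = ennreal (taboo i V n)"
      unfolding taboo_def using V(1) n by (intro jump_prob_integral) auto
    finally have "1 + (\<integral>\<^sup>+m. ennreal (jump_prob (states K) q n m) * ennreal (V m) \<partial>count_space (states K - {i}))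
       = 1 + ennreal (taboo i V n)" by simp
    also have "\<dots> = ennreal (1 + taboo i V n)"
    proof -
      have "taboo i (\<lambda>_. 0) n \<le> taboo i V n" using V(1) by (rule taboo_mono)
      then have "0 \<le> taboo i V n" by (simp add: taboo_def outflow_def cong: if_cong)
      then show ?thesis by (simp add: ennreal_plus[symmetric] del: ennreal_plus flip: ennreal_1)
    qed
    also have "\<dots> \<le> ennreal (V n)"
      using V(2)[OF n] by (rule ennreal_leI)
    finally show "1 + (\<integral>\<^sup>+m. ennreal (jump_prob (states K) q n m) * ennreal (V m) \<partial>count_space (states K - {i}))
       \<le> ennreal (V n)" .
  qed
qed

end

section \<open>Stationary distributions as limits of Cesaro averages\<close>

text \<open>Tychonoff. Refining the filter, instead of extracting a subsequence, gives convergence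
  at all points simultaneously.\<close>

lemma function_cluster_point:
  fixes f :: "'t \<Rightarrow> 'a \<Rightarrow> real"
  assumes F: "F \<noteq> bot" and f: "\<And>t a. f t a \<in> {0..1}"
  shows "\<exists>p G. G \<noteq> bot \<and> G \<le> F \<and> (\<forall>a. ((\<lambda>t. f t a) \<longlongrightarrow> p a) G)"
proof -
  have "compactin (product_topology (\<lambda>_. euclidean) UNIV) (PiE (UNIV :: 'a set) (\<lambda>_. {0..1::real}))"
    by (subst compactin_PiE) simp
  then have "compact (PiE (UNIV :: 'a set) (\<lambda>_. {0..1::real}))"
    unfolding euclidean_product_topology by simp
  moreover have "filtermap f F \<noteq> bot" using F by (simp add: filtermap_bot_iff)
  moreover have "eventually (\<lambda>g. g \<in> PiE UNIV (\<lambda>_. {0..1})) (filtermap f F)"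
    using f unfolding eventually_filtermap by (intro always_eventually) auto
  ultimately obtain p where p: "inf (nhds p) (filtermap f F) \<noteq> bot"
    unfolding compact_filter by blast
  \<comment> \<open>The restriction of \<open>F\<close> to indices at which \<open>f\<close> is near
    \<open>p\<close>; it is proper precisely because \<open>p\<close> is a cluster point.\<close>
  define G where "G = inf F (filtercomap f (nhds p))"
  have "G \<noteq> bot"
  proof
    assume "G = bot"
    then have "eventually (\<lambda>_. False) (inf F (filtercomap f (nhds p)))"
      by (simp add: G_def)
    then obtain Q R where QR: "eventually Q F" "eventually R (nhds p)" "\<And>t. Q t \<Longrightarrow> \<not> R (f t)"
      unfolding eventually_inf eventually_filtercomap by blast
    then have "eventually (\<lambda>g. \<not> R g) (filtermap f F)"
      by (auto simp: eventually_filtermap elim: eventually_mono)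
    then have "eventually (\<lambda>_. False) (inf (nhds p) (filtermap f F))"
      unfolding eventually_inf using QR(2) by (intro exI[of _ R] exI[of _ "\<lambda>g. \<not> R g"]) auto
    then show False using p by (simp add: trivial_limit_def[symmetric])
  qed
  moreover have "G \<le> F" by (simp add: G_def)
  moreover have "((\<lambda>t. f t a) \<longlongrightarrow> p a) G" for a
  proof -
    have lim: "filterlim f (nhds p) G"
      by (simp add: G_def filterlim_iff_le_filtercomap)
    show ?thesis
    proof (rule topological_tendstoI)
      fix V assume V: "open V" "p a \<in> V"
      have "open ((\<lambda>g :: 'a \<Rightarrow> real. g a) -` V)"
        using V(1) by (intro open_vimage continuous_on_product_coordinates)
      then have "eventually (\<lambda>g. g a \<in> V) (nhds p)"
        using V(2) unfolding eventually_nhds by (intro exI[of _ "(\<lambda>g. g a) -` V"]) auto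
      with lim show "eventually (\<lambda>t. f t a \<in> V) G"
        by (auto simp: filterlim_iff)
    qed
  qed
  ultimately show ?thesis by blast
qed

lemma has_sum_sum:
  fixes f :: "'i \<Rightarrow> 'a \<Rightarrow> 'b::topological_comm_monoid_add"
  assumes "finite I" "\<And>i. i \<in> I \<Longrightarrow> (f i has_sum s i) A"
  shows "((\<lambda>x. \<Sum>i\<in>I. f i x) has_sum (\<Sum>i\<in>I. s i)) A"
  using assms by (induction rule: finite_induct) (auto intro!: has_sum_add)

lemma pmf_has_sum:
  assumes "set_pmf p \<subseteq> A"
  shows "(pmf p has_sum 1) A"
proof -
  have "pmf p summable_on A"
    using pmf_abs_summable[of p A] by (simp add: abs_summable_equivalent[symmetric] abs_summable_summable)
  moreover have "infsum (pmf p) A = 1"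
    using infsetsum_pmf_eq_1[OF assms] infsetsum_infsum[OF pmf_abs_summable[of p A]] by simp
  ultimately show ?thesis by (simp add: has_sum_iff)
qed

section \<open>Uniqueness of the stationary distribution and the uniformised chain\<close>

context flow_system
begin

lemma inflow_linear: "inflow (\<lambda>n. a * f n + b * g n) n = a * inflow f n + b * inflow g n"
  unfolding inflow_def sum_distrib_left sum.distrib[symmetric]
  by (intro sum.cong) (auto simp: algebra_simps)

text \<open>Conservation of mass: reindexing by \<open>inc n k\<close> matches every term of the
  inflow with a term of the outflow, so both have the same total.\<close>

lemma inflow_has_sum:
  assumes g: "g summable_on states K"
    and rg: "\<And>k. k \<in> K \<Longrightarrow> (\<lambda>n. g n * (mu k * phi k n)) summable_on states K"
  shows "\<exists>s. (inflow g has_sum s) (states K) \<and> ((\<lambda>n. g n * rate n) has_sum s) (states K)"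
proof -
  let ?S = "states K"
  have inj: "inj_on (\<lambda>n. inc n k) ?S" for k
    by (intro inj_onI) (metis fun_upd_same fun_upd_triv fun_upd_upd add_right_cancel)
  have img: "(\<lambda>n. inc n k) ` ?S = {n \<in> ?S. 0 < n k}" if "k \<in> K" for k
  proof (intro set_eqI iffI)
    fix n assume n: "n \<in> {n \<in> ?S. 0 < n k}"
    then have "n = inc (dec n k) k" by (auto simp: dec_eq_iff)
    then show "n \<in> (\<lambda>n. inc n k) ` ?S"
      using n that by (intro image_eqI[of _ _ "dec n k"]) (auto simp: upd_in_states)
  qed (use that in \<open>auto simp: upd_in_states\<close>)
  have 1: "((\<lambda>n. if 0 < n k then g (dec n k) * lam k else 0) has_sum (infsum g ?S * lam k)) ?S" if k: "k \<in> K" for k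
  proof -
    have "((\<lambda>n. g n * lam k) has_sum (infsum g ?S * lam k)) ?S"
      using g by (intro has_sum_cmult_left has_sum_infsum)
    then have "((\<lambda>n. g (dec n k) * lam k) has_sum (infsum g ?S * lam k)) ((\<lambda>n. inc n k) ` ?S)"
      by (subst has_sum_reindex[OF inj]) (simp add: o_def)
    then show ?thesis
      unfolding img[OF k] by (rule has_sum_cong_neutral[THEN iffD1, rotated -1]) auto
  qed
  have 2: "((\<lambda>n. g (inc n k) * (mu k * phi k (inc n k))) has_sum (infsum (\<lambda>n. g n * (mu k * phi k n)) ?S)) ?S"
    if k: "k \<in> K" for k
  proof -
    have "((\<lambda>n. g n * (mu k * phi k n)) has_sum (infsum (\<lambda>n. g n * (mu k * phi k n)) ?S)) ?S"
      using rg[OF k] by (rule has_sum_infsum)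
    then have "((\<lambda>n. g n * (mu k * phi k n)) has_sum (infsum (\<lambda>n. g n * (mu k * phi k n)) ?S)) ((\<lambda>n. inc n k) ` ?S)"
      unfolding img[OF k] by (rule has_sum_cong_neutral[THEN iffD1, rotated -1]) (use k phi_zero in auto)
    then show ?thesis
      by (subst (asm) has_sum_reindex[OF inj]) (simp add: o_def)
  qed
  let ?s = "\<Sum>k\<in>K. infsum g ?S * lam k + infsum (\<lambda>n. g n * (mu k * phi k n)) ?S"
  have "(inflow g has_sum ?s) ?S"
    unfolding inflow_def[abs_def] using 1 2 by (intro has_sum_sum has_sum_add finite_K) auto
  moreover have "((\<lambda>n. \<Sum>k\<in>K. g n * lam k + g n * (mu k * phi k n)) has_sum ?s) ?S"
    using g rg by (intro has_sum_sum has_sum_add has_sum_cmult_left has_sum_infsum finite_K) auto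
  ultimately show ?thesis
    by (auto simp: rate_def sum_distrib_left distrib_left)
qed

text \<open>Where \<open>g\<close> vanishes, its inflow is a vanishing sum of nonnegative terms with
  positive rates, so \<open>g\<close> vanishes at all neighbours.\<close>

lemma balanced_zero:
  assumes g: "\<And>n. n \<in> states K \<Longrightarrow> 0 \<le> g n"
    and bal: "\<And>n. n \<in> states K \<Longrightarrow> inflow g n = g n * rate n"
    and z: "z \<in> states K" "g z = 0" and n: "n \<in> states K"
  shows "g n = 0"
proof -
  have zero: "(0 < n k \<longrightarrow> g (dec n k) = 0) \<and> g (inc n k) = 0"
    if n: "n \<in> states K" "g n = 0" and k: "k \<in> K" for n k
  proof -
    have "inflow g n = 0" using bal[OF n(1)] n by simp
    moreover have "0 \<le> (if 0 < n j then g (dec n j) * lam j else 0)" "0 \<le> g (inc n j) * (mu j * phi j (inc n j))"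
      if "j \<in> K" for j
      using that n g by (auto intro!: mult_nonneg_nonneg lam_nonneg mu_nonneg phi_nonneg upd_in_states)
    ultimately have "(if 0 < n k then g (dec n k) * lam k else 0) + g (inc n k) * (mu k * phi k (inc n k)) = 0"
      unfolding inflow_def using finite_K k
      by (subst (asm) sum_nonneg_eq_0_iff) (auto intro: add_nonneg_nonneg)
    then have "(if 0 < n k then g (dec n k) * lam k else 0) = 0" "g (inc n k) * (mu k * phi k (inc n k)) = 0"
      using \<open>\<And>j. j \<in> K \<Longrightarrow> 0 \<le> (if 0 < n j then g (dec n j) * lam j else 0)\<close>[OF k]
        \<open>\<And>j. j \<in> K \<Longrightarrow> 0 \<le> g (inc n j) * (mu j * phi j (inc n j))\<close>[OF k] by linarith+
    moreover have "0 < phi k (inc n k)" using k by (intro phi_pos) auto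
    ultimately show ?thesis
      using lam_pos[OF k] mu_pos[OF k] by (auto split: if_splits)
  qed
  have "n \<in> {n. g n = 0}"
  proof (rule states_connected[OF _ _ z(1) n])
    fix n k assume *: "n \<in> states K" "k \<in> K"
    show "n \<in> {n. g n = 0} \<longleftrightarrow> inc n k \<in> {n. g n = 0}"
    proof
      assume "inc n k \<in> {n. g n = 0}"
      then have "g (dec (inc n k) k) = 0"
        using zero[OF upd_in_states[OF *, of "n k + 1"] _ *(2)] by auto
      then show "n \<in> {n. g n = 0}" by simp
    qed (use zero[OF *(1) _ *(2)] in simp)
  qed (use z in simp)
  then show ?thesis by simp
qed

text \<open>The difference of two stationary distributions has balanced positive and negative parts,
  and at any state one of them vanishes.\<close>

lemma stationary_distribution_unique:
  assumes p: "stationary_distribution (states K) q p" and p': "stationary_distribution (states K) q p'"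
  shows "p = p'"
proof -
  let ?S = "states K"
  define d where "d n = pmf p n - pmf p' n" for n
  have sp: "set_pmf p \<subseteq> ?S" "set_pmf p' \<subseteq> ?S"
    using p p' by (auto simp: stationary_distribution_iff)
  have d_sum: "(d has_sum 0) ?S"
    using has_sum_add[OF pmf_has_sum[OF sp(1)] has_sum_cmult_right[OF pmf_has_sum[OF sp(2)], of "-1"]]
    by (simp add: d_def[abs_def])
  have d_bal: "inflow d n = d n * rate n" if "n \<in> ?S" for n
    using p p' that inflow_linear[of 1 "pmf p" "-1" "pmf p'" n]
    by (auto simp: stationary_distribution_iff d_def[abs_def] algebra_simps)
  have abs_d: "(\<lambda>n. \<bar>d n\<bar>) summable_on ?S"
  proof (rule summable_on_comparison_test)
    show "(\<lambda>n. pmf p n + pmf p' n) summable_on ?S"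
      using pmf_has_sum[OF sp(1)] pmf_has_sum[OF sp(2)] by (intro summable_on_add) (auto simp: has_sum_iff)
  qed (auto simp: d_def abs_le_iff intro: add_increasing order_trans[OF _ pmf_nonneg])
  have summ: "(\<lambda>n. \<bar>d n\<bar> * (mu k * phi k n)) summable_on ?S" if k: "k \<in> K" for k
  proof (rule summable_on_comparison_test)
    show "(\<lambda>n. \<bar>d n\<bar> * mu k) summable_on ?S"
      using abs_d by (rule summable_on_cmult_left)
  qed (use k phi_le_1 phi_nonneg mu_nonneg in \<open>auto intro!: mult_left_mono mult_nonneg_nonneg simp: mult_le_cancel_left1 mult_left_le\<close>)
  obtain s where s: "(inflow (\<lambda>n. \<bar>d n\<bar>) has_sum s) ?S" "((\<lambda>n. \<bar>d n\<bar> * rate n) has_sum s) ?S"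
    using inflow_has_sum[OF abs_d summ] by blast
  have le: "\<bar>d n\<bar> * rate n \<le> inflow (\<lambda>n. \<bar>d n\<bar>) n" if "n \<in> ?S" for n
  proof -
    have "\<bar>d n\<bar> * rate n = \<bar>inflow d n\<bar>"
      using rate_pos[of n] by (simp add: d_bal[OF that] abs_mult)
    also have "\<dots> \<le> inflow (\<lambda>n. \<bar>d n\<bar>) n"
      unfolding inflow_def
    proof (rule order_trans[OF sum_abs sum_mono])
      fix k assume k: "k \<in> K"
      show "\<bar>(if 0 < n k then d (dec n k) * lam k else 0) + d (inc n k) * (mu k * phi k (inc n k))\<bar>
        \<le> (if 0 < n k then \<bar>d (dec n k)\<bar> * lam k else 0) + \<bar>d (inc n k)\<bar> * (mu k * phi k (inc n k))"
        by (rule order_trans[OF abs_triangle_ineq])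
          (auto simp: abs_mult lam_nonneg[OF k] mu_nonneg[OF k] phi_nonneg[OF k])
    qed
    finally show ?thesis .
  qed
  \<comment> \<open>The two sides of \<open>le\<close> have the same total \<open>s\<close>, so the
    inequality is an equality at every state.\<close>
  have "inflow (\<lambda>n. \<bar>d n\<bar>) n = \<bar>d n\<bar> * rate n" if "n \<in> ?S" for n
  proof -
    have "((\<lambda>n. inflow (\<lambda>n. \<bar>d n\<bar>) n + (-1) * (\<bar>d n\<bar> * rate n)) has_sum (s + (-1) * s)) ?S"
      by (intro has_sum_add has_sum_cmult_right s)
    then have "inflow (\<lambda>n. \<bar>d n\<bar>) n + (-1) * (\<bar>d n\<bar> * rate n) = 0"
      by (rule nonneg_has_sum_le_0D) (use le that in auto)
    then show ?thesis by simp
  qed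
  then have bal: "inflow (\<lambda>n. 1 * \<bar>d n\<bar> + c * d n) n = (1 * \<bar>d n\<bar> + c * d n) * rate n" if "n \<in> ?S" for n c
    unfolding inflow_linear using that d_bal[OF that] by (simp add: algebra_simps)
  let ?z = "\<lambda>_::nat. 0::nat"
  have z: "?z \<in> ?S" by (simp add: states_def)
  \<comment> \<open>The sign makes \<open>\<bar>d n\<bar> + c * d n\<close> vanish at the empty
    state, hence everywhere by \<open>balanced_zero\<close>. So \<open>d\<close> does not change
    sign, and having sum 0 it vanishes.\<close>
  define c :: real where "c = (if 0 \<le> d ?z then -1 else 1)"
  have "1 * \<bar>d n\<bar> + c * d n = 0" if "n \<in> ?S" for n
    by (rule balanced_zero[OF _ bal z _ that]) (auto simp: c_def)
  then have *: "\<bar>d n\<bar> = - c * d n" if "n \<in> ?S" for n using that by fastforce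
  have "((\<lambda>n. - c * d n) has_sum 0) ?S"
    using has_sum_cmult_right[OF d_sum, of "-c"] by simp
  then have cd: "- c * d n = 0" if "n \<in> ?S" for n
  proof (rule nonneg_has_sum_le_0D)
    show "0 \<le> - c * d m" if "m \<in> ?S" for m
      using *[OF that] abs_ge_zero[of "d m"] by simp
  qed (use that in auto)
  have "c \<noteq> 0" by (simp add: c_def)
  then have "d n = 0" if "n \<in> ?S" for n
    using cd[OF that] by simp
  moreover have "d n = 0" if "n \<notin> ?S" for n
  proof -
    have "n \<notin> set_pmf p" "n \<notin> set_pmf p'" using sp that by auto
    then show ?thesis by (simp add: d_def set_pmf_iff)
  qed
  ultimately show ?thesis
    by (intro pmf_eqI) (auto simp: d_def)
qed

text \<open>The transition operator of the uniformised chain.\<close>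

definition step :: "((nat \<Rightarrow> nat) \<Rightarrow> real) \<Rightarrow> (nat \<Rightarrow> nat) \<Rightarrow> real" where
  "step f n = f n + gen f n / total_rate"

text \<open>The powers run from 1 to \<open>T\<close> rather than from 0, the shift for which
  \<open>gen_corrector\<close> is an exact identity.\<close>

definition avg :: "nat \<Rightarrow> ((nat \<Rightarrow> nat) \<Rightarrow> real) \<Rightarrow> (nat \<Rightarrow> nat) \<Rightarrow> real" where
  "avg T f n = (\<Sum>t<T. (step ^^ Suc t) f n) / real T"

lemma gen_linear: "gen (\<lambda>n. a * f n + b * g n) n = a * gen f n + b * gen g n"
  unfolding gen_def sum_distrib_left sum.distrib[symmetric]
  by (intro sum.cong) (auto simp: algebra_simps)

lemma gen_zero: "gen (\<lambda>_. c) n = 0"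
  by (simp add: gen_def)

lemma step_linear: "step (\<lambda>n. a * f n + b * g n) = (\<lambda>n. a * step f n + b * step g n)"
  by (rule ext) (simp add: step_def gen_linear algebra_simps add_divide_distrib)

lemma funpow_step_linear:
  "(step ^^ t) (\<lambda>n. a * f n + b * g n) = (\<lambda>n. a * (step ^^ t) f n + b * (step ^^ t) g n)"
  by (induction t) (simp_all add: step_linear)

lemma funpow_step_const: "(step ^^ t) (\<lambda>_. c) = (\<lambda>_. c)"
  by (induction t) (auto simp: step_def[abs_def] gen_zero)

text \<open>\<open>total_rate\<close> dominates every exit rate, so the weight left on the diagonal
  is nonnegative and \<open>step\<close> is a positive operator.\<close>

lemma step_mono:
  assumes n: "n \<in> states K" and fg: "\<And>m. m \<in> states K \<Longrightarrow> f m \<le> g m"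
  shows "step f n \<le> step g n"
proof -
  have step_eq: "step f n = (1 - rate n / total_rate) * f n + outflow f n / total_rate" for f
    by (simp add: step_def gen_eq algebra_simps diff_divide_distrib)
  have "0 \<le> 1 - rate n / total_rate"
    using rate_le[of n] total_rate_pos by simp
  moreover have "outflow f n \<le> outflow g n"
    using n by (intro outflow_mono fg upd_in_states)
  ultimately show ?thesis
    unfolding step_eq using fg[OF n] total_rate_pos
    by (intro add_mono mult_left_mono divide_right_mono) auto
qed

lemma funpow_step_mono:
  assumes "\<And>m. m \<in> states K \<Longrightarrow> f m \<le> g m" "n \<in> states K"
  shows "(step ^^ t) f n \<le> (step ^^ t) g n"
  using assms(2)
proof (induction t arbitrary: n)
  case (Suc t)
  then show ?case by (auto intro: step_mono)
qed (use assms in auto)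

lemma funpow_step_bounds:
  assumes "\<And>m. m \<in> states K \<Longrightarrow> 0 \<le> f m \<and> f m \<le> 1" "n \<in> states K"
  shows "0 \<le> (step ^^ t) f n" "(step ^^ t) f n \<le> 1"
  using funpow_step_mono[of "\<lambda>_. 0" f n t] funpow_step_mono[of f "\<lambda>_. 1" n t] assms
  by (auto simp: funpow_step_const)

lemma avg_linear: "avg T (\<lambda>n. a * f n + b * g n) n = a * avg T f n + b * avg T g n"
  unfolding avg_def funpow_step_linear
  by (simp add: sum.distrib sum_distrib_left add_divide_distrib)

lemma avg_zero: "avg T (\<lambda>_. 0) n = 0"
  by (simp add: avg_def funpow_step_const del: funpow.simps)

lemma avg_const: "0 < T \<Longrightarrow> avg T (\<lambda>_. c) n = c"
  by (simp add: avg_def funpow_step_const del: funpow.simps)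

lemma avg_sum: "finite A \<Longrightarrow> avg T (\<lambda>n. \<Sum>i\<in>A. c i * f i n) n = (\<Sum>i\<in>A. c i * avg T (f i) n)"
proof (induction rule: finite_induct)
  case (insert i A)
  then show ?case
    using avg_linear[of T "c i" "f i" 1 "\<lambda>n. \<Sum>i\<in>A. c i * f i n" n] by simp
qed (simp add: avg_zero)

lemma avg_mono:
  assumes "\<And>m. m \<in> states K \<Longrightarrow> f m \<le> g m" "n \<in> states K"
  shows "avg T f n \<le> avg T g n"
  unfolding avg_def using assms by (intro divide_right_mono sum_mono funpow_step_mono) auto

lemma avg_bounds:
  assumes "\<And>m. m \<in> states K \<Longrightarrow> 0 \<le> f m \<and> f m \<le> 1" "n \<in> states K"
  shows "0 \<le> avg T f n" "avg T f n \<le> 1"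
proof -
  have "avg T (\<lambda>_. 1) n \<le> 1" by (cases "T = 0") (auto simp: avg_const, simp add: avg_def)
  then show "0 \<le> avg T f n" "avg T f n \<le> 1"
    using avg_mono[of "\<lambda>_. 0" f n T] avg_mono[of f "\<lambda>_. 1" n T] assms by (auto simp: avg_zero)
qed

text \<open>The average of a generator image telescopes to a boundary term divided by
  \<open>T\<close>. Applied to indicators it gives approximate balance, applied to a Lyapunov
  function tightness.\<close>

lemma avg_gen: "avg T (gen f) n = total_rate * ((step ^^ Suc T) f n - step f n) / real T"
proof -
  have *: "gen f = (\<lambda>n. total_rate * step f n + (- total_rate) * f n)"
    using total_rate_pos by (auto simp: step_def field_simps)
  have "(step ^^ Suc t) (gen f) n = total_rate * ((step ^^ Suc (Suc t)) f n - (step ^^ Suc t) f n)" for t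
    by (subst *, subst funpow_step_linear) (simp add: funpow_swap1 algebra_simps)
  then have "(\<Sum>t<T. (step ^^ Suc t) (gen f) n) = total_rate * (\<Sum>t<T. (step ^^ Suc (Suc t)) f n - (step ^^ Suc t) f n)"
    by (simp only: sum_distrib_left)
  also have "(\<Sum>t<T. (step ^^ Suc (Suc t)) f n - (step ^^ Suc t) f n) = (step ^^ Suc T) f n - step f n"
    using sum_lessThan_telescope[of "\<lambda>t. (step ^^ Suc t) f n" T] by simp
  finally show ?thesis by (simp add: avg_def)
qed

text \<open>Solves the Poisson equation up to a Cesaro average.\<close>

definition corrector :: "nat \<Rightarrow> ((nat \<Rightarrow> nat) \<Rightarrow> real) \<Rightarrow> (nat \<Rightarrow> nat) \<Rightarrow> real" where
  "corrector T f n = - (\<Sum>s<T. \<Sum>t\<le>s. (step ^^ t) f n) / (total_rate * real T)"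

lemma gen_sum: "finite A \<Longrightarrow> gen (\<lambda>n. \<Sum>i\<in>A. f i n) n = (\<Sum>i\<in>A. gen (f i) n)"
proof (induction rule: finite_induct)
  case (insert i A)
  then show ?case
    using gen_linear[of 1 "f i" 1 "\<lambda>n. \<Sum>i\<in>A. f i n" n] by simp
qed (simp add: gen_zero)

lemma gen_corrector:
  assumes "0 < T"
  shows "gen (corrector T f) n = f n - avg T f n"
proof -
  have 1: "gen ((step ^^ t) f) n = total_rate * ((step ^^ Suc t) f n - (step ^^ t) f n)" for t
    using total_rate_pos by (simp add: step_def)
  have "gen (\<lambda>n. \<Sum>s<T. \<Sum>t\<le>s. (step ^^ t) f n) n = (\<Sum>s<T. \<Sum>t\<le>s. gen ((step ^^ t) f) n)"
    by (simp add: gen_sum)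
  also have "\<dots> = (\<Sum>s<T. total_rate * ((step ^^ Suc s) f n - f n))"
    unfolding 1 sum_distrib_left[symmetric]
    using sum_lessThan_telescope[of "\<lambda>t. (step ^^ t) f n"] by (simp add: lessThan_Suc_atMost[symmetric])
  also have "\<dots> = total_rate * (\<Sum>s<T. (step ^^ Suc s) f n) - total_rate * real T * f n"
    by (simp add: sum_subtractf right_diff_distrib sum_distrib_left)
  finally have 2: "gen (\<lambda>n. \<Sum>s<T. \<Sum>t\<le>s. (step ^^ t) f n) n =
    total_rate * (\<Sum>s<T. (step ^^ Suc s) f n) - total_rate * real T * f n" .
  \<comment> \<open>The summand \<open>0 * 0\<close> puts the function into the shape required by
    \<open>gen_linear\<close>.\<close>
  have "corrector T f = (\<lambda>n. (- 1 / (total_rate * real T)) * (\<Sum>s<T. \<Sum>t\<le>s. (step ^^ t) f n) + 0 * 0)"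
    by (auto simp: corrector_def)
  then have "gen (corrector T f) n = (- 1 / (total_rate * real T)) * gen (\<lambda>n. \<Sum>s<T. \<Sum>t\<le>s. (step ^^ t) f n) n + 0 * gen (\<lambda>_. 0) n"
    by (simp only: gen_linear)
  then show ?thesis
    using total_rate_pos assms by (simp only: 2 avg_def) (simp add: divide_simps, simp add: algebra_simps)
qed

lemma corrector_bounds:
  assumes "\<And>m. m \<in> states K \<Longrightarrow> 0 \<le> f m \<and> f m \<le> 1" "n \<in> states K"
  shows "\<bar>corrector T f n\<bar> \<le> real T / total_rate"
proof (cases "T = 0")
  case False
  note b = funpow_step_bounds[of f, OF assms]
  have "(\<Sum>s<T. \<Sum>t\<le>s. (step ^^ t) f n) \<le> (\<Sum>s<T. \<Sum>t\<le>s. 1)"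
    using b by (intro sum_mono)
  also have "\<dots> \<le> (\<Sum>s<T. real T)"
    by (intro sum_mono) simp
  finally have "(\<Sum>s<T. \<Sum>t\<le>s. (step ^^ t) f n) \<le> real T * real T" by simp
  moreover have "0 \<le> (\<Sum>s<T. \<Sum>t\<le>s. (step ^^ t) f n)"
    using b by (intro sum_nonneg)
  ultimately show ?thesis
    using False total_rate_pos by (simp add: corrector_def field_simps)
qed (simp add: corrector_def)

text \<open>As a function of \<open>n\<close> this is the column of the rate matrix at
  \<open>j\<close>; the identity is the adjointness of \<open>outflow\<close> and
  \<open>inflow\<close>.\<close>

lemma gen_indicator:
  "gen (\<lambda>m. of_bool (m = j)) n = inflow (\<lambda>x. of_bool (n = x)) j - rate j * of_bool (n = j)"
proof -
  have "outflow (\<lambda>m. of_bool (m = j)) n = inflow (\<lambda>x. of_bool (n = x)) j"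
    unfolding outflow_def inflow_def
  proof (rule sum.cong)
    fix k assume k: "k \<in> K"
    have "lam k * of_bool (inc n k = j) = (if 0 < j k then of_bool (n = dec j k) * lam k else 0)"
      using dec_eq_iff[of j n k] by auto
    moreover have "mu k * phi k n * of_bool (dec n k = j) = of_bool (n = inc j k) * (mu k * phi k (inc j k))"
    proof (cases "n k = 0")
      case True
      then show ?thesis using phi_zero[OF k] by auto
    next
      case False
      then show ?thesis using dec_eq_iff[of n j k] by auto
    qed
    ultimately show "lam k * of_bool (inc n k = j) + mu k * phi k n * of_bool (dec n k = j) =
      (if 0 < j k then of_bool (n = dec j k) * lam k else 0) + of_bool (n = inc j k) * (mu k * phi k (inc j k))"
      by simp
  qed simp
  then show ?thesis by (auto simp: gen_eq)
qed

lemma avg_inflow: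
  "avg T (\<lambda>n. inflow (\<lambda>x. of_bool (n = x)) j) n = inflow (\<lambda>x. avg T (\<lambda>m. of_bool (m = x)) n) j"
proof -
  have "inflow (\<lambda>x. of_bool (n = x)) j = (\<Sum>k\<in>K. 1 *
    ((if 0 < j k then lam k else 0) * of_bool (n = dec j k) + mu k * phi k (inc j k) * of_bool (n = inc j k)))" for n
    unfolding inflow_def by (intro sum.cong) auto
  then have "avg T (\<lambda>n. inflow (\<lambda>x. of_bool (n = x)) j) n = (\<Sum>k\<in>K. 1 *
    ((if 0 < j k then lam k else 0) * avg T (\<lambda>n. of_bool (n = dec j k)) n + mu k * phi k (inc j k) * avg T (\<lambda>n. of_bool (n = inc j k)) n))"
    using finite_K by (simp only: avg_sum avg_linear)
  also have "\<dots> = inflow (\<lambda>x. avg T (\<lambda>m. of_bool (m = x)) n) j"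
    unfolding inflow_def by (intro sum.cong) auto
  finally show ?thesis .
qed

text \<open>The occupation measure of the uniformised chain over \<open>T\<close> steps is
  stationary up to an error of order \<open>1 / T\<close>, so cluster points satisfy the balance
  equations exactly.\<close>

lemma avg_indicator_balance:
  "n \<in> states K \<Longrightarrow> \<bar>inflow (\<lambda>x. avg T (\<lambda>m. of_bool (m = x)) n) j - rate j * avg T (\<lambda>m. of_bool (m = j)) n\<bar>
    \<le> total_rate / real T"
proof -
  assume n: "n \<in> states K"
  let ?e = "\<lambda>m. of_bool (m = j) :: real"
  have "avg T (gen ?e) n = avg T (\<lambda>n. 1 * inflow (\<lambda>x. of_bool (n = x)) j + (- rate j) * ?e n) n"
    by (simp add: gen_indicator[abs_def])
  also have "\<dots> = inflow (\<lambda>x. avg T (\<lambda>m. of_bool (m = x)) n) j - rate j * avg T ?e n"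
    unfolding avg_linear avg_inflow by simp
  finally have "inflow (\<lambda>x. avg T (\<lambda>m. of_bool (m = x)) n) j - rate j * avg T ?e n
      = total_rate * ((step ^^ Suc T) ?e n - (step ^^ Suc 0) ?e n) / real T"
    by (simp add: avg_gen)
  moreover have "\<bar>(step ^^ Suc T) ?e n - (step ^^ Suc 0) ?e n\<bar> \<le> 1"
    using funpow_step_bounds[of ?e n "Suc T"] funpow_step_bounds[of ?e n "Suc 0"] n by auto
  ultimately show ?thesis
    using total_rate_pos by (auto simp: abs_mult intro!: divide_right_mono simp: mult_le_cancel_left2)
qed

end

section \<open>Existence of the stationary distribution and limits of Cesaro averages\<close>

context flow_system
begin

abbreviation size_of :: "(nat \<Rightarrow> nat) \<Rightarrow> nat" where "size_of n \<equiv> \<Sum>k\<in>K. n k"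

abbreviation stationary where "stationary \<equiv> THE \<pi>. stationary_distribution (states K) q \<pi>"

context
  fixes U :: "(nat \<Rightarrow> nat) \<Rightarrow> real" and C \<delta> :: real
  assumes U_nonneg: "\<And>n. n \<in> states K \<Longrightarrow> 0 \<le> U n"
    and U_drift: "\<And>n. n \<in> states K \<Longrightarrow> gen U n \<le> C - \<delta> * real (size_of n)"
    and \<delta>_pos: "0 < \<delta>"
begin

text \<open>Averaging the drift inequality leaves a boundary term on the left that is at least
  \<open>- (total_rate * step U n)\<close>, because \<open>U\<close> is nonnegative; this bound does
  not depend on \<open>T\<close>.\<close>

lemma avg_size_bounded:
  assumes n: "n \<in> states K"
  shows "\<exists>B. \<forall>T>0. avg T (\<lambda>m. real (size_of m)) n \<le> B"
proof (intro exI allI impI)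
  fix T :: nat assume T: "0 < T"
  have nonneg: "0 \<le> (step ^^ t) U n" for t
    using funpow_step_mono[of "\<lambda>_. 0" U n t] U_nonneg n by (simp add: funpow_step_const)
  have "- (total_rate * step U n) \<le> total_rate * ((step ^^ Suc T) U n - step U n) / real T"
  proof -
    have "- (total_rate * step U n) \<le> - (total_rate * step U n) / real T"
    proof -
      have "total_rate * step U n / real T \<le> total_rate * step U n / 1"
        using T nonneg[of 1] total_rate_pos by (intro divide_left_mono) auto
      then show ?thesis by simp
    qed
    also have "\<dots> \<le> total_rate * ((step ^^ Suc T) U n - step U n) / real T"
      using nonneg[of "Suc T"] total_rate_pos by (intro divide_right_mono) (auto simp: algebra_simps)
    finally show ?thesis .
  qed
  also have "\<dots> = avg T (gen U) n" by (simp add: avg_gen)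
  also have "\<dots> \<le> avg T (\<lambda>m. C * 1 + (- \<delta>) * real (size_of m)) n"
    using n U_drift by (intro avg_mono) auto
  also have "\<dots> = C - \<delta> * avg T (\<lambda>m. real (size_of m)) n"
    unfolding avg_linear using T by (simp add: avg_const)
  finally show "avg T (\<lambda>m. real (size_of m)) n \<le> (C + total_rate * step U n) / \<delta>"
    using \<delta>_pos by (simp add: field_simps)
qed

text \<open>Balance survives the limit because it involves finitely many states at a time; tightness
  prevents loss of mass. The filter \<open>F\<close> is arbitrary so that the lemma also applies
  along the horizons at which some bound fails.\<close>

lemma Cesaro_cluster_stationary:
  assumes n: "n \<in> states K" and F: "F \<noteq> bot" "F \<le> sequentially"
  shows "\<exists>\<pi> G. stationary_distribution (states K) q \<pi> \<and> G \<noteq> bot \<and> G \<le> F \<and>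
    (\<forall>j\<in>states K. ((\<lambda>T. avg T (\<lambda>m. of_bool (m = j)) n) \<longlongrightarrow> pmf \<pi> j) G)"
proof -
  let ?S = "states K"
  define occ where "occ T j = avg T (\<lambda>m. of_bool (m = j)) n" for T j
  have occ: "0 \<le> occ T j" "occ T j \<le> 1" for T j
    using avg_bounds[of "\<lambda>m. of_bool (m = j)" n T] n by (auto simp: occ_def)
  obtain p G where G: "G \<noteq> bot" "G \<le> F" and p: "\<And>j. ((\<lambda>T. occ T j) \<longlongrightarrow> p j) G"
    using function_cluster_point[OF F(1), of occ] occ by auto
  have Gseq: "G \<le> sequentially" using G(2) F(2) by (rule order_trans)
  have ev_pos: "eventually (\<lambda>T. 0 < T) G"
    using Gseq eventually_gt_at_top[of 0] by (rule filter_leD)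
  have p_nonneg: "0 \<le> p j" for j
    using p occ by (intro tendsto_lowerbound[OF p _ G(1)]) (auto intro: always_eventually)
  have sum_occ: "(\<Sum>j\<in>A. occ T j) = avg T (\<lambda>m. \<Sum>j\<in>A. of_bool (m = j)) n" if "finite A" for A T
    using avg_sum[OF that, of T "\<lambda>_. 1" "\<lambda>j m. of_bool (m = j)" n] by (simp add: occ_def)
  have sum_ind: "(\<Sum>j\<in>A. of_bool (m = j) :: real) = of_bool (m \<in> A)" if "finite A" for A and m :: "nat \<Rightarrow> nat"
    using that by (simp add: of_bool_def)
  have p_le: "(\<Sum>j\<in>A. p j) \<le> 1" if A: "finite A" for A
  proof (rule tendsto_upperbound[OF _ _ G(1)])
    show "((\<lambda>T. \<Sum>j\<in>A. occ T j) \<longlongrightarrow> (\<Sum>j\<in>A. p j)) G"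
      using p by (intro tendsto_sum)
    show "\<forall>\<^sub>F T in G. (\<Sum>j\<in>A. occ T j) \<le> 1"
      using n unfolding sum_occ[OF A] sum_ind[OF A] by (intro always_eventually allI avg_bounds) auto
  qed
  obtain B where B: "\<And>T. 0 < T \<Longrightarrow> avg T (\<lambda>m. real (size_of m)) n \<le> B"
    using avg_size_bounded[OF n] by blast
  \<comment> \<open>Markov's inequality, in the form that \<open>1 - size_of m / (y + 1)\<close> is
    at most the indicator of \<open>size_of m \<le> y\<close>.\<close>
  have p_ge: "1 - B / (real y + 1) \<le> (\<Sum>j\<in>{n \<in> ?S. size_of n \<le> y}. p j)" (is "_ \<le> (\<Sum>j\<in>?A. p j)") for y
  proof (rule tendsto_lowerbound[OF _ _ G(1)])
    show "((\<lambda>T. \<Sum>j\<in>?A. occ T j) \<longlongrightarrow> (\<Sum>j\<in>?A. p j)) G"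
      using p by (intro tendsto_sum)
    show "\<forall>\<^sub>F T in G. 1 - B / (real y + 1) \<le> (\<Sum>j\<in>?A. occ T j)"
      using ev_pos
    proof eventually_elim
      case (elim T)
      have "1 - B / (real y + 1) \<le> 1 + (- 1 / (real y + 1)) * avg T (\<lambda>m. real (size_of m)) n"
        using B[OF elim] by (simp add: divide_right_mono)
      also have "\<dots> = avg T (\<lambda>m. 1 * 1 + (- 1 / (real y + 1)) * real (size_of m)) n"
        unfolding avg_linear using elim by (simp add: avg_const)
      also have "\<dots> \<le> avg T (\<lambda>m. of_bool (m \<in> ?A)) n"
      proof (intro avg_mono n)
        fix m assume m: "m \<in> ?S"
        show "1 * 1 + (- 1 / (real y + 1)) * real (size_of m) \<le> of_bool (m \<in> ?A)"
        proof (cases "size_of m \<le> y")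
          case False
          then have "real y + 1 \<le> real (size_of m)" by linarith
          then show ?thesis using False by (simp add: field_simps)
        qed (use m in \<open>auto intro!: divide_nonneg_nonneg sum_nonneg\<close>)
      qed
      also have "\<dots> = (\<Sum>j\<in>?A. occ T j)"
        unfolding sum_occ[OF finite_states_le] sum_ind[OF finite_states_le] ..
      finally show ?case .
    qed
  qed
  have summ: "p summable_on ?S"
    using p_nonneg p_le by (intro nonneg_bdd_above_summable_on) (auto intro!: bdd_aboveI2[of _ _ 1])
  have p_sum: "infsum p ?S = 1"
  proof (rule antisym)
    show "infsum p ?S \<le> 1" using summ p_le by (rule infsum_le_finite_sums)
    have "1 - B / (real y + 1) \<le> infsum p ?S" for y
      using p_ge[of y] finite_sum_le_infsum[OF summ finite_states_le[of y]] p_nonneg by force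
    moreover have "(\<lambda>y. 1 - B / (real y + 1)) \<longlonglongrightarrow> 1 - 0"
      using LIMSEQ_Suc[OF lim_const_over_n[of B]] by (intro tendsto_diff) (auto simp: add.commute)
    ultimately show "1 \<le> infsum p ?S"
      by (intro LIMSEQ_le_const2[of "\<lambda>y. 1 - B / (real y + 1)"]) auto
  qed
  have bal: "inflow p j = p j * rate j" for j
  proof -
    have 1: "((\<lambda>T. inflow (occ T) j - rate j * occ T j) \<longlongrightarrow> inflow p j - rate j * p j) G"
      unfolding inflow_def
    proof (intro tendsto_diff tendsto_sum tendsto_add)
      fix k
      show "((\<lambda>T. if 0 < j k then occ T (dec j k) * lam k else 0) \<longlongrightarrow> (if 0 < j k then p (dec j k) * lam k else 0)) G"
        by (cases "0 < j k") (simp_all only: if_True if_False simp_thms, intro tendsto_mult_right p, rule tendsto_const)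
      show "((\<lambda>T. occ T (inc j k) * (mu k * phi k (inc j k))) \<longlongrightarrow> p (inc j k) * (mu k * phi k (inc j k))) G"
        by (intro tendsto_mult_right p)
    qed (intro tendsto_mult_left p)
    have "((\<lambda>T. total_rate / real T) \<longlongrightarrow> 0) G"
      using lim_const_over_n[of total_rate] Gseq by (rule tendsto_mono[rotated])
    then have "((\<lambda>T. inflow (occ T) j - rate j * occ T j) \<longlongrightarrow> 0) G"
      by (rule Lim_null_comparison[rotated])
        (use avg_indicator_balance[OF n] in \<open>auto simp: occ_def[abs_def] intro!: always_eventually\<close>)
    then show ?thesis
      using tendsto_unique[OF G(1) 1] by (simp add: algebra_simps)
  qed
  define p' where "p' j = (if j \<in> ?S then p j else 0)" for j
  have p'_abs: "Infinite_Set_Sum.abs_summable_on p' UNIV"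
  proof -
    have "p' summable_on UNIV"
      using summ by (subst summable_on_cong_neutral[where S = UNIV and T = "?S" and g = p]) (auto simp: p'_def)
    then have "(\<lambda>j. norm (p' j)) summable_on UNIV"
      using p_nonneg by (simp add: p'_def cong: summable_on_cong if_cong)
    then show ?thesis by (simp add: abs_summable_equivalent[symmetric])
  qed
  have "infsum p' UNIV = 1"
    using p_sum by (subst infsum_cong_neutral[where S = UNIV and T = "?S" and g = p]) (auto simp: p'_def)
  then have "(\<integral>\<^sup>+j. ennreal (p' j) \<partial>count_space UNIV) = 1"
    by (subst nn_integral_conv_infsetsum[OF p'_abs]) (simp_all add: infsetsum_infsum[OF p'_abs], simp add: p'_def p_nonneg)
  then have pmf: "pmf (embed_pmf p') j = p' j" for j
    using p_nonneg by (intro pmf_embed_pmf) (auto simp: p'_def)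
  have "stationary_distribution ?S q (embed_pmf p')"
    unfolding stationary_distribution_iff
  proof (intro conjI ballI)
    show "set_pmf (embed_pmf p') \<subseteq> ?S"
      by (auto simp: set_pmf_eq pmf p'_def split: if_splits)
    fix j assume j: "j \<in> ?S"
    have "inflow (pmf (embed_pmf p')) j = inflow p j"
      unfolding inflow_def using j by (intro sum.cong) (auto simp: pmf p'_def upd_in_states)
    then show "inflow (pmf (embed_pmf p')) j = pmf (embed_pmf p') j * rate j"
      using j by (simp add: bal pmf p'_def)
  qed
  then show ?thesis
    using G p by (intro exI[of _ "embed_pmf p'"] exI[of _ G]) (auto simp: pmf p'_def occ_def)
qed

lemma stationary: "stationary_distribution (states K) q stationary"
proof -
  obtain \<pi> where \<pi>: "stationary_distribution (states K) q \<pi>"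
    using Cesaro_cluster_stationary[of "\<lambda>_. 0" sequentially] by (auto simp: states_def)
  show ?thesis
    by (rule theI'[OF ex1I[where P = "stationary_distribution (states K) q", OF \<pi>]])
      (rule stationary_distribution_unique[OF _ \<pi>])
qed

text \<open>If the bound failed for arbitrarily large \<open>T\<close>, a cluster point along those
  \<open>T\<close> would be stationary, hence the stationary law. A Fatou argument over finite sets
  then contradicts the value of its mean.\<close>

lemma eventually_avg_ge:
  assumes n: "n \<in> states K" and f: "\<And>m. m \<in> states K \<Longrightarrow> 0 \<le> f m \<and> f m \<le> 1" and e: "0 < e"
  shows "\<forall>\<^sub>F T in sequentially. (\<Sum>\<^sub>\<infinity>m\<in>states K. pmf stationary m * f m) - e \<le> avg T f n"
proof (rule ccontr)
  let ?m = "\<Sum>\<^sub>\<infinity>m\<in>states K. pmf stationary m * f m"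
  define F where "F = inf sequentially (principal {T. avg T f n < ?m - e})"
  assume "\<not> ?thesis"
  then have "F \<noteq> bot"
    by (simp add: F_def trivial_limit_def eventually_inf_principal not_less)
  then obtain \<pi> G where \<pi>: "stationary_distribution (states K) q \<pi>" and G: "G \<noteq> bot" "G \<le> F"
    and lim: "\<And>j. j \<in> states K \<Longrightarrow> ((\<lambda>T. avg T (\<lambda>m. of_bool (m = j)) n) \<longlongrightarrow> pmf \<pi> j) G"
    using Cesaro_cluster_stationary[OF n, of F] by (auto simp: F_def)
  have "\<pi> = stationary"
    using \<pi> stationary by (rule stationary_distribution_unique)
  have fin: "(\<Sum>j\<in>A. pmf \<pi> j * f j) \<le> ?m - e" if A: "finite A" "A \<subseteq> states K" for A
  proof (rule tendsto_upperbound[OF _ _ G(1)])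
    show "((\<lambda>T. \<Sum>j\<in>A. f j * avg T (\<lambda>m. of_bool (m = j)) n) \<longlongrightarrow> (\<Sum>j\<in>A. pmf \<pi> j * f j)) G"
      using A lim by (subst mult.commute) (intro tendsto_intros, auto)
    have "\<forall>\<^sub>F T in F. avg T f n < ?m - e"
      by (simp add: F_def eventually_inf_principal)
    then have "\<forall>\<^sub>F T in G. avg T f n < ?m - e"
      using G(2) by (rule filter_leD[rotated])
    then show "\<forall>\<^sub>F T in G. (\<Sum>j\<in>A. f j * avg T (\<lambda>m. of_bool (m = j)) n) \<le> ?m - e"
    proof eventually_elim
      case (elim T)
      have "(\<Sum>j\<in>A. f j * avg T (\<lambda>m. of_bool (m = j)) n) = avg T (\<lambda>m. \<Sum>j\<in>A. f j * of_bool (m = j)) n"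
        using avg_sum[OF A(1), of T f "\<lambda>j m. of_bool (m = j)" n] by (rule sym)
      also have "\<dots> \<le> avg T f n"
      proof (intro avg_mono n)
        fix m assume m: "m \<in> states K"
        have "(\<Sum>j\<in>A. f j * of_bool (m = j)) = (if m \<in> A then f m else 0)"
          using A by (simp add: of_bool_def if_distrib cong: if_cong)
        then show "(\<Sum>j\<in>A. f j * of_bool (m = j)) \<le> f m"
          using f[OF m] by simp
      qed
      finally show ?case using elim by simp
    qed
  qed
  have "(\<lambda>j. pmf \<pi> j * f j) summable_on states K"
    using fin f by (intro nonneg_bdd_above_summable_on) (auto intro!: bdd_aboveI2)
  then have "?m \<le> ?m - e"
    using fin unfolding \<open>\<pi> = stationary\<close> by (rule infsum_le_finite_sums)
  then show False using e by simp
qed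

end

end

section \<open>The quasi-stationary processes\<close>

text \<open>Closed form of the minima in the model: a vanishing denominator cannot occur, and the
  Lipschitz bounds follow from those of the maximum.\<close>

definition share :: "real \<Rightarrow> real \<Rightarrow> real" where
  "share x y = x / max 1 (x + y)"

lemma min_eq_share:
  assumes "0 \<le> x" "0 \<le> y"
  shows "min x (x / (x + y)) = share x y" "min x (x / (y + x)) = share x y"
proof -
  show "min x (x / (x + y)) = share x y"
  proof (cases "x + y \<le> 1")
    case True
    show ?thesis
    proof (cases "x = 0")
      case False
      then have "0 < x + y" using assms by auto
      then have "x \<le> x / (x + y)"
        using True assms by (simp add: le_divide_eq mult_left_le)
      then show ?thesis using True by (simp add: share_def)
    qed (simp add: share_def)
  next
    case False
    then have "x / (x + y) \<le> x"
      using assms by (simp add: divide_le_eq mult_le_cancel_left1)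
    then show ?thesis using False by (simp add: share_def)
  qed
  then show "min x (x / (y + x)) = share x y" by (simp add: add.commute)
qed

lemma share_bounds:
  assumes "0 \<le> x" "0 \<le> y"
  shows "0 \<le> share x y" "share x y \<le> x" "share x y \<le> 1"
proof -
  have "1 \<le> max 1 (x + y)" "x \<le> max 1 (x + y)" using assms by auto
  then show "0 \<le> share x y" "share x y \<le> x" "share x y \<le> 1"
    using assms by (auto simp: share_def divide_le_eq mult_le_cancel_left1)
qed

lemma share_pos: "0 < x \<Longrightarrow> 0 < share x y"
  by (simp add: share_def less_max_iff_disj)

lemma share_lipschitz_left_aux:
  assumes "0 \<le> x" "x \<le> x'" "0 \<le> y"
  shows "\<bar>share x' y - share x y\<bar> \<le> x' - x"
proof -
  define s t where "s = max 1 (x + y)" and "t = max 1 (x' + y)"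
  have st: "1 \<le> s" "1 \<le> t" "s \<le> t" "t - s \<le> x' - x" "x \<le> s"
    using assms by (auto simp: s_def t_def)
  have eq: "share x' y - share x y = ((x' - x) * s - x * (t - s)) / (s * t)"
    using st by (simp add: share_def s_def[symmetric] t_def[symmetric] field_simps)
  have "0 \<le> (x' - x) * (s - x)" using assms st by (intro mult_nonneg_nonneg) auto
  also have "\<dots> \<le> (x' - x) * s - x * (t - s)"
    using mult_left_mono[OF st(4) assms(1)] by (simp add: algebra_simps)
  finally have "0 \<le> share x' y - share x y"
    using st by (simp add: eq)
  moreover have "share x' y - share x y \<le> x' - x"
  proof -
    have "(x' - x) * s - x * (t - s) \<le> (x' - x) * s * 1"
      using assms st by simp
    also have "\<dots> \<le> (x' - x) * s * t"
      using assms st by (intro mult_left_mono) auto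
    finally show ?thesis
      using st by (simp add: eq divide_le_eq mult.assoc)
  qed
  ultimately show ?thesis by simp
qed

lemma share_lipschitz_left:
  assumes "0 \<le> x" "0 \<le> x'" "0 \<le> y"
  shows "\<bar>share x y - share x' y\<bar> \<le> \<bar>x - x'\<bar>"
  using share_lipschitz_left_aux[of x x' y] share_lipschitz_left_aux[of x' x y] assms
  by (cases "x \<le> x'") (auto simp: abs_minus_commute)

lemma share_lipschitz_right_aux:
  assumes "0 \<le> x" "0 \<le> y" "y \<le> y'"
  shows "\<bar>share x y' - share x y\<bar> \<le> y' - y"
proof -
  define s t where "s = max 1 (x + y)" and "t = max 1 (x + y')"
  have st: "1 \<le> s" "1 \<le> t" "s \<le> t" "t - s \<le> y' - y" "x \<le> s"
    using assms by (auto simp: s_def t_def)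
  have eq: "share x y - share x y' = x * (t - s) / (s * t)"
    using st by (simp add: share_def s_def[symmetric] t_def[symmetric] field_simps)
  have "x * (t - s) \<le> s * (y' - y)"
    using st assms by (intro mult_mono) auto
  also have "\<dots> = s * (y' - y) * 1" by simp
  also have "\<dots> \<le> s * (y' - y) * t"
    using st assms by (intro mult_left_mono mult_nonneg_nonneg) auto
  finally have "share x y - share x y' \<le> y' - y"
    using st unfolding eq by (subst pos_divide_le_eq) (simp_all add: mult_ac)
  moreover have "0 \<le> share x y - share x y'"
    using st assms by (simp add: eq)
  ultimately show ?thesis by simp
qed

lemma share_lipschitz_right:
  assumes "0 \<le> x" "0 \<le> y" "0 \<le> y'"
  shows "\<bar>share x y - share x y'\<bar> \<le> \<bar>y - y'\<bar>"
  using share_lipschitz_right_aux[of x y y'] share_lipschitz_right_aux[of x y' y] assms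
  by (cases "y \<le> y'") (auto simp: abs_minus_commute)

section \<open>The bandwidth recursion as a function of \<alpha>\<close>

lemma qs_theta0_nonneg:
  assumes "0 \<le> \<alpha>" "\<And>j. j \<le> k \<Longrightarrow> 0 \<le> x j"
  shows "0 \<le> qs_theta0 \<alpha> x k"
  using assms by (induction \<alpha> x k rule: qs_theta0.induct) auto

lemma qs_theta0_Suc:
  assumes "0 \<le> \<alpha>" "\<And>j. j \<le> Suc (Suc k) \<Longrightarrow> 0 \<le> x j"
  shows "qs_theta0 \<alpha> x (Suc (Suc k)) = share (qs_theta0 \<alpha> x (Suc k)) (x (Suc (Suc k)))"
  using assms by (simp add: min_eq_share qs_theta0_nonneg)

lemma qs_theta0_le: "qs_theta0 \<alpha> x k \<le> \<alpha>"
  by (induction \<alpha> x k rule: qs_theta0.induct) (auto intro: min.coboundedI1)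

lemma qs_theta0_pos:
  assumes "0 < \<alpha>" "\<And>j. j \<le> k \<Longrightarrow> 0 \<le> x j"
  shows "0 < qs_theta0 \<alpha> x k"
  using assms
  by (induction \<alpha> x k rule: qs_theta0.induct) (auto intro!: divide_pos_pos add_pos_nonneg)

text \<open>Each link applies a 1-Lipschitz map to the incoming rate, so the constant 1 persists
  along the route whatever the populations are.\<close>

lemma qs_theta0_lipschitz:
  assumes "0 \<le> \<alpha>" "0 \<le> \<beta>" "\<And>j. j \<le> k \<Longrightarrow> 0 \<le> x j"
  shows "\<bar>qs_theta0 \<alpha> x k - qs_theta0 \<beta> x k\<bar> \<le> \<bar>\<alpha> - \<beta>\<bar>"
  using assms
proof (induction \<alpha> x k rule: qs_theta0.induct)
  case (3 \<alpha> x k)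
  have "\<bar>qs_theta0 \<alpha> x (Suc (Suc k)) - qs_theta0 \<beta> x (Suc (Suc k))\<bar>
      \<le> \<bar>qs_theta0 \<alpha> x (Suc k) - qs_theta0 \<beta> x (Suc k)\<bar>"
    using 3 by (simp only: qs_theta0_Suc) (intro share_lipschitz_left qs_theta0_nonneg; simp)
  then show ?case using 3 by force
qed auto

lemma qs_theta0_cong:
  assumes "\<And>j. 2 \<le> j \<Longrightarrow> j \<le> k \<Longrightarrow> x j = y j"
  shows "qs_theta0 \<alpha> x k = qs_theta0 \<alpha> y k"
  using assms by (induction \<alpha> x k rule: qs_theta0.induct) auto

lemma theta0_eq_qs: "1 \<le> k \<Longrightarrow> theta0 x k = qs_theta0 (theta0 x 1) x k"
proof (induction k)
  case (Suc k)
  then show ?case by (cases k) auto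
qed simp

lemma psi_eq_qs: "1 \<le> L \<Longrightarrow> k = 0 \<or> 2 \<le> k \<Longrightarrow> psi L k x = qs_psi L (theta0 x 1) k x"
  using theta0_eq_qs[of L x] theta0_eq_qs[of "k - 1" x] by (auto simp: psi_def qs_psi_def)

section \<open>The network and its quasi-stationary processes as flow systems\<close>

locale linear_network =
  fixes L :: nat and lam mu a :: "nat \<Rightarrow> real"
  assumes L_ge_2: "2 \<le> L"
    and lam_pos: "\<And>k. k \<le> L \<Longrightarrow> 0 < lam k"
    and mu_pos: "\<And>k. k \<le> L \<Longrightarrow> 0 < mu k"
    and a_pos: "\<And>k. k \<le> L \<Longrightarrow> 0 < a k"
    and stable: "\<And>k. 2 \<le> k \<Longrightarrow> k \<le> L \<Longrightarrow> lam k < mu k"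
begin

lemma access_nonneg: "j \<le> L \<Longrightarrow> 0 \<le> a j * real (n j)"
  using a_pos[of j] by simp

lemma qs_phi_eq_share:
  assumes "0 \<le> \<alpha>" "k \<in> {2..L}"
  shows "qs_phi L a \<alpha> k n = share (a k * real (n k)) (qs_theta0 \<alpha> (\<lambda>j. a j * real (n j)) (k - 1))"
  using assms by (auto simp: qs_phi_def qs_psi_def min_eq_share access_nonneg qs_theta0_nonneg)

lemma qs_phi_0: "qs_phi L a \<alpha> 0 n = qs_theta0 \<alpha> (\<lambda>j. a j * real (n j)) L"
  by (simp add: qs_phi_def qs_psi_def)

lemma qs_phi_0_bounds:
  assumes "\<alpha> \<in> {0..1}"
  shows "0 \<le> qs_phi L a \<alpha> 0 n" "qs_phi L a \<alpha> 0 n \<le> 1"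
  using assms qs_theta0_le[of \<alpha> "\<lambda>j. a j * real (n j)" L]
  by (auto simp: qs_phi_0 intro!: qs_theta0_nonneg access_nonneg)

lemma qs_phi_lipschitz:
  assumes "0 \<le> \<alpha>" "0 \<le> \<beta>" "k = 0 \<or> k \<in> {2..L}"
  shows "\<bar>qs_phi L a \<alpha> k n - qs_phi L a \<beta> k n\<bar> \<le> \<bar>\<alpha> - \<beta>\<bar>"
proof (cases "k = 0")
  case True
  then show ?thesis
    using assms by (simp add: qs_phi_0 qs_theta0_lipschitz access_nonneg)
next
  case False
  then have k: "k \<in> {2..L}" using assms by simp
  let ?\<theta> = "\<lambda>\<alpha>. qs_theta0 \<alpha> (\<lambda>j. a j * real (n j)) (k - 1)"
  have "\<bar>qs_phi L a \<alpha> k n - qs_phi L a \<beta> k n\<bar> \<le> \<bar>?\<theta> \<alpha> - ?\<theta> \<beta>\<bar>"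
  proof -
    have "0 \<le> ?\<theta> \<alpha>" "0 \<le> ?\<theta> \<beta>" "0 \<le> a k * real (n k)"
      using assms k by (auto intro!: qs_theta0_nonneg access_nonneg)
    then show ?thesis
      unfolding qs_phi_eq_share[OF assms(1) k] qs_phi_eq_share[OF assms(2) k] by (intro share_lipschitz_right)
  qed
  also have "\<dots> \<le> \<bar>\<alpha> - \<beta>\<bar>"
    using assms k by (intro qs_theta0_lipschitz access_nonneg) auto
  finally show ?thesis .
qed

text \<open>The competing rate of class 0 is at most \<alpha>, hence at most 1. The lower bound is
  free of \<alpha>, and so are the drift constants derived from it.\<close>

lemma qs_phi_ge:
  assumes "\<alpha> \<in> {0..1}" "k \<in> {2..L}"
  shows "a k * real (n k) / (1 + a k * real (n k)) \<le> qs_phi L a \<alpha> k n"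
proof -
  let ?\<theta> = "qs_theta0 \<alpha> (\<lambda>j. a j * real (n j)) (k - 1)"
  have "?\<theta> \<le> 1" using qs_theta0_le[of \<alpha> "\<lambda>j. a j * real (n j)" "k - 1"] assms by simp
  moreover have "0 \<le> ?\<theta>" using assms by (intro qs_theta0_nonneg access_nonneg) auto
  moreover have "0 \<le> a k * real (n k)" using assms by (intro access_nonneg) auto
  ultimately show ?thesis
    using assms by (auto simp: qs_phi_eq_share share_def intro!: divide_left_mono mult_pos_pos)
qed

lemma qs_flow_system:
  assumes "\<alpha> \<in> {0..1}"
  shows "flow_system {2..L} lam mu (qs_phi L a \<alpha>)"
proof
  fix k n assume k: "k \<in> {2..L}"
  have *: "0 \<le> qs_theta0 \<alpha> (\<lambda>j. a j * real (n j)) (k - 1)"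
    using assms k by (intro qs_theta0_nonneg access_nonneg) auto
  show "qs_phi L a \<alpha> k n \<le> 1"
    using assms k * by (simp add: qs_phi_eq_share share_bounds access_nonneg)
  show "0 < qs_phi L a \<alpha> k n" if "0 < n k"
    using assms k * that a_pos[of k] by (simp add: qs_phi_eq_share share_pos)
  show "qs_phi L a \<alpha> k n = 0" if "n k = 0"
    using assms k * that by (simp add: qs_phi_eq_share share_def)
qed (use L_ge_2 lam_pos mu_pos in auto)

definition ratio :: "(nat \<Rightarrow> nat) \<Rightarrow> real" where
  "ratio n = share (a 0 * real (n 0)) (a 1 * real (n 1))"

lemma ratio_bounds: "ratio n \<in> {0..1}"
  using L_ge_2 by (auto simp: ratio_def intro!: share_bounds access_nonneg)

lemma phi_eq_qs_phi: "k = 0 \<or> 2 \<le> k \<Longrightarrow> phi L a k n = qs_phi L a (ratio n) k n"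
  using L_ge_2 unfolding phi_def qs_phi_def ratio_def
  by (subst psi_eq_qs) (auto simp: min_eq_share access_nonneg)

lemma phi_1: "phi L a 1 n = share (a 1 * real (n 1)) (a 0 * real (n 0))"
  using L_ge_2 by (simp add: phi_def psi_def min_eq_share access_nonneg)

lemma network_flow_system: "flow_system {0..L} lam mu (phi L a)"
proof
  fix k n assume k: "k \<in> {0..L}"
  consider "k = 0" | "k = 1" | "k \<in> {2..L}" using k by force
  then have "phi L a k n \<le> 1 \<and> (0 < n k \<longrightarrow> 0 < phi L a k n) \<and> (n k = 0 \<longrightarrow> phi L a k n = 0)"
  proof cases
    case 1
    have "0 < phi L a 0 n" if "0 < n 0"
    proof -
      have "0 < ratio n" using that a_pos[of 0] by (simp add: ratio_def share_pos)
      then show ?thesis by (simp add: phi_eq_qs_phi qs_phi_0 qs_theta0_pos access_nonneg)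
    qed
    moreover have "phi L a 0 n = 0" if "n 0 = 0"
    proof -
      have "ratio n = 0" using that by (simp add: ratio_def share_def)
      then show ?thesis
        using qs_theta0_le[of 0 "\<lambda>j. a j * real (n j)" L] qs_theta0_nonneg[of 0 L "\<lambda>j. a j * real (n j)"]
        by (simp add: phi_eq_qs_phi qs_phi_0 access_nonneg)
    qed
    ultimately show ?thesis
      using 1 qs_phi_0_bounds[OF ratio_bounds, of n n] by (auto simp: phi_eq_qs_phi)
  next
    case 2
    then show ?thesis
      using L_ge_2 a_pos[of 1] share_bounds(3)[of "a 1 * real (n 1)" "a 0 * real (n 0)"]
      unfolding 2 phi_1 by (auto simp: share_pos access_nonneg share_def[of 0])
  next
    case 3
    interpret flow_system "{2..L}" lam mu "qs_phi L a (ratio n)"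
      by (rule qs_flow_system[OF ratio_bounds])
    show ?thesis
      using phi_le_1[OF 3, of n] phi_pos[OF 3, of n] phi_zero[OF 3, of n] 3 by (simp add: phi_eq_qs_phi)
  qed
  then show "phi L a k n \<le> 1" "0 < n k \<Longrightarrow> 0 < phi L a k n" "n k = 0 \<Longrightarrow> phi L a k n = 0" by auto
qed (use lam_pos mu_pos in auto)

abbreviation qs_gen :: "real \<Rightarrow> ((nat \<Rightarrow> nat) \<Rightarrow> real) \<Rightarrow> (nat \<Rightarrow> nat) \<Rightarrow> real" where
  "qs_gen \<alpha> \<equiv> flow_system.gen {2..L} lam mu (qs_phi L a \<alpha>)"

abbreviation qs_step :: "real \<Rightarrow> ((nat \<Rightarrow> nat) \<Rightarrow> real) \<Rightarrow> (nat \<Rightarrow> nat) \<Rightarrow> real" where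
  "qs_step \<alpha> \<equiv> flow_system.step {2..L} lam mu (qs_phi L a \<alpha>)"

definition qs_avg :: "nat \<Rightarrow> real \<Rightarrow> (nat \<Rightarrow> nat) \<Rightarrow> real" where
  "qs_avg T \<alpha> = flow_system.avg {2..L} lam mu (qs_phi L a \<alpha>) T (qs_phi L a \<alpha> 0)"

definition qs_corr :: "nat \<Rightarrow> real \<Rightarrow> (nat \<Rightarrow> nat) \<Rightarrow> real" where
  "qs_corr T \<alpha> = flow_system.corrector {2..L} lam mu (qs_phi L a \<alpha>) T (qs_phi L a \<alpha> 0)"

text \<open>The uniformisation rate. It is the same for all \<alpha>, so powers of
  \<open>qs_step\<close> at different parameters can be compared.\<close>

definition qs_total :: real where
  "qs_total = (\<Sum>k\<in>{2..L}. lam k + mu k)"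

definition squares :: "(nat \<Rightarrow> nat) \<Rightarrow> real" where
  "squares n = (\<Sum>k\<in>{2..L}. (real (n k))\<^sup>2)"

text \<open>The terms \<open>lam k + mu k\<close> come from the 1 in the increments
  \<open>2 * n + 1\<close> and \<open>1 - 2 * n\<close> of a square, the last term from the deficit
  \<open>1 / a k\<close> in \<open>qs_gen_squares_le\<close>.\<close>

definition drift_const :: real where
  "drift_const = (\<Sum>k\<in>{2..L}. lam k + mu k + 2 * mu k / a k)"

definition margin :: real where
  "margin = Min ((\<lambda>k. 2 * (mu k - lam k)) ` {2..L})"

lemma qs_total_pos: "0 < qs_total"
  unfolding qs_total_def using L_ge_2 lam_pos mu_pos by (intro sum_pos) (auto intro: add_pos_pos)

lemma margin_pos: "0 < margin"
  unfolding margin_def using L_ge_2 stable by (subst Min_gr_iff) auto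

lemma margin_le: "k \<in> {2..L} \<Longrightarrow> margin \<le> 2 * (mu k - lam k)"
  unfolding margin_def by (intro Min_le) auto

lemma drift_const_nonneg: "0 \<le> drift_const"
  unfolding drift_const_def using lam_pos mu_pos a_pos
  by (intro sum_nonneg add_nonneg_nonneg divide_nonneg_nonneg) (auto intro: less_imp_le)

lemma squares_nonneg: "0 \<le> squares n"
  by (simp add: squares_def sum_nonneg)

lemma squares_le: "squares n \<le> (real (\<Sum>k\<in>{2..L}. n k))\<^sup>2"
proof -
  have "squares n \<le> (\<Sum>k\<in>{2..L}. real (n k) * real (\<Sum>k\<in>{2..L}. n k))"
    unfolding squares_def power2_eq_square
    by (intro sum_mono mult_left_mono) (auto intro!: member_le_sum simp del: of_nat_sum)
  then show ?thesis
    by (simp add: power2_eq_square sum_distrib_right)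
qed

lemma qs_gen_squares_le:
  assumes \<alpha>: "\<alpha> \<in> {0..1}"
  shows "qs_gen \<alpha> squares n \<le> drift_const - margin * real (\<Sum>k\<in>{2..L}. n k)"
proof -
  interpret flow_system "{2..L}" lam mu "qs_phi L a \<alpha>"
    by (rule qs_flow_system[OF \<alpha>])
  have sq: "squares (n(k := x)) - squares n = (real x)\<^sup>2 - (real (n k))\<^sup>2" if "k \<in> {2..L}" for k x
    using that by (simp add: squares_def sum.remove[of "{2..L}" k])
  have "gen squares n \<le> (\<Sum>k\<in>{2..L}. (lam k + mu k + 2 * mu k / a k) - margin * real (n k))"
    unfolding gen_def
  proof (rule sum_mono)
    fix k assume k: "k \<in> {2..L}"
    let ?n = "real (n k)" and ?\<phi> = "qs_phi L a \<alpha> k n"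
    have pos: "0 < a k" "0 < mu k" "0 < lam k" using k a_pos mu_pos lam_pos by auto
    have \<phi>: "0 \<le> ?\<phi>" "?\<phi> \<le> 1" using k phi_nonneg phi_le_1 by auto
    \<comment> \<open>A class falls short of full service by at most
      \<open>1 / (1 + a k * n)\<close>, and n times this is at most \<open>1 / a k\<close>.\<close>
    have n\<phi>: "?n - 1 / a k \<le> ?n * ?\<phi>"
    proof -
      have "?n - 1 / a k \<le> ?n * (a k * ?n / (1 + a k * ?n))"
        using pos by (simp add: divide_simps add_pos_nonneg) (simp add: algebra_simps add_pos_nonneg)
      also have "\<dots> \<le> ?n * ?\<phi>"
        using qs_phi_ge[OF \<alpha> k] by (intro mult_left_mono) auto
      finally show ?thesis .
    qed
    have up: "squares (inc n k) - squares n = 2 * ?n + 1"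
      by (simp add: sq[OF k] power2_eq_square algebra_simps)
    have down: "mu k * ?\<phi> * (squares (dec n k) - squares n) = mu k * ?\<phi> - 2 * (mu k * (?n * ?\<phi>))"
    proof (cases "n k = 0")
      case True
      then show ?thesis using phi_zero[OF k] by simp
    next
      case False
      then have *: "squares (dec n k) - squares n = 1 - 2 * ?n"
        unfolding sq[OF k] by (simp add: of_nat_diff power2_eq_square algebra_simps)
      show ?thesis unfolding * by (simp add: algebra_simps)
    qed
    have "mu k * ?\<phi> \<le> mu k" using \<phi> pos by (simp add: mult_left_le)
    moreover have "mu k * ?n - mu k / a k \<le> mu k * (?n * ?\<phi>)"
      using mult_left_mono[OF n\<phi>, of "mu k"] pos by (simp add: right_diff_distrib)
    moreover have "margin * ?n \<le> 2 * (mu k * ?n) - 2 * (lam k * ?n)"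
      using mult_right_mono[OF margin_le[OF k], of ?n] by (simp add: algebra_simps)
    moreover have "lam k * (2 * ?n + 1) = 2 * (lam k * ?n) + lam k" "2 * mu k / a k = 2 * (mu k / a k)"
      by (simp_all add: algebra_simps)
    ultimately show "lam k * (squares (inc n k) - squares n) + mu k * ?\<phi> * (squares (dec n k) - squares n)
      \<le> lam k + mu k + 2 * mu k / a k - margin * ?n"
      unfolding up down by linarith
  qed
  then show ?thesis
    by (simp add: drift_const_def sum_subtractf sum_distrib_left)
qed

text \<open>One more step costs one more \<open>\<bar>\<alpha> - \<beta>\<bar>\<close>: the old
  difference is contracted by the operator at \<alpha>, and the two operators applied to the same
  function with values in [0, 1] differ by at most that much.\<close>

lemma qs_step_lipschitz:
  assumes \<alpha>: "\<alpha> \<in> {0..1}" and \<beta>: "\<beta> \<in> {0..1}" and n: "n \<in> states {2..L}"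
  shows "\<bar>(qs_step \<alpha> ^^ t) (qs_phi L a \<alpha> 0) n - (qs_step \<beta> ^^ t) (qs_phi L a \<beta> 0) n\<bar> \<le> real (Suc t) * \<bar>\<alpha> - \<beta>\<bar>"
  using n
proof (induction t arbitrary: n)
  case 0
  then show ?case using \<alpha> \<beta> qs_phi_lipschitz[of \<alpha> \<beta> 0 n] by simp
next
  case (Suc t)
  interpret A: flow_system "{2..L}" lam mu "qs_phi L a \<alpha>" by (rule qs_flow_system[OF \<alpha>])
  interpret B: flow_system "{2..L}" lam mu "qs_phi L a \<beta>" by (rule qs_flow_system[OF \<beta>])
  define f g where "f = (qs_step \<alpha> ^^ t) (qs_phi L a \<alpha> 0)" and "g = (qs_step \<beta> ^^ t) (qs_phi L a \<beta> 0)"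
  have g: "0 \<le> g m" "g m \<le> 1" if "m \<in> states {2..L}" for m
    unfolding g_def using that qs_phi_0_bounds[OF \<beta>] by (auto intro!: B.funpow_step_bounds)
  have fg: "\<bar>f m - g m\<bar> \<le> real (Suc t) * \<bar>\<alpha> - \<beta>\<bar>" if "m \<in> states {2..L}" for m
    unfolding f_def g_def using Suc.IH[OF that] .
  have "qs_step \<alpha> (\<lambda>m. 1 * f m + (-1) * g m) n \<le> qs_step \<alpha> (\<lambda>_. real (Suc t) * \<bar>\<alpha> - \<beta>\<bar>) n"
       "qs_step \<alpha> (\<lambda>_. - (real (Suc t) * \<bar>\<alpha> - \<beta>\<bar>)) n \<le> qs_step \<alpha> (\<lambda>m. 1 * f m + (-1) * g m) n"
    using fg Suc.prems by (auto intro!: A.step_mono simp: abs_le_iff) fastforce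
  then have 1: "\<bar>qs_step \<alpha> f n - qs_step \<alpha> g n\<bar> \<le> real (Suc t) * \<bar>\<alpha> - \<beta>\<bar>"
    unfolding A.step_linear using A.funpow_step_const[of 1] by (simp add: abs_le_iff fun_eq_iff)
  \<comment> \<open>Arrivals do not depend on \<alpha> and cancel; only the departure rates
    differ.\<close>
  have "qs_gen \<alpha> g n - qs_gen \<beta> g n =
      (\<Sum>k\<in>{2..L}. mu k * (qs_phi L a \<alpha> k n - qs_phi L a \<beta> k n) * (g (A.dec n k) - g n))"
    unfolding A.gen_def B.gen_def sum_subtractf[symmetric] by (intro sum.cong) (auto simp: algebra_simps)
  also have "\<bar>\<dots>\<bar> \<le> (\<Sum>k\<in>{2..L}. (lam k + mu k) * \<bar>\<alpha> - \<beta>\<bar>)"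
  proof (rule order_trans[OF sum_abs sum_mono])
    fix k assume k: "k \<in> {2..L}"
    have "\<bar>g (A.dec n k) - g n\<bar> \<le> 1"
      using g[OF Suc.prems] g[OF A.upd_in_states[OF Suc.prems k]] by (simp add: abs_le_iff) (smt (verit))
    then have "\<bar>mu k * (qs_phi L a \<alpha> k n - qs_phi L a \<beta> k n) * (g (A.dec n k) - g n)\<bar> \<le> mu k * \<bar>\<alpha> - \<beta>\<bar> * 1"
      unfolding abs_mult using qs_phi_lipschitz[of \<alpha> \<beta> k n] \<alpha> \<beta> k mu_pos[of k]
      by (intro mult_mono) auto
    also have "\<dots> \<le> (lam k + mu k) * \<bar>\<alpha> - \<beta>\<bar>"
      using lam_pos[of k] k by (simp add: mult_right_mono)
    finally show "\<bar>mu k * (qs_phi L a \<alpha> k n - qs_phi L a \<beta> k n) * (g (A.dec n k) - g n)\<bar> \<le> (lam k + mu k) * \<bar>\<alpha> - \<beta>\<bar>" .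
  qed
  also have "\<dots> = qs_total * \<bar>\<alpha> - \<beta>\<bar>" by (simp add: qs_total_def sum_distrib_right)
  finally have "\<bar>qs_gen \<alpha> g n - qs_gen \<beta> g n\<bar> / qs_total \<le> \<bar>\<alpha> - \<beta>\<bar>"
    using qs_total_pos by (simp add: divide_le_eq mult.commute)
  moreover have "qs_step \<alpha> g n - qs_step \<beta> g n = (qs_gen \<alpha> g n - qs_gen \<beta> g n) / qs_total"
    by (simp add: A.step_def B.step_def A.total_rate_def B.total_rate_def qs_total_def diff_divide_distrib)
  ultimately have 2: "\<bar>qs_step \<alpha> g n - qs_step \<beta> g n\<bar> \<le> \<bar>\<alpha> - \<beta>\<bar>"
    using qs_total_pos by simp
  have "\<bar>qs_step \<alpha> f n - qs_step \<beta> g n\<bar> \<le> real (Suc t) * \<bar>\<alpha> - \<beta>\<bar> + \<bar>\<alpha> - \<beta>\<bar>"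
    using 1 2 by linarith
  then show ?case by (simp add: f_def g_def algebra_simps)
qed

lemma qs_avg_lipschitz:
  assumes \<alpha>: "\<alpha> \<in> {0..1}" and \<beta>: "\<beta> \<in> {0..1}" and n: "n \<in> states {2..L}"
  shows "\<bar>qs_avg T \<alpha> n - qs_avg T \<beta> n\<bar> \<le> real (Suc T) * \<bar>\<alpha> - \<beta>\<bar>"
proof (cases "T = 0")
  case False
  interpret A: flow_system "{2..L}" lam mu "qs_phi L a \<alpha>" by (rule qs_flow_system[OF \<alpha>])
  interpret B: flow_system "{2..L}" lam mu "qs_phi L a \<beta>" by (rule qs_flow_system[OF \<beta>])
  have "\<bar>(\<Sum>t<T. (qs_step \<alpha> ^^ Suc t) (qs_phi L a \<alpha> 0) n) - (\<Sum>t<T. (qs_step \<beta> ^^ Suc t) (qs_phi L a \<beta> 0) n)\<bar>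
      \<le> (\<Sum>t<T. real (Suc T) * \<bar>\<alpha> - \<beta>\<bar>)"
    unfolding sum_subtractf[symmetric]
  proof (rule order_trans[OF sum_abs sum_mono])
    fix t assume "t \<in> {..<T}"
    then show "\<bar>(qs_step \<alpha> ^^ Suc t) (qs_phi L a \<alpha> 0) n - (qs_step \<beta> ^^ Suc t) (qs_phi L a \<beta> 0) n\<bar> \<le> real (Suc T) * \<bar>\<alpha> - \<beta>\<bar>"
      by (intro order_trans[OF qs_step_lipschitz[OF \<alpha> \<beta> n]] mult_right_mono) auto
  qed
  then show ?thesis
    using False unfolding qs_avg_def A.avg_def B.avg_def diff_divide_distrib[symmetric]
    by (simp add: divide_le_eq mult_ac del: funpow.simps)
qed (simp add: qs_avg_def flow_system.avg_def[OF qs_flow_system[OF \<alpha>]] flow_system.avg_def[OF qs_flow_system[OF \<beta>]])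

lemma qs_corr_lipschitz:
  assumes \<alpha>: "\<alpha> \<in> {0..1}" and \<beta>: "\<beta> \<in> {0..1}" and n: "n \<in> states {2..L}"
  shows "\<bar>qs_corr T \<alpha> n - qs_corr T \<beta> n\<bar> \<le> (real T)\<^sup>2 / qs_total * \<bar>\<alpha> - \<beta>\<bar>"
proof (cases "T = 0")
  case False
  interpret A: flow_system "{2..L}" lam mu "qs_phi L a \<alpha>" by (rule qs_flow_system[OF \<alpha>])
  interpret B: flow_system "{2..L}" lam mu "qs_phi L a \<beta>" by (rule qs_flow_system[OF \<beta>])
  let ?A = "\<Sum>s<T. \<Sum>t\<le>s. (qs_step \<alpha> ^^ t) (qs_phi L a \<alpha> 0) n"
  let ?B = "\<Sum>s<T. \<Sum>t\<le>s. (qs_step \<beta> ^^ t) (qs_phi L a \<beta> 0) n"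
  have "\<bar>?A - ?B\<bar> \<le> (\<Sum>s<T. \<Sum>t\<le>s. real T * \<bar>\<alpha> - \<beta>\<bar>)"
    unfolding sum_subtractf[symmetric]
  proof (intro order_trans[OF sum_abs sum_mono])
    fix s t assume "s \<in> {..<T}" "t \<in> {..s}"
    then show "\<bar>(qs_step \<alpha> ^^ t) (qs_phi L a \<alpha> 0) n - (qs_step \<beta> ^^ t) (qs_phi L a \<beta> 0) n\<bar> \<le> real T * \<bar>\<alpha> - \<beta>\<bar>"
      by (intro order_trans[OF qs_step_lipschitz[OF \<alpha> \<beta> n]] mult_right_mono) auto
  qed
  also have "\<dots> \<le> (\<Sum>s<T. real T * (real T * \<bar>\<alpha> - \<beta>\<bar>))"
    by (intro sum_mono) (auto intro!: mult_right_mono)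
  finally have le: "\<bar>?A - ?B\<bar> \<le> real T * (real T * (real T * \<bar>\<alpha> - \<beta>\<bar>))" by simp
  have eq: "qs_corr T \<alpha> n - qs_corr T \<beta> n = - (?A - ?B) / (qs_total * real T)"
    by (simp add: qs_corr_def A.corrector_def B.corrector_def A.total_rate_def B.total_rate_def qs_total_def diff_divide_distrib)
  have "\<bar>qs_corr T \<alpha> n - qs_corr T \<beta> n\<bar> = \<bar>?A - ?B\<bar> / (qs_total * real T)"
    unfolding eq using False qs_total_pos by (simp only: abs_divide abs_minus_cancel abs_mult abs_of_pos abs_of_nat)
  also have "\<dots> \<le> real T * (real T * (real T * \<bar>\<alpha> - \<beta>\<bar>)) / (qs_total * real T)"
    using le qs_total_pos by (intro divide_right_mono) auto
  also have "\<dots> = (real T)\<^sup>2 / qs_total * \<bar>\<alpha> - \<beta>\<bar>"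
    using False qs_total_pos by (simp add: power2_eq_square)
  finally show ?thesis .
qed (simp add: qs_corr_def flow_system.corrector_def[OF qs_flow_system[OF \<alpha>]] flow_system.corrector_def[OF qs_flow_system[OF \<beta>]])

lemma qs_avg_nonneg:
  assumes \<alpha>: "\<alpha> \<in> {0..1}" and n: "n \<in> states {2..L}"
  shows "0 \<le> qs_avg T \<alpha> n"
proof -
  interpret flow_system "{2..L}" lam mu "qs_phi L a \<alpha>" by (rule qs_flow_system[OF \<alpha>])
  show ?thesis
    unfolding qs_avg_def using qs_phi_0_bounds[OF \<alpha>] n by (intro avg_bounds) auto
qed

lemma qs_corr_bound:
  assumes \<alpha>: "\<alpha> \<in> {0..1}" and n: "n \<in> states {2..L}"
  shows "\<bar>qs_corr T \<alpha> n\<bar> \<le> real T / qs_total"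
proof -
  interpret flow_system "{2..L}" lam mu "qs_phi L a \<alpha>" by (rule qs_flow_system[OF \<alpha>])
  show ?thesis
    unfolding qs_corr_def qs_total_def total_rate_def[symmetric]
    using qs_phi_0_bounds[OF \<alpha>] n by (intro corrector_bounds) auto
qed

section \<open>Lower bounds for the Cesaro averages, locally and then uniformly in \<alpha>\<close>

lemma eventually_qs_avg_ge:
  assumes \<alpha>: "\<alpha> \<in> {0..1}" and n: "n \<in> states {2..L}" and e: "0 < e"
  shows "\<forall>\<^sub>F T in sequentially. mean_phi0 L lam mu a \<alpha> - e \<le> qs_avg T \<alpha> n"
proof -
  interpret flow_system "{2..L}" lam mu "qs_phi L a \<alpha>" by (rule qs_flow_system[OF \<alpha>])
  show ?thesis
    unfolding mean_phi0_def qs_distribution_def qs_rates_def qs_avg_def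
    using n e qs_gen_squares_le[OF \<alpha>] margin_pos qs_phi_0_bounds[OF \<alpha>] squares_nonneg
    by (intro eventually_avg_ge[of squares drift_const margin]) auto
qed

text \<open>A quantitative lower semicontinuity, with \<open>d\<close> independent of
  \<open>y\<close>. The function \<open>qs_corr T0 \<alpha> + c * squares\<close> satisfies the
  inequality \<open>key\<close> at all states; averaging it over \<open>T\<close> steps replaces
  \<open>qs_phi\<close> by \<open>qs_avg T\<close> up to a boundary term. Four errors of
  \<open>e / 4\<close> arise: from \<open>T0\<close>, from the change of \<alpha>, from
  \<open>c\<close>, and from the boundary.\<close>

lemma qs_avg_locally_ge:
  assumes \<alpha>0: "\<alpha>0 \<in> {0..1}" and e: "0 < e"
  shows "\<exists>d>0. \<forall>y. \<exists>T1. \<forall>T\<ge>T1. \<forall>\<alpha>\<in>{0..1}. \<forall>n\<in>states {2..L}.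
    \<bar>\<alpha> - \<alpha>0\<bar> < d \<longrightarrow> (\<Sum>k\<in>{2..L}. n k) \<le> y \<longrightarrow> mean_phi0 L lam mu a \<alpha>0 - e \<le> qs_avg T \<alpha> n"
proof -
  define m where "m = mean_phi0 L lam mu a \<alpha>0"
  define c where "c = e / (4 * (drift_const + 1))"
  have c: "0 < c" "c * drift_const \<le> e / 4"
    using e drift_const_nonneg by (auto simp: c_def divide_simps add_pos_nonneg mult_left_mono)
  \<comment> \<open>Above \<open>y0\<close> the squares alone contribute at most
    \<open>- \<bar>m\<bar>\<close>, so there the trivial bound
    \<open>0 \<le> qs_avg T0 \<alpha> n\<close> is enough for \<open>key\<close>, and
    \<open>T0\<close> has to serve only finitely many states.\<close>
  obtain y0 :: nat where y0: "(drift_const + \<bar>m\<bar> / c) / margin \<le> real y0"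
    using real_arch_simple by blast
  have y0': "c * (drift_const - margin * real s) \<le> - \<bar>m\<bar>" if "y0 < s" for s
  proof -
    have "(drift_const + \<bar>m\<bar> / c) / margin \<le> real s" using y0 that by linarith
    then have "drift_const + \<bar>m\<bar> / c \<le> margin * real s"
      using margin_pos by (simp add: divide_le_eq mult.commute)
    then have "c * (drift_const + \<bar>m\<bar> / c) \<le> c * (margin * real s)"
      using c by (intro mult_left_mono) auto
    then show ?thesis using c by (simp add: algebra_simps)
  qed
  let ?F = "{n \<in> states {2..L}. (\<Sum>k\<in>{2..L}. n k) \<le> y0}"
  have fin: "finite ?F"
    using flow_system.finite_states_le[OF qs_flow_system[OF \<alpha>0]] .
  have "\<forall>\<^sub>F T in sequentially. \<forall>n\<in>?F. m - e / 4 \<le> qs_avg T \<alpha>0 n"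
    using fin e eventually_qs_avg_ge[OF \<alpha>0, of _ "e / 4"] unfolding m_def
    by (intro eventually_ball_finite) auto
  then obtain T0 where T0: "0 < T0" "\<And>n. n \<in> ?F \<Longrightarrow> m - e / 4 \<le> qs_avg T0 \<alpha>0 n"
    using eventually_gt_at_top[of 0] eventually_happens'[OF sequentially_bot]
    by (metis (mono_tags, lifting) eventually_conj)
  \<comment> \<open>The Lipschitz constant of \<open>qs_avg T0\<close> is \<open>Suc T0\<close>, so
    moving \<alpha> by less than \<open>d\<close> costs at most \<open>e / 4\<close>.\<close>
  define d where "d = e / (4 * real (Suc T0))"
  have d: "0 < d" using e by (simp add: d_def)
  have key: "qs_gen \<alpha> (\<lambda>n. 1 * qs_corr T0 \<alpha> n + c * squares n) n \<le> qs_phi L a \<alpha> 0 n - m + 3 * e / 4"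
    if \<alpha>: "\<alpha> \<in> {0..1}" "\<bar>\<alpha> - \<alpha>0\<bar> < d" and n: "n \<in> states {2..L}" for \<alpha> n
  proof -
    interpret flow_system "{2..L}" lam mu "qs_phi L a \<alpha>" by (rule qs_flow_system[OF \<alpha>(1)])
    have eq: "gen (\<lambda>n. 1 * qs_corr T0 \<alpha> n + c * squares n) n = qs_phi L a \<alpha> 0 n - qs_avg T0 \<alpha> n + c * gen squares n"
      using gen_corrector[OF T0(1), of "qs_phi L a \<alpha> 0" n]
      unfolding gen_linear by (simp add: qs_corr_def qs_avg_def)
    have sq: "c * gen squares n \<le> c * (drift_const - margin * real (size_of n))"
      using c qs_gen_squares_le[OF \<alpha>(1), of n] by (intro mult_left_mono) auto
    show ?thesis
    proof (cases "size_of n \<le> y0")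
      case True
      have "real (Suc T0) * \<bar>\<alpha> - \<alpha>0\<bar> \<le> real (Suc T0) * d"
        using \<alpha> by (intro mult_left_mono) auto
      also have "\<dots> = e / 4" by (simp add: d_def del: of_nat_Suc)
      finally have "m - e / 2 \<le> qs_avg T0 \<alpha> n"
        using qs_avg_lipschitz[OF \<alpha>(1) \<alpha>0 n, of T0] T0(2)[of n] True n by (simp add: abs_le_iff)
      moreover have "c * (drift_const - margin * real (size_of n)) \<le> c * drift_const"
        using c margin_pos by (intro mult_left_mono) (auto intro!: mult_nonneg_nonneg sum_nonneg)
      ultimately show ?thesis using eq sq c(2) by simp
    next
      case False
      then show ?thesis
        using eq sq y0'[of "size_of n"] qs_avg_nonneg[OF \<alpha>(1) n, of T0] e by simp
    qed
  qed
  show ?thesis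
  proof (intro exI[of _ d] conjI d allI)
    fix y :: nat
    \<comment> \<open>\<open>qs_total\<close> times the upper bound for \<open>step g n\<close>
      minus the lower bound for later powers: the boundary term of \<open>avg_gen\<close>. Only here
      does \<open>y\<close> enter, through \<open>squares n\<close>.\<close>
    define b where "b = 2 * real T0 + qs_total * c * (real y)\<^sup>2 + c * drift_const"
    obtain T1 :: nat where T1: "4 * b / e \<le> real T1"
      using real_arch_simple by blast
    have "m - e \<le> qs_avg T \<alpha> n"
      if T: "Suc T1 \<le> T" and \<alpha>: "\<alpha> \<in> {0..1}" "\<bar>\<alpha> - \<alpha>0\<bar> < d" and n: "n \<in> states {2..L}"
        and y: "(\<Sum>k\<in>{2..L}. n k) \<le> y" for T \<alpha> n
    proof -
      interpret flow_system "{2..L}" lam mu "qs_phi L a \<alpha>" by (rule qs_flow_system[OF \<alpha>(1)])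
      have tot: "total_rate = qs_total" by (simp add: total_rate_def qs_total_def)
      define g where "g = (\<lambda>n. 1 * qs_corr T0 \<alpha> n + c * squares n)"
      have "(\<Sum>k\<in>{2..L}. real (n k)) \<le> real y" using y by (simp flip: of_nat_sum)
      then have sqy: "squares n \<le> (real y)\<^sup>2"
        using squares_le[of n] by (intro order_trans[OF squares_le]) (auto intro!: power_mono sum_nonneg)
      have lower: "- (real T0 / qs_total) \<le> (step ^^ Suc T) g n"
      proof -
        have "(step ^^ Suc T) (\<lambda>_. - (real T0 / qs_total)) n \<le> (step ^^ Suc T) g n"
        proof (intro funpow_step_mono n)
          fix m' assume m': "m' \<in> states {2..L}"
          have "- (real T0 / qs_total) \<le> qs_corr T0 \<alpha> m'"
            using qs_corr_bound[OF \<alpha>(1) m', of T0] by (simp add: abs_le_iff)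
          then show "- (real T0 / qs_total) \<le> g m'"
            using c squares_nonneg[of m'] by (simp add: g_def add_increasing2)
        qed
        then show ?thesis by (simp add: funpow_step_const del: funpow.simps)
      qed
      have upper: "step g n \<le> real T0 / qs_total + c * ((real y)\<^sup>2 + drift_const / qs_total)"
      proof -
        have "step g n = 1 * step (qs_corr T0 \<alpha>) n + c * step squares n"
          unfolding g_def step_linear ..
        moreover have "step (qs_corr T0 \<alpha>) n \<le> step (\<lambda>_. real T0 / qs_total) n"
          using qs_corr_bound[OF \<alpha>(1), of _ T0] n by (intro step_mono) (auto simp: abs_le_iff)
        moreover have "step (\<lambda>_. real T0 / qs_total) n = real T0 / qs_total"
          by (simp add: step_def gen_zero)
        moreover have "step squares n \<le> (real y)\<^sup>2 + drift_const / qs_total"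
        proof -
          have "gen squares n \<le> drift_const"
            using qs_gen_squares_le[OF \<alpha>(1), of n] margin_pos
            by (rule_tac order_trans) (auto intro!: mult_nonneg_nonneg sum_nonneg)
          then show ?thesis
            unfolding step_def tot using sqy qs_total_pos by (intro add_mono divide_right_mono) auto
        qed
        ultimately show ?thesis using c by (simp add: add_mono mult_left_mono)
      qed
      have Tpos: "0 < T" using T by simp
      have "qs_total * (real T0 / qs_total + c * ((real y)\<^sup>2 + drift_const / qs_total) + real T0 / qs_total) = b"
        using qs_total_pos by (simp add: b_def field_simps)
      moreover have "qs_total * (step g n - (step ^^ Suc T) g n)
          \<le> qs_total * (real T0 / qs_total + c * ((real y)\<^sup>2 + drift_const / qs_total) + real T0 / qs_total)"
        using lower upper qs_total_pos by (intro mult_left_mono) auto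
      ultimately have "- b \<le> total_rate * ((step ^^ Suc T) g n - step g n)"
        by (simp add: tot algebra_simps)
      then have "- b / real T \<le> avg T (gen g) n"
        unfolding avg_gen by (intro divide_right_mono) auto
      also have "\<dots> \<le> avg T (\<lambda>n. 1 * qs_phi L a \<alpha> 0 n + (- m + 3 * e / 4) * 1) n"
        using key[OF \<alpha>] unfolding g_def by (intro avg_mono n) (auto simp: algebra_simps)
      also have "\<dots> = qs_avg T \<alpha> n - m + 3 * e / 4"
        unfolding avg_linear using Tpos by (simp add: avg_const qs_avg_def)
      finally have "- b / real T \<le> qs_avg T \<alpha> n - m + 3 * e / 4" .
      moreover have "b / real T \<le> e / 4"
      proof -
        have "4 * b / e \<le> real T" using T1 T by linarith
        then show ?thesis using e Tpos by (simp add: field_simps)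
      qed
      ultimately show ?thesis by simp
    qed
    then show "\<exists>T1. \<forall>T\<ge>T1. \<forall>\<alpha>\<in>{0..1}. \<forall>n\<in>states {2..L}. \<bar>\<alpha> - \<alpha>0\<bar> < d \<longrightarrow>
      (\<Sum>k\<in>{2..L}. n k) \<le> y \<longrightarrow> mean_phi0 L lam mu a \<alpha>0 - e \<le> qs_avg T \<alpha> n"
      unfolding m_def by blast
  qed
qed

text \<open>That \<open>\<delta>\<close> is chosen before \<open>y\<close> matters: the Lyapunov function fixes its cone by \<open>\<delta>\<close>, and \<open>y\<close> is a
  cutoff for the fast classes that depends on the cone.\<close>

lemma qs_avg_uniformly_ge:
  assumes \<alpha>s: "\<alpha>s \<in> {0..1}" and e: "0 < e"
    and \<sigma>: "\<And>\<alpha>. \<alpha>s \<le> \<alpha> \<Longrightarrow> \<alpha> \<le> 1 \<Longrightarrow> \<sigma> \<le> mean_phi0 L lam mu a \<alpha>"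
  shows "\<exists>\<delta>>0. \<forall>y. \<exists>T>0. \<forall>\<alpha>\<in>{0..1}. \<forall>n\<in>states {2..L}.
    \<alpha>s - \<delta> \<le> \<alpha> \<longrightarrow> (\<Sum>k\<in>{2..L}. n k) \<le> y \<longrightarrow> \<sigma> - e \<le> qs_avg T \<alpha> n"
proof -
  have "\<forall>\<alpha>0\<in>{\<alpha>s..1}. \<exists>d>0. \<forall>y. \<exists>T1. \<forall>T\<ge>T1. \<forall>\<alpha>\<in>{0..1}. \<forall>n\<in>states {2..L}.
      \<bar>\<alpha> - \<alpha>0\<bar> < d \<longrightarrow> (\<Sum>k\<in>{2..L}. n k) \<le> y \<longrightarrow> \<sigma> - e \<le> qs_avg T \<alpha> n"
  proof
    fix \<alpha>0 assume "\<alpha>0 \<in> {\<alpha>s..1}"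
    then have "\<alpha>0 \<in> {0..1}" and "\<sigma> - e \<le> mean_phi0 L lam mu a \<alpha>0 - e"
      using \<alpha>s \<sigma> by auto
    then show "\<exists>d>0. \<forall>y. \<exists>T1. \<forall>T\<ge>T1. \<forall>\<alpha>\<in>{0..1}. \<forall>n\<in>states {2..L}.
      \<bar>\<alpha> - \<alpha>0\<bar> < d \<longrightarrow> (\<Sum>k\<in>{2..L}. n k) \<le> y \<longrightarrow> \<sigma> - e \<le> qs_avg T \<alpha> n"
      using qs_avg_locally_ge[of \<alpha>0 e] e by (meson order_trans)
  qed
  then obtain d where d: "\<And>\<alpha>0. \<alpha>0 \<in> {\<alpha>s..1} \<Longrightarrow> 0 < d \<alpha>0"
    and d': "\<And>\<alpha>0 y. \<alpha>0 \<in> {\<alpha>s..1} \<Longrightarrow> \<exists>T1. \<forall>T\<ge>T1. \<forall>\<alpha>\<in>{0..1}. \<forall>n\<in>states {2..L}.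
      \<bar>\<alpha> - \<alpha>0\<bar> < d \<alpha>0 \<longrightarrow> (\<Sum>k\<in>{2..L}. n k) \<le> y \<longrightarrow> \<sigma> - e \<le> qs_avg T \<alpha> n"
    by metis
  \<comment> \<open>Balls of half the radius leave room to step to the left of the interval by up to
    \<delta>.\<close>
  have "{\<alpha>s..1} \<subseteq> (\<Union>\<alpha>0\<in>{\<alpha>s..1}. ball \<alpha>0 (d \<alpha>0 / 2))"
    using d by force
  then obtain D where D: "D \<subseteq> {\<alpha>s..1}" "finite D" "{\<alpha>s..1} \<subseteq> (\<Union>\<alpha>0\<in>D. ball \<alpha>0 (d \<alpha>0 / 2))"
    using compactE_image[of "{\<alpha>s..1}" "{\<alpha>s..1}" "\<lambda>\<alpha>0. ball \<alpha>0 (d \<alpha>0 / 2)"] by (metis compact_Icc open_ball)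
  define \<delta> where "\<delta> = Min (insert 1 ((\<lambda>\<alpha>0. d \<alpha>0 / 2) ` D))"
  have \<delta>: "0 < \<delta>"
    unfolding \<delta>_def using D d by (auto simp: Min_gr_iff)
  have \<delta>_le: "\<delta> \<le> d \<alpha>0 / 2" if "\<alpha>0 \<in> D" for \<alpha>0
    unfolding \<delta>_def using D(2) that by (intro Min_le) auto
  show ?thesis
  proof (intro exI[of _ \<delta>] conjI \<delta> allI)
    fix y
    obtain T1 where T1: "\<And>\<alpha>0 T \<alpha> n. \<alpha>0 \<in> D \<Longrightarrow> T1 \<alpha>0 \<le> T \<Longrightarrow> \<alpha> \<in> {0..1} \<Longrightarrow> n \<in> states {2..L} \<Longrightarrow>
      \<bar>\<alpha> - \<alpha>0\<bar> < d \<alpha>0 \<Longrightarrow> (\<Sum>k\<in>{2..L}. n k) \<le> y \<Longrightarrow> \<sigma> - e \<le> qs_avg T \<alpha> n"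
      using d'[of _ y] D(1) by (metis subsetD)
    define T where "T = Suc (\<Sum>\<alpha>0\<in>D. T1 \<alpha>0)"
    have "\<sigma> - e \<le> qs_avg T \<alpha> n" if \<alpha>: "\<alpha> \<in> {0..1}" "\<alpha>s - \<delta> \<le> \<alpha>" and n: "n \<in> states {2..L}" "(\<Sum>k\<in>{2..L}. n k) \<le> y" for \<alpha> n
    proof -
      \<comment> \<open>The nearest point of the interval, at distance at most \<delta> from
        \<alpha>.\<close>
      have "max \<alpha>s \<alpha> \<in> {\<alpha>s..1}" using \<alpha> \<alpha>s by auto
      then obtain \<alpha>0 where \<alpha>0: "\<alpha>0 \<in> D" "max \<alpha>s \<alpha> \<in> ball \<alpha>0 (d \<alpha>0 / 2)"
        using D(3) by blast
      then have "\<bar>max \<alpha>s \<alpha> - \<alpha>0\<bar> < d \<alpha>0 / 2"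
        by (simp add: dist_real_def abs_minus_commute)
      then have "\<bar>\<alpha> - \<alpha>0\<bar> < d \<alpha>0"
        using \<delta>_le[OF \<alpha>0(1)] \<alpha>(2) by linarith
      moreover have "T1 \<alpha>0 \<le> T"
        using member_le_sum[of \<alpha>0 D T1] D(2) \<alpha>0(1) by (simp add: T_def)
      ultimately show ?thesis using T1 \<alpha>0(1) \<alpha>(1) n by blast
    qed
    then show "\<exists>T>0. \<forall>\<alpha>\<in>{0..1}. \<forall>n\<in>states {2..L}.
      \<alpha>s - \<delta> \<le> \<alpha> \<longrightarrow> (\<Sum>k\<in>{2..L}. n k) \<le> y \<longrightarrow> \<sigma> - e \<le> qs_avg T \<alpha> n"
      by (intro exI[of _ T]) (auto simp: T_def)
  qed
qed

end

section \<open>The Lyapunov function\<close>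

definition ramp :: "real \<Rightarrow> real \<Rightarrow> real" where
  "ramp R t = max 0 (min 1 (t / R))"

text \<open>For positive \<open>R\<close> this is the maximum of \<open>w * t - R / 2 * w^2\<close>
  over w in [0, 1], attained at \<open>w = ramp R t\<close>.\<close>

definition hinge :: "real \<Rightarrow> real \<Rightarrow> real" where
  "hinge R t = ramp R t * t - R / 2 * (ramp R t)\<^sup>2"

lemma ramp_bounds: "0 \<le> ramp R t" "ramp R t \<le> 1"
  by (auto simp: ramp_def)

lemma ramp_lipschitz: "0 < R \<Longrightarrow> \<bar>ramp R s - ramp R t\<bar> \<le> \<bar>s - t\<bar> / R"
proof -
  assume R: "0 < R"
  have "\<bar>ramp R s - ramp R t\<bar> \<le> \<bar>s / R - t / R\<bar>"
    unfolding ramp_def by linarith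
  then show ?thesis using R by (simp add: diff_divide_distrib[symmetric])
qed

lemma ramp_pos_imp: "0 < R \<Longrightarrow> 0 < ramp R t \<Longrightarrow> 0 < t"
  by (auto simp: ramp_def less_max_iff_disj zero_less_divide_iff)

lemma ramp_lt_1_imp: "0 < R \<Longrightarrow> ramp R t < 1 \<Longrightarrow> t < R"
  by (auto simp: ramp_def min_less_iff_disj)

lemma ramp_eq_0: "0 < R \<Longrightarrow> t \<le> 0 \<Longrightarrow> ramp R t = 0"
  using divide_nonpos_pos[of t R] by (simp add: ramp_def)

lemma hinge_nonneg:
  assumes R: "0 < R"
  shows "0 \<le> hinge R t"
proof -
  consider "t \<le> 0" | "0 < t" "t \<le> R" | "R < t" by linarith
  then show ?thesis
  proof cases
    case 1
    then have "ramp R t = 0" using R by (simp add: ramp_eq_0)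
    then show ?thesis by (simp add: hinge_def)
  next
    case 2
    then have "ramp R t = t / R" using R by (simp add: ramp_def)
    then show ?thesis using R by (simp add: hinge_def power2_eq_square)
  next
    case 3
    then have "ramp R t = 1" using R by (simp add: ramp_def)
    then show ?thesis using 3 R by (simp add: hinge_def)
  qed
qed

text \<open>\<open>hinge R\<close> is a primitive of \<open>ramp R\<close>: a smoothing of the positive part on the scale \<open>R\<close>.\<close>

lemma hinge_increment:
  assumes R: "0 < R"
  shows "hinge R s \<le> hinge R t + ramp R t * (s - t) + (s - t)\<^sup>2 / (2 * R)"
proof -
  define x y where "x = ramp R s" and "y = ramp R t"
  have xy: "0 \<le> x" "x \<le> 1" by (simp_all add: x_def ramp_bounds)
  \<comment> \<open>The first-order optimality condition for \<open>y\<close> as the maximiser at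
    \<open>t\<close>, tested against \<open>x\<close>. Completing the square does the rest.\<close>
  have "0 \<le> (x - y) * (R * y - t)"
  proof -
    consider "t \<le> 0" | "0 < t" "t \<le> R" | "R < t" by linarith
    then show ?thesis
    proof cases
      case 1
      then have "y = 0" using R by (simp add: y_def ramp_eq_0)
      then show ?thesis using xy 1 by (simp add: mult_nonneg_nonpos)
    next
      case 2
      then have "y = t / R" using R by (simp add: y_def ramp_def)
      then show ?thesis using R by simp
    next
      case 3
      then have "y = 1" using R by (simp add: y_def ramp_def)
      then show ?thesis using xy 3 by (simp add: mult_nonpos_nonpos)
    qed
  qed
  moreover have "0 \<le> (s - t - R * (x - y))\<^sup>2 / (2 * R)" using R by simp
  moreover have "hinge R t + y * (s - t) + (s - t)\<^sup>2 / (2 * R) - hinge R s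
      = (x - y) * (R * y - t) + (s - t - R * (x - y))\<^sup>2 / (2 * R)"
    using R by (simp add: hinge_def x_def[symmetric] y_def[symmetric] field_simps power2_eq_square)
  ultimately show ?thesis by (simp add: y_def)
qed

text \<open>Unlike the plain Lipschitz bounds this one decays with the total \<open>x' + y'\<close>:
  a single jump hardly moves the ratio once the slow classes are large.\<close>

lemma share_difference:
  assumes "0 \<le> x" "0 \<le> y" "0 \<le> x'" "0 \<le> y'"
  shows "\<bar>share x' y' - share x y\<bar> \<le> 2 * (\<bar>x' - x\<bar> + \<bar>y' - y\<bar>) / max 1 (x' + y')"
proof -
  define s s' where "s = max 1 (x + y)" and "s' = max 1 (x' + y')"
  have s: "1 \<le> s" "1 \<le> s'" "x \<le> s" "\<bar>s' - s\<bar> \<le> \<bar>x' - x\<bar> + \<bar>y' - y\<bar>"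
    using assms by (auto simp: s_def s'_def)
  have "share x' y' - share x y = ((x' - x) - share x y * (s' - s)) / s'"
    using s by (simp add: share_def s_def[symmetric] s'_def[symmetric] field_simps)
  also have "\<bar>\<dots>\<bar> \<le> (\<bar>x' - x\<bar> + 1 * \<bar>s' - s\<bar>) / s'"
  proof -
    have "\<bar>share x y * (s' - s)\<bar> \<le> 1 * \<bar>s' - s\<bar>"
      unfolding abs_mult using assms by (intro mult_right_mono) (auto simp: share_bounds)
    then show ?thesis using s by (simp add: divide_right_mono)
  qed
  also have "\<dots> \<le> 2 * (\<bar>x' - x\<bar> + \<bar>y' - y\<bar>) / s'"
  proof (rule divide_right_mono)
    have "\<bar>s' - s\<bar> \<le> \<bar>x' - x\<bar> + 2 * \<bar>y' - y\<bar>" using s(4) by (rule order_trans) simp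
    then show "\<bar>x' - x\<bar> + 1 * \<bar>s' - s\<bar> \<le> 2 * (\<bar>x' - x\<bar> + \<bar>y' - y\<bar>)" by simp
  qed (use s in simp)
  finally show ?thesis by (simp add: s'_def)
qed

section \<open>Drift of the Lyapunov function and recurrence of the network\<close>

context linear_network
begin

definition tail :: "(nat \<Rightarrow> nat) \<Rightarrow> nat \<Rightarrow> nat" where
  "tail n = (\<lambda>k. if k \<in> {2..L} then n k else 0)"

lemma tail_in_states: "tail n \<in> states {2..L}"
  by (simp add: tail_def states_def)

lemma qs_phi_tail: "k = 0 \<or> k \<in> {2..L} \<Longrightarrow> qs_phi L a \<alpha> k (tail n) = qs_phi L a \<alpha> k n"
proof -
  assume k: "k = 0 \<or> k \<in> {2..L}"
  have "qs_theta0 \<alpha> (\<lambda>j. a j * real (tail n j)) l = qs_theta0 \<alpha> (\<lambda>j. a j * real (n j)) l" if "l \<le> L" for l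
    using that by (intro qs_theta0_cong) (simp add: tail_def)
  moreover have "k - 1 \<le> L" using k by auto
  ultimately show ?thesis
    using k by (auto simp: qs_phi_def qs_psi_def tail_def)
qed

definition lead :: "real \<Rightarrow> (nat \<Rightarrow> nat) \<Rightarrow> real" where
  "lead \<kappa> n = real (n 0) - \<kappa> * real (n 1)"

text \<open>\<open>n 0\<close> counts when class 0 leads, \<open>\<kappa> * n 1\<close> when class 1 leads. The third summand replaces the
  departure rate of class 0 by its time average over the fast classes.\<close>

definition lyapunov :: "real \<Rightarrow> real \<Rightarrow> nat \<Rightarrow> real \<Rightarrow> (nat \<Rightarrow> nat) \<Rightarrow> real" where
  "lyapunov \<kappa> R T c n = \<kappa> * real (n 1) + hinge R (lead \<kappa> n)
    + mu 0 * (ramp R (lead \<kappa> n) * qs_corr T (ratio n) (tail n)) + c * squares n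
    + mu 0 * (real T / qs_total)"

text \<open>Three errors of one slow jump: the second-order term of \<open>hinge\<close>, the change
  of the ramp times the bound on the corrector, and the change of the corrector with the ratio.
  Subtracting \<open>a 0 + a 1\<close> makes the denominator valid after the jump.\<close>

definition jump_error :: "real \<Rightarrow> real \<Rightarrow> nat \<Rightarrow> (nat \<Rightarrow> nat) \<Rightarrow> real" where
  "jump_error \<kappa> R T n = (1 + \<kappa>)\<^sup>2 / (2 * R) + mu 0 * ((1 + \<kappa>) / R * (real T / qs_total)
    + (real T)\<^sup>2 / qs_total * (2 * (a 0 + a 1) / max 1 (a 0 * real (n 0) + a 1 * real (n 1) - (a 0 + a 1))))"

text \<open>The constant summand of \<open>lyapunov\<close> bounds the corrector term, the only one
  that can be negative.\<close>

lemma lyapunov_nonneg: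
  assumes "0 \<le> \<kappa>" "0 < R" "0 \<le> c"
  shows "0 \<le> lyapunov \<kappa> R T c n"
proof -
  have mu0: "0 < mu 0" using mu_pos by simp
  have "\<bar>ramp R (lead \<kappa> n) * qs_corr T (ratio n) (tail n)\<bar> \<le> 1 * (real T / qs_total)"
    unfolding abs_mult using qs_corr_bound[OF ratio_bounds tail_in_states] ramp_bounds[of R "lead \<kappa> n"]
    by (intro mult_mono) auto
  then have "0 \<le> mu 0 * (ramp R (lead \<kappa> n) * qs_corr T (ratio n) (tail n) + real T / qs_total)"
    using mu0 by (intro mult_nonneg_nonneg) auto
  moreover have "0 \<le> c * squares n" using assms squares_nonneg by simp
  moreover have "0 \<le> \<kappa> * real (n 1)" using assms by simp
  ultimately show ?thesis
    using hinge_nonneg[OF assms(2), of "lead \<kappa> n"] by (simp add: lyapunov_def distrib_left)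
qed

text \<open>To first order the slopes in \<open>n 0\<close> and \<open>n 1\<close> are w and
  \<open>(1 - w) * \<kappa>\<close>, with w the value of the ramp, so the drifts of the two classes
  enter as a convex combination.\<close>

lemma lyapunov_slow_jump:
  assumes \<kappa>: "0 < \<kappa>" and R: "0 < R"
    and same: "\<And>k. 2 \<le> k \<Longrightarrow> n' k = n k"
    and jump: "\<bar>real (n' 0) - real (n 0)\<bar> \<le> 1" "\<bar>real (n' 1) - real (n 1)\<bar> \<le> 1"
  shows "lyapunov \<kappa> R T c n' - lyapunov \<kappa> R T c n \<le>
    ramp R (lead \<kappa> n) * (real (n' 0) - real (n 0))
    + (1 - ramp R (lead \<kappa> n)) * (\<kappa> * (real (n' 1) - real (n 1))) + jump_error \<kappa> R T n"
proof -
  let ?t = "lead \<kappa> n" and ?t' = "lead \<kappa> n'" and ?M = "real T / qs_total"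
  define w w' where "w = ramp R ?t" and "w' = ramp R ?t'"
  define b b' where "b = qs_corr T (ratio n) (tail n)" and "b' = qs_corr T (ratio n') (tail n)"
  have tail': "tail n' = tail n" using same by (auto simp: tail_def)
  have sq: "squares n' = squares n" unfolding squares_def using same by (intro sum.cong) auto
  have a01: "0 < a 0" "0 < a 1" using a_pos L_ge_2 by auto
  have mu0: "0 < mu 0" using mu_pos by simp
  have dt: "\<bar>?t' - ?t\<bar> \<le> 1 + \<kappa>"
  proof -
    have "\<bar>\<kappa> * (real (n' 1) - real (n 1))\<bar> \<le> \<kappa> * 1"
      unfolding abs_mult using \<kappa> jump(2) by (intro mult_mono) auto
    moreover have "?t' - ?t = (real (n' 0) - real (n 0)) - \<kappa> * (real (n' 1) - real (n 1))"
      by (simp add: lead_def algebra_simps)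
    ultimately show ?thesis using jump(1) by linarith
  qed
  have "(?t' - ?t)\<^sup>2 \<le> (1 + \<kappa>)\<^sup>2" using dt \<kappa> by (simp add: abs_le_square_iff[symmetric])
  then have h: "hinge R ?t' \<le> hinge R ?t + w * (?t' - ?t) + (1 + \<kappa>)\<^sup>2 / (2 * R)"
    using hinge_increment[OF R, of ?t' ?t] R divide_right_mono[of "(?t' - ?t)\<^sup>2" "(1 + \<kappa>)\<^sup>2" "2 * R"]
    by (simp add: w_def)
  have dratio: "\<bar>ratio n' - ratio n\<bar> \<le> 2 * (a 0 + a 1) / max 1 (a 0 * real (n 0) + a 1 * real (n 1) - (a 0 + a 1))"
  proof -
    have d: "\<bar>a k * real (n' k) - a k * real (n k)\<bar> \<le> a k" if "k \<in> {0, 1}" for k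
    proof -
      have "\<bar>a k * (real (n' k) - real (n k))\<bar> \<le> a k * 1"
        unfolding abs_mult using a01 jump that by (intro mult_mono) auto
      then show ?thesis by (simp add: right_diff_distrib)
    qed
    have "\<bar>ratio n' - ratio n\<bar> \<le> 2 * (\<bar>a 0 * real (n' 0) - a 0 * real (n 0)\<bar> + \<bar>a 1 * real (n' 1) - a 1 * real (n 1)\<bar>)
      / max 1 (a 0 * real (n' 0) + a 1 * real (n' 1))"
      unfolding ratio_def using a01 by (intro share_difference) auto
    also have "\<dots> \<le> 2 * (a 0 + a 1) / max 1 (a 0 * real (n 0) + a 1 * real (n 1) - (a 0 + a 1))"
    proof (intro frac_le)
      have "a 0 * real (n 0) + a 1 * real (n 1) - (a 0 + a 1) \<le> a 0 * real (n' 0) + a 1 * real (n' 1)"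
        using d[of 0] d[of 1] by (simp add: abs_le_iff)
      then show "max 1 (a 0 * real (n 0) + a 1 * real (n 1) - (a 0 + a 1)) \<le> max 1 (a 0 * real (n' 0) + a 1 * real (n' 1))"
        by auto
    qed (use d[of 0] d[of 1] a01 in auto)
    finally show ?thesis .
  qed
  have "\<bar>b' - b\<bar> \<le> (real T)\<^sup>2 / qs_total * \<bar>ratio n' - ratio n\<bar>"
    unfolding b_def b'_def by (intro qs_corr_lipschitz ratio_bounds tail_in_states)
  also have "\<dots> \<le> (real T)\<^sup>2 / qs_total * (2 * (a 0 + a 1) / max 1 (a 0 * real (n 0) + a 1 * real (n 1) - (a 0 + a 1)))"
    using dratio qs_total_pos by (intro mult_left_mono) auto
  finally have db: "\<bar>b' - b\<bar> \<le> (real T)\<^sup>2 / qs_total * (2 * (a 0 + a 1) / max 1 (a 0 * real (n 0) + a 1 * real (n 1) - (a 0 + a 1)))" .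
  have dw: "\<bar>w' - w\<bar> \<le> (1 + \<kappa>) / R"
    using ramp_lipschitz[OF R, of ?t' ?t] dt R unfolding w_def w'_def
    by (intro order_trans[OF ramp_lipschitz[OF R] divide_right_mono]) auto
  have "w' * b' - w * b = (w' - w) * b' + w * (b' - b)" by (simp add: algebra_simps)
  also have "\<dots> \<le> \<bar>w' - w\<bar> * \<bar>b'\<bar> + 1 * \<bar>b' - b\<bar>"
  proof (intro add_mono)
    show "(w' - w) * b' \<le> \<bar>w' - w\<bar> * \<bar>b'\<bar>" by (simp flip: abs_mult)
    have "w * (b' - b) \<le> w * \<bar>b' - b\<bar>" by (intro mult_left_mono) (auto simp: w_def ramp_bounds)
    also have "\<dots> \<le> 1 * \<bar>b' - b\<bar>" by (intro mult_right_mono) (auto simp: w_def ramp_bounds)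
    finally show "w * (b' - b) \<le> 1 * \<bar>b' - b\<bar>" .
  qed
  also have "\<dots> \<le> (1 + \<kappa>) / R * ?M + 1 * \<bar>b' - b\<bar>"
    using dw qs_corr_bound[OF ratio_bounds tail_in_states] \<kappa> R
    by (intro add_mono mult_mono order_refl) (auto simp: b'_def)
  finally have "mu 0 * (w' * b' - w * b) \<le> mu 0 * ((1 + \<kappa>) / R * ?M + (real T)\<^sup>2 / qs_total * (2 * (a 0 + a 1) / max 1 (a 0 * real (n 0) + a 1 * real (n 1) - (a 0 + a 1))))"
    using db mu0 by (intro mult_left_mono) auto
  moreover have "lyapunov \<kappa> R T c n' - lyapunov \<kappa> R T c n =
      \<kappa> * (real (n' 1) - real (n 1)) + (hinge R ?t' - hinge R ?t) + mu 0 * (w' * b' - w * b)"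
    by (simp add: lyapunov_def tail' sq w_def w'_def b_def b'_def algebra_simps)
  moreover have "w * (?t' - ?t) = w * (real (n' 0) - real (n 0)) - w * (\<kappa> * (real (n' 1) - real (n 1)))"
    by (simp add: lead_def algebra_simps)
  moreover have "(1 - w) * (\<kappa> * (real (n' 1) - real (n 1))) = \<kappa> * (real (n' 1) - real (n 1)) - w * (\<kappa> * (real (n' 1) - real (n 1)))"
    by (simp add: algebra_simps)
  ultimately show ?thesis
    using h unfolding jump_error_def w_def[symmetric] by linarith
qed

text \<open>Slow jumps produce \<open>phi L a 0 n\<close> with factor \<open>- mu 0 * w n\<close>;
  fast jumps acting on the corrector produce it with the opposite sign. It cancels, leaving the
  Cesaro average.\<close>

lemma lyapunov_drift:
  assumes \<kappa>: "0 < \<kappa>" and R: "0 < R" and T: "0 < T" and c: "0 \<le> c"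
  defines "w \<equiv> \<lambda>n. ramp R (lead \<kappa> n)"
  shows "flow_system.gen {0..L} lam mu (phi L a) (lyapunov \<kappa> R T c) n \<le>
    w n * (lam 0 - mu 0 * qs_avg T (ratio n) (tail n)) + (1 - w n) * (\<kappa> * (lam 1 - mu 1 * phi L a 1 n))
    + c * (drift_const - margin * real (\<Sum>k\<in>{2..L}. n k))
    + (lam 0 + lam 1 + mu 0 + mu 1) * jump_error \<kappa> R T n"
proof -
  let ?W = "lyapunov \<kappa> R T c"
  interpret net: flow_system "{0..L}" lam mu "phi L a" by (rule network_flow_system)
  interpret qs: flow_system "{2..L}" lam mu "qs_phi L a (ratio n)" by (rule qs_flow_system[OF ratio_bounds])
  define part where "part k = lam k * (?W (net.inc n k) - ?W n) + mu k * phi L a k n * (?W (net.dec n k) - ?W n)" for k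
  have pos: "0 < lam 0" "0 < lam 1" "0 < mu 0" "0 < mu 1" using lam_pos mu_pos L_ge_2 by auto
  have err: "0 \<le> jump_error \<kappa> R T n"
    unfolding jump_error_def using \<kappa> R pos qs_total_pos a_pos[of 0] a_pos[of 1] L_ge_2
    by (intro add_nonneg_nonneg mult_nonneg_nonneg divide_nonneg_nonneg) auto
  have split: "{0..L} = {0, 1} \<union> {2..L}" using L_ge_2 by auto
  have "net.gen ?W n = (\<Sum>k\<in>{0, 1} \<union> {2..L}. part k)"
    unfolding split[symmetric] by (simp only: net.gen_def part_def)
  also have "\<dots> = part 0 + part 1 + (\<Sum>k\<in>{2..L}. part k)"
    by (subst sum.union_disjoint) auto
  finally have gen: "net.gen ?W n = part 0 + part 1 + (\<Sum>k\<in>{2..L}. part k)" .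
  have 0: "part 0 \<le> w n * (lam 0 - mu 0 * phi L a 0 n) + (lam 0 + mu 0) * jump_error \<kappa> R T n"
  proof -
    have up: "?W (net.inc n 0) - ?W n \<le> w n + jump_error \<kappa> R T n"
      using lyapunov_slow_jump[OF \<kappa> R, of "net.inc n 0" n T c] by (simp add: w_def)
    \<comment> \<open>The factor \<open>phi\<close> stays in the inequality because at
      \<open>n 0 = 0\<close> the truncated decrement does nothing and the bound without the factor
      could fail.\<close>
    have down: "phi L a 0 n * (?W (net.dec n 0) - ?W n) \<le> phi L a 0 n * (- w n + jump_error \<kappa> R T n)"
    proof (cases "n 0 = 0")
      case True
      then show ?thesis using net.phi_zero[of 0 n] by simp
    next
      case False
      then have "real (n 0 - Suc 0) - real (n 0) = - 1" by (simp add: of_nat_diff)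
      then have "?W (net.dec n 0) - ?W n \<le> - w n + jump_error \<kappa> R T n"
        using lyapunov_slow_jump[OF \<kappa> R, of "net.dec n 0" n T c] by (simp add: w_def)
      then show ?thesis using net.phi_nonneg[of 0 n] by (intro mult_left_mono) auto
    qed
    have "part 0 \<le> lam 0 * (w n + jump_error \<kappa> R T n) + mu 0 * (phi L a 0 n * (- w n + jump_error \<kappa> R T n))"
      unfolding part_def mult.assoc by (intro add_mono mult_left_mono[OF up] mult_left_mono[OF down]) (use pos in auto)
    also have "\<dots> = w n * (lam 0 - mu 0 * phi L a 0 n) + (lam 0 + mu 0 * phi L a 0 n) * jump_error \<kappa> R T n"
      by (simp add: algebra_simps)
    also have "\<dots> \<le> w n * (lam 0 - mu 0 * phi L a 0 n) + (lam 0 + mu 0) * jump_error \<kappa> R T n"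
      using net.phi_le_1[of 0 n] pos err by (intro add_left_mono mult_right_mono) (auto simp: mult_left_le)
    finally show ?thesis .
  qed
  have 1: "part 1 \<le> (1 - w n) * (\<kappa> * (lam 1 - mu 1 * phi L a 1 n)) + (lam 1 + mu 1) * jump_error \<kappa> R T n"
  proof -
    have in1: "1 \<in> {0..L}" using L_ge_2 by simp
    have up: "?W (net.inc n 1) - ?W n \<le> (1 - w n) * \<kappa> + jump_error \<kappa> R T n"
      using lyapunov_slow_jump[OF \<kappa> R, of "net.inc n 1" n T c] by (simp add: w_def)
    have down: "phi L a 1 n * (?W (net.dec n 1) - ?W n) \<le> phi L a 1 n * (- ((1 - w n) * \<kappa>) + jump_error \<kappa> R T n)"
    proof (cases "n 1 = 0")
      case True
      then show ?thesis using net.phi_zero[OF in1, of n] by simp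
    next
      case False
      then have "real (n 1 - Suc 0) - real (n 1) = - 1" by (simp add: of_nat_diff)
      then have "?W (net.dec n 1) - ?W n \<le> - ((1 - w n) * \<kappa>) + jump_error \<kappa> R T n"
        using lyapunov_slow_jump[OF \<kappa> R, of "net.dec n 1" n T c] by (simp add: w_def)
      then show ?thesis using net.phi_nonneg[OF in1, of n] by (intro mult_left_mono) auto
    qed
    have "part 1 \<le> lam 1 * ((1 - w n) * \<kappa> + jump_error \<kappa> R T n) + mu 1 * (phi L a 1 n * (- ((1 - w n) * \<kappa>) + jump_error \<kappa> R T n))"
      unfolding part_def mult.assoc by (intro add_mono mult_left_mono[OF up] mult_left_mono[OF down]) (use pos in auto)
    also have "\<dots> = (1 - w n) * (\<kappa> * (lam 1 - mu 1 * phi L a 1 n)) + (lam 1 + mu 1 * phi L a 1 n) * jump_error \<kappa> R T n"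
      by (simp add: algebra_simps)
    also have "\<dots> \<le> (1 - w n) * (\<kappa> * (lam 1 - mu 1 * phi L a 1 n)) + (lam 1 + mu 1) * jump_error \<kappa> R T n"
      using net.phi_le_1[OF in1, of n] pos err by (intro add_left_mono mult_right_mono) (auto simp: mult_left_le)
    finally show ?thesis .
  qed
  \<comment> \<open>Fast jumps change neither \<open>ratio\<close> nor \<open>lead\<close>, so the
    ramp is a constant factor and \<alpha> is frozen: the corrector equation applies
    exactly.\<close>
  have 2: "(\<Sum>k\<in>{2..L}. part k) = mu 0 * w n * (phi L a 0 n - qs_avg T (ratio n) (tail n)) + c * qs.gen squares n"
  proof -
    let ?b = "qs_corr T (ratio n)"
    have part: "part k = mu 0 * w n * (lam k * (?b (qs.inc (tail n) k) - ?b (tail n))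
        + mu k * qs_phi L a (ratio n) k (tail n) * (?b (qs.dec (tail n) k) - ?b (tail n)))
      + c * (lam k * (squares (qs.inc n k) - squares n) + mu k * qs_phi L a (ratio n) k n * (squares (qs.dec n k) - squares n))"
      if k: "k \<in> {2..L}" for k
    proof -
      have jump: "?W (n(k := x)) - ?W n = mu 0 * w n * (?b ((tail n)(k := x)) - ?b (tail n)) + c * (squares (n(k := x)) - squares n)" for x
      proof -
        have "tail (n(k := x)) = (tail n)(k := x)" using k by (auto simp: tail_def)
        moreover have "ratio (n(k := x)) = ratio n" "lead \<kappa> (n(k := x)) = lead \<kappa> n" "(n(k := x)) 1 = n 1"
          using k by (auto simp: ratio_def lead_def)
        ultimately show ?thesis by (simp add: lyapunov_def w_def algebra_simps del: fun_upd_apply)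
      qed
      have tk: "tail n k = n k" using k by (simp add: tail_def)
      have "phi L a k n = qs_phi L a (ratio n) k n" using k by (intro phi_eq_qs_phi) auto
      then show ?thesis
        unfolding part_def jump tk qs_phi_tail[OF disjI2[OF k]] by (simp add: algebra_simps)
    qed
    have "(\<Sum>k\<in>{2..L}. part k) = mu 0 * w n * qs.gen ?b (tail n) + c * qs.gen squares n"
      unfolding qs.gen_def sum_distrib_left sum.distrib[symmetric] by (intro sum.cong) (simp_all add: part)
    also have "qs.gen ?b (tail n) = phi L a 0 n - qs_avg T (ratio n) (tail n)"
      using qs.gen_corrector[OF T, of "qs_phi L a (ratio n) 0" "tail n"]
      by (simp add: qs_corr_def qs_avg_def qs_phi_tail phi_eq_qs_phi)
    finally show ?thesis .
  qed
  have "c * qs.gen squares n \<le> c * (drift_const - margin * real (\<Sum>k\<in>{2..L}. n k))"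
    using c qs_gen_squares_le[OF ratio_bounds, of n n] by (intro mult_left_mono) auto
  then have "net.gen ?W n \<le> w n * (lam 0 - mu 0 * phi L a 0 n) + (lam 0 + mu 0) * jump_error \<kappa> R T n
      + ((1 - w n) * (\<kappa> * (lam 1 - mu 1 * phi L a 1 n)) + (lam 1 + mu 1) * jump_error \<kappa> R T n)
      + (mu 0 * w n * (phi L a 0 n - qs_avg T (ratio n) (tail n)) + c * (drift_const - margin * real (\<Sum>k\<in>{2..L}. n k)))"
    unfolding gen 2 by (intro add_mono 0 1 order_refl)
  also have "\<dots> = w n * (lam 0 - mu 0 * qs_avg T (ratio n) (tail n)) + (1 - w n) * (\<kappa> * (lam 1 - mu 1 * phi L a 1 n))
    + c * (drift_const - margin * real (\<Sum>k\<in>{2..L}. n k))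
    + (lam 0 + lam 1 + mu 0 + mu 1) * jump_error \<kappa> R T n"
    by (simp add: algebra_simps)
  finally show ?thesis .
qed

lemma large_tail_drift:
  assumes "0 < c"
  shows "\<exists>y::nat. \<forall>s. y < s \<longrightarrow> c * (drift_const - margin * real s) \<le> - b"
proof -
  obtain y :: nat where y: "(drift_const + b / c) / margin \<le> real y"
    using real_arch_simple by blast
  have "c * (drift_const - margin * real s) \<le> - b" if "y < s" for s
  proof -
    have "(drift_const + b / c) / margin \<le> real s" using y that by linarith
    then have "drift_const + b / c \<le> margin * real s"
      using margin_pos by (simp add: divide_le_eq mult.commute)
    then have "c * (drift_const + b / c) \<le> c * (margin * real s)"
      using assms by (intro mult_left_mono) auto
    then show ?thesis using assms by (simp add: algebra_simps)
  qed
  then show ?thesis by blast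
qed

lemma network_positive_recurrent:
  fixes P :: "(nat \<Rightarrow> nat) \<Rightarrow> 'w measure"
  assumes fam: "markov_jump_family (states {0..L}) (network_rates L lam mu a) P N"
    and \<rho>1: "lam 1 < mu 1"
    and \<sigma>: "\<And>\<alpha>. 1 - lam 1 / mu 1 \<le> \<alpha> \<Longrightarrow> \<alpha> \<le> 1 \<Longrightarrow> \<sigma> \<le> mean_phi0 L lam mu a \<alpha>"
    and \<rho>0: "lam 0 / mu 0 < \<sigma>"
  shows "positive_recurrent (states {0..L}) P N"
proof -
  interpret net: flow_system "{0..L}" lam mu "phi L a" by (rule network_flow_system)
  have pos: "0 < lam 0" "0 < lam 1" "0 < mu 0" "0 < mu 1" "0 < a 0" "0 < a 1"
    using lam_pos mu_pos a_pos L_ge_2 by auto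
  define \<alpha>s where "\<alpha>s = 1 - lam 1 / mu 1"
  have \<alpha>s: "0 < \<alpha>s" "\<alpha>s < 1" using \<rho>1 pos by (auto simp: \<alpha>s_def)
  define e where "e = (\<sigma> - lam 0 / mu 0) / 2"
  have e: "0 < e" using \<rho>0 by (simp add: e_def)
  obtain \<delta>0 where \<delta>0: "0 < \<delta>0" and unif: "\<And>y. \<exists>T>0. \<forall>\<alpha>\<in>{0..1}. \<forall>n\<in>states {2..L}.
    \<alpha>s - \<delta>0 \<le> \<alpha> \<longrightarrow> (\<Sum>k\<in>{2..L}. n k) \<le> y \<longrightarrow> \<sigma> - e \<le> qs_avg T \<alpha> n"
    using qs_avg_uniformly_ge[of \<alpha>s e \<sigma>] \<alpha>s e \<sigma> unfolding \<alpha>s_def[symmetric] by auto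
  \<comment> \<open>The cap \<open>\<alpha>s / 2\<close> keeps \<alpha>' positive, so that \<kappa>
    is positive.\<close>
  define \<delta> where "\<delta> = min \<delta>0 (\<alpha>s / 2)"
  have \<delta>: "0 < \<delta>" "\<delta> \<le> \<delta>0" "\<delta> < \<alpha>s" using \<delta>0 \<alpha>s by (auto simp: \<delta>_def)
  define \<alpha>' where "\<alpha>' = \<alpha>s - \<delta>"
  have \<alpha>': "0 < \<alpha>'" "\<alpha>' < 1" using \<delta> \<alpha>s by (auto simp: \<alpha>'_def)
  \<comment> \<open>so that, for many flows of the classes 0 and 1, \<open>0 < lead \<kappa> n\<close> iff \<open>\<alpha>' < ratio n\<close>\<close>
  define \<kappa> where "\<kappa> = \<alpha>' * a 1 / ((1 - \<alpha>') * a 0)"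
  have \<kappa>: "0 < \<kappa>" using \<alpha>' pos by (simp add: \<kappa>_def)
  \<comment> \<open>The guaranteed decrease while class 0 leads and while class 1 leads. The latter
    uses only half of \<delta>; the other half is spent on the width of the ramp.\<close>
  define eps where "eps = min (mu 0 * e) (\<kappa> * (mu 1 * (\<delta> / 2)))"
  have eps: "0 < eps" "eps \<le> mu 0 * e" "eps \<le> \<kappa> * (mu 1 * (\<delta> / 2))"
    using pos e \<kappa> \<delta> by (auto simp: eps_def)
  define c where "c = eps / (4 * (drift_const + 1))"
  have c: "0 < c" "c * drift_const \<le> eps / 4"
    using eps drift_const_nonneg by (auto simp: c_def divide_simps add_pos_nonneg mult_left_mono)
  \<comment> \<open>The first two terms bound the slow part of the drift in all states;
    \<open>2 * eps\<close> leaves room for the jump error.\<close>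
  define b where "b = lam 0 + \<kappa> * lam 1 + 2 * eps"
  obtain y where y: "\<And>s. y < s \<Longrightarrow> c * (drift_const - margin * real s) \<le> - b"
    using large_tail_drift[OF c(1), of b] by blast
  obtain T where T: "0 < T" "\<And>\<alpha> n. \<alpha> \<in> {0..1} \<Longrightarrow> n \<in> states {2..L} \<Longrightarrow> \<alpha>s - \<delta>0 \<le> \<alpha> \<Longrightarrow>
      (\<Sum>k\<in>{2..L}. n k) \<le> y \<Longrightarrow> \<sigma> - e \<le> qs_avg T \<alpha> n"
    using unif[of y] by blast
  define S4 where "S4 = lam 0 + lam 1 + mu 0 + mu 1"
  have S4: "0 < S4" using pos by (simp add: S4_def)
  define B where "B = (1 + \<kappa>)\<^sup>2 / 2 + mu 0 * ((1 + \<kappa>) * (real T / qs_total))"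
  have B: "0 < B" unfolding B_def using \<kappa> pos qs_total_pos by (intro add_pos_nonneg) auto
  \<comment> \<open>\<open>B / R\<close> collects the parts of \<open>jump_error\<close> that
    involve the width; this \<open>R\<close> makes their total contribution \<open>eps / 8\<close>.
    \<open>B\<close> contains \<open>T\<close>, so \<open>T\<close> is fixed beforehand.\<close>
  define R where "R = 8 * S4 * B / eps"
  have R: "0 < R" using S4 B eps by (simp add: R_def)
  define C where "C = S4 * (mu 0 * ((real T)\<^sup>2 / qs_total * (2 * (a 0 + a 1))))"
  have C: "0 \<le> C" unfolding C_def using S4 pos qs_total_pos by auto
  let ?x = "\<lambda>n. a 0 * real (n 0) + a 1 * real (n 1)"
  have error: "S4 * jump_error \<kappa> R T n = eps / 8 + C / max 1 (?x n - (a 0 + a 1))" for n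
  proof -
    have "jump_error \<kappa> R T n = B / R + mu 0 * ((real T)\<^sup>2 / qs_total * (2 * (a 0 + a 1) / max 1 (?x n - (a 0 + a 1))))"
      by (simp add: jump_error_def B_def add_divide_distrib distrib_left mult_ac)
    moreover have "S4 * (B / R) = eps / 8" using S4 B eps by (simp add: R_def)
    ultimately show ?thesis by (simp add: C_def distrib_left)
  qed
  \<comment> \<open>Beyond \<open>X\<close> link 1 is saturated, the error from the moving ratio is
    at most \<open>eps / 8\<close>, and the ramp, of width \<open>R\<close> in \<open>lead\<close>,
    spans at most \<open>\<delta> / 2\<close> in the ratio.\<close>
  define X where "X = max 1 (max (8 * C / eps + (a 0 + a 1)) (2 * R * a 0 / \<delta>))"
  have X: "1 \<le> X" "8 * C / eps + (a 0 + a 1) \<le> X" "2 * R * a 0 / \<delta> \<le> X" by (auto simp: X_def)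
  \<comment> \<open>A second, larger cutoff for states with few slow flows, where the ratio is
    unstable and its error is only bounded by \<open>C\<close>.\<close>
  obtain y' where y': "\<And>s. y' < s \<Longrightarrow> c * (drift_const - margin * real s) \<le> - (b + C)"
    using large_tail_drift[OF c(1), of "b + C"] by blast
  let ?s = "\<lambda>n :: nat \<Rightarrow> nat. \<Sum>k\<in>{2..L}. n k"
  let ?F = "{n \<in> states {0..L}. ?x n < X \<and> ?s n \<le> y'}"
  let ?W = "lyapunov \<kappa> R T c"
  have finite_F: "finite ?F"
  proof -
    obtain z :: nat where z: "X / a 0 + X / a 1 + real y' \<le> real z" using real_arch_simple by blast
    have "(\<Sum>k\<in>{0..L}. n k) \<le> z" if n: "n \<in> ?F" for n
    proof -
      have "a 0 * real (n 0) \<le> X" "a 1 * real (n 1) \<le> X" using n pos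
        by (auto intro: order_trans[rotated, OF less_imp_le])
      then have "real (n 0) \<le> X / a 0" "real (n 1) \<le> X / a 1"
        using pos by (auto simp: pos_le_divide_eq mult.commute)
      moreover have "(\<Sum>k\<in>{0..L}. n k) = n 0 + n 1 + ?s n"
      proof -
        have "{0..L} = {0, 1} \<union> {2..L}" using L_ge_2 by auto
        then show ?thesis by (simp add: sum.union_disjoint)
      qed
      moreover have "real (?s n) \<le> real y'" using n by (simp only: of_nat_le_iff) simp
      ultimately have "real (\<Sum>k\<in>{0..L}. n k) \<le> real z" using z by (simp only: of_nat_add)
      then show ?thesis by (simp only: of_nat_le_iff)
    qed
    then have "?F \<subseteq> {n \<in> states {0..L}. (\<Sum>k\<in>{0..L}. n k) \<le> z}" by auto
    then show ?thesis using net.finite_states_le[of z] by (rule finite_subset)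
  qed
  have drift: "net.gen ?W n \<le> - (eps / 2)" if n: "n \<in> states {0..L} - ?F" for n
  proof -
    define w where "w = ramp R (lead \<kappa> n)"
    have w: "0 \<le> w" "w \<le> 1" by (simp_all add: w_def ramp_bounds)
    define A where "A = w * (lam 0 - mu 0 * qs_avg T (ratio n) (tail n))"
    define D where "D = (1 - w) * (\<kappa> * (lam 1 - mu 1 * phi L a 1 n))"
    define E where "E = c * (drift_const - margin * real (?s n))"
    have main: "net.gen ?W n \<le> A + D + E + S4 * jump_error \<kappa> R T n"
      using lyapunov_drift[OF \<kappa> R T(1), of c n] c unfolding A_def D_def E_def w_def S4_def by simp
    have A_le: "A \<le> lam 0"
    proof -
      have "A \<le> w * lam 0"
        unfolding A_def using w pos qs_avg_nonneg[OF ratio_bounds tail_in_states] by (intro mult_left_mono) auto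
      also have "\<dots> \<le> 1 * lam 0" using w pos by (intro mult_right_mono) auto
      finally show ?thesis by simp
    qed
    have D_le: "D \<le> \<kappa> * lam 1"
    proof -
      have "D \<le> (1 - w) * (\<kappa> * lam 1)"
        unfolding D_def using w \<kappa> pos net.phi_nonneg[of 1 n] L_ge_2 by (intro mult_left_mono) auto
      also have "\<dots> \<le> 1 * (\<kappa> * lam 1)" using w \<kappa> pos by (intro mult_right_mono) auto
      finally show ?thesis by simp
    qed
    show ?thesis
    \<comment> \<open>With few slow or many fast flows the squares outweigh everything else. Only
      the remaining case, many slow and few fast flows, uses the cone and the averages.\<close>
    proof (cases "?x n < X")
      case True
      then have "y' < ?s n" using n by auto
      then have "E \<le> - (b + C)" unfolding E_def by (rule y')
      moreover have "S4 * jump_error \<kappa> R T n \<le> eps / 8 + C"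
      proof -
        have "C / max 1 (?x n - (a 0 + a 1)) \<le> C / 1" using C by (intro divide_left_mono) auto
        then show ?thesis by (simp add: error)
      qed
      ultimately show ?thesis
        using main A_le D_le eps by (simp add: b_def)
    next
      case False
      then have x: "X \<le> ?x n" by simp
      have err: "S4 * jump_error \<kappa> R T n \<le> eps / 4"
      proof -
        have "8 * C / eps \<le> max 1 (?x n - (a 0 + a 1))" using x X(2) by simp
        then have "C / max 1 (?x n - (a 0 + a 1)) \<le> eps / 8"
          using eps by (simp add: divide_le_eq pos_divide_le_eq mult.commute)
        then show ?thesis unfolding error by linarith
      qed
      show ?thesis
      proof (cases "?s n \<le> y")
        case False
        then have "E \<le> - b" unfolding E_def by (intro y) simp
        then show ?thesis using main A_le D_le err eps by (simp add: b_def)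
      next
        case True
        have x1: "1 \<le> ?x n" and xpos: "0 < ?x n" using x X by auto
        have ratio: "ratio n = a 0 * real (n 0) / ?x n" using x1 by (simp add: ratio_def share_def)
        have phi1: "phi L a 1 n = 1 - ratio n"
          using x1 xpos unfolding phi_1 ratio by (simp add: share_def field_simps)
        \<comment> \<open>By the choice of \<kappa>, \<open>lead\<close> measures the deviation of
          the ratio from \<alpha>', scaled by the size of the slow classes.\<close>
        have cross: "(ratio n - \<alpha>') * ?x n = (1 - \<alpha>') * a 0 * lead \<kappa> n"
          using xpos \<alpha>' pos unfolding ratio lead_def \<kappa>_def by (simp add: field_simps)
        have "A \<le> w * (- eps)"
        proof (cases "w = 0")
          case False
          then have "0 < lead \<kappa> n" using w R by (rule_tac ramp_pos_imp[OF R]) (auto simp: w_def)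
          then have "0 < (ratio n - \<alpha>') * ?x n" unfolding cross using \<alpha>' pos by auto
          then have "\<alpha>' < ratio n" using xpos by (simp add: zero_less_mult_iff)
          then have "\<sigma> - e \<le> qs_avg T (ratio n) (tail n)"
            using True \<delta> by (intro T(2) ratio_bounds tail_in_states) (auto simp: \<alpha>'_def tail_def)
          then have "mu 0 * (lam 0 / mu 0 + e) \<le> mu 0 * qs_avg T (ratio n) (tail n)"
            using pos by (intro mult_left_mono) (auto simp: e_def field_simps)
          then have "lam 0 - mu 0 * qs_avg T (ratio n) (tail n) \<le> - eps"
            using eps(2) pos by (simp add: distrib_left)
          then show ?thesis unfolding A_def using w by (intro mult_left_mono) auto
        qed (simp add: A_def)
        moreover have "D \<le> (1 - w) * (- eps)"
        proof (cases "w = 1")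
          case False
          then have "lead \<kappa> n < R" using w by (rule_tac ramp_lt_1_imp[OF R]) (auto simp: w_def)
          then have "(1 - \<alpha>') * a 0 * lead \<kappa> n \<le> 1 * a 0 * R"
            using \<alpha>' pos R by (intro order_trans[OF mult_left_mono mult_right_mono]) auto
          then have "(ratio n - \<alpha>') * ?x n \<le> a 0 * R" unfolding cross by simp
          also have "\<dots> \<le> \<delta> / 2 * ?x n"
            using order_trans[OF X(3) x] \<delta> by (simp add: divide_le_eq algebra_simps)
          finally have "ratio n - \<alpha>' \<le> \<delta> / 2" using xpos by simp
          then have "ratio n - \<alpha>s \<le> - (\<delta> / 2)" by (simp add: \<alpha>'_def)
          then have "mu 1 * (ratio n - \<alpha>s) \<le> mu 1 * (- (\<delta> / 2))"
            using pos by (intro mult_left_mono) auto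
          moreover have "lam 1 - mu 1 * phi L a 1 n = mu 1 * (ratio n - \<alpha>s)"
            unfolding phi1 \<alpha>s_def using pos by (simp add: field_simps)
          ultimately have "\<kappa> * (lam 1 - mu 1 * phi L a 1 n) \<le> \<kappa> * (mu 1 * (- (\<delta> / 2)))"
            using \<kappa> by (intro mult_left_mono) auto
          then have "\<kappa> * (lam 1 - mu 1 * phi L a 1 n) \<le> - eps" using eps(3) by simp
          then show ?thesis unfolding D_def using w by (intro mult_left_mono) auto
        qed (simp add: D_def)
        ultimately have "A + D \<le> - eps" by (simp add: algebra_simps)
        moreover have "E \<le> eps / 4"
        proof -
          have "E \<le> c * drift_const"
            unfolding E_def using c margin_pos by (intro mult_left_mono) (auto intro!: mult_nonneg_nonneg sum_nonneg)
          then show ?thesis using c by simp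
        qed
        ultimately show ?thesis using main err by simp
      qed
    qed
  qed
  show ?thesis
  proof (rule net.positive_recurrent_if_drift[of P N ?W ?F "eps / 2"])
    show "markov_jump_family (states {0..L}) net.q P N"
      using fam by (simp add: network_rates_def)
    show "0 \<le> ?W n" for n using \<kappa> R c by (intro lyapunov_nonneg) auto
  qed (use finite_F drift eps in auto)
qed

end

theorem theorem1:
  fixes L :: nat
    and lam mu a \<rho> :: "nat \<Rightarrow> real"
    and P :: "(nat \<Rightarrow> nat) \<Rightarrow> 'w measure"
    and N :: "real \<Rightarrow> 'w \<Rightarrow> (nat \<Rightarrow> nat)"
  assumes "L \<ge> 2"
    and "\<And>k. k \<le> L \<Longrightarrow> lam k > 0"
    and "\<And>k. k \<le> L \<Longrightarrow> mu k > 0"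
    and "\<And>k. k \<le> L \<Longrightarrow> a k > 0"
    and "\<And>k. k \<le> L \<Longrightarrow> \<rho> k = lam k / mu k"
    and "markov_jump_family (states {0..L}) (network_rates L lam mu a) P N"
    and "\<And>k. 2 \<le> k \<Longrightarrow> k \<le> L \<Longrightarrow> \<rho> k < 1"
    and "\<rho> 0 < Inf (mean_phi0 L lam mu a ` {x \<in> {0..1}. 1 - \<rho> 1 \<le> x \<and> x \<le> 1})"
  shows "positive_recurrent (states {0..L}) P N"
proof -
  interpret linear_network L lam mu a
    using assms(1-5,7) by unfold_locales (auto simp: divide_less_eq)
  let ?A = "{x \<in> {0..1}. 1 - \<rho> 1 \<le> x \<and> x \<le> 1}"
  have \<rho>: "\<rho> 0 = lam 0 / mu 0" "\<rho> 1 = lam 1 / mu 1" using assms(1,5) by auto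
  have pos: "0 < lam 0" "0 < mu 0" "0 < mu 1" using lam_pos mu_pos assms(1) by auto
  have "0 \<le> mean_phi0 L lam mu a x" if "x \<in> {0..1}" for x
    unfolding mean_phi0_def using that by (intro infsum_nonneg) (auto simp: qs_phi_0_bounds)
  then have bdd: "bdd_below (mean_phi0 L lam mu a ` ?A)" by (auto intro!: bdd_belowI2)
  have le: "Inf (mean_phi0 L lam mu a ` ?A) \<le> mean_phi0 L lam mu a x" if "x \<in> ?A" for x
    using that bdd by (intro cInf_lower) auto
  \<comment> \<open>Otherwise the infimum would include the parameter 0, where class 0 gets no
    service and \<open>mean_phi0\<close> is 0, contradicting that \<rho> 0 is positive.\<close>
  have "\<rho> 1 < 1"
  proof (rule ccontr)
    assume "\<not> \<rho> 1 < 1"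
    then have "\<rho> 0 < mean_phi0 L lam mu a 0" using assms(8) le[of 0] by auto
    moreover have "mean_phi0 L lam mu a 0 = 0"
    proof -
      have "qs_phi L a 0 0 n = 0" for n
        using qs_phi_0_bounds(1)[of 0 n] qs_theta0_le[of 0 "\<lambda>j. a j * real (n j)" L] by (simp add: qs_phi_0)
      then show ?thesis by (simp add: mean_phi0_def)
    qed
    ultimately show False using divide_pos_pos[OF pos(1,2)] by (simp add: \<rho>)
  qed
  then have "lam 1 < mu 1" unfolding \<rho> using pos by (simp add: divide_less_eq)
  moreover have "Inf (mean_phi0 L lam mu a ` ?A) \<le> mean_phi0 L lam mu a x" if "1 - lam 1 / mu 1 \<le> x" "x \<le> 1" for x
    using that \<open>\<rho> 1 < 1\<close> unfolding \<rho>[symmetric] by (intro le) auto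
  ultimately show ?thesis
    using assms(6,8) by (intro network_positive_recurrent) (auto simp: \<rho>)
qed

end
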